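(* Consider black-peg Mastermind with $n$ positions and $k=k(n)$ colors. (i) If $k=\Omega(n)$, there exists a deterministic Codebreaker strategy using only black-peg answers that finds every secret code $z\in[k]^n$ (i.e., eventually guesses $z$) within $O(n\log\log n+k)$ guesses. (ii) If $k=o(n)$, there exists a deterministic Codebreaker strategy using only black-peg answers that finds every secret code within $O\!\left(n\log\!\left(\frac{\log n}{\log(n/k)}\right)\right)$ guesses. Moreover, these strategies can be realized by a deterministic polynomial-time algorithm (computing each next guess from the previous answers in polynomial time). The asymptotic notation refers to $n\to\infty$ and hides only absolute constants.
   Context: Mastermind with $n$ positions and $k$ colors: Codemaker fixes a secret code $z\in[k]^n$, $[k]=\{1,\dots,k\}$. In each round Codebreaker guesses $x\in[k]^n$ and, in black-peg Mastermind, receives only $\mathrm{eq}(z,x)=|\{i\in[n]: z_i=x_i\}|$. Codebreaker wins when he guesses $z$. $\log$ is the binary logarithm.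
   Formalization: In part (ii) the bound is claimed only for those n with k(n) ≥ 2, because for k = 1 the stated bound equals n·log(1) = 0 although at least one guess is always needed. *)

theory Defs
  imports Complex_Main "HOL-Library.FuncSet" "HOL-Library.Landau_Symbols"
begin

section \<open>Black-peg Mastermind\<close>

type_synonym code = "nat \<Rightarrow> nat"

definition codes :: "nat \<Rightarrow> nat \<Rightarrow> code set" where
  "codes n k = ({1..n} \<rightarrow>\<^sub>E {1..k})"

definition black_pegs :: "nat \<Rightarrow> code \<Rightarrow> code \<Rightarrow> nat" where
  "black_pegs n z x = card {i \<in> {1..n}. z i = x i}"

text \<open>
  A deterministic strategy maps the list of answers received so far (oldest first) to the
  next guess.  The earlier guesses need not be supplied, since they are determined by the
  earlier answers.
\<close>

type_synonym strategy = "nat list \<Rightarrow> code"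

definition valid_strategy :: "nat \<Rightarrow> nat \<Rightarrow> strategy \<Rightarrow> bool" where
  "valid_strategy n k \<sigma> \<longleftrightarrow> (\<forall>as. \<sigma> as \<in> codes n k)"

primrec answers :: "nat \<Rightarrow> strategy \<Rightarrow> code \<Rightarrow> nat \<Rightarrow> nat list" where
  "answers n \<sigma> z 0 = []"
| "answers n \<sigma> z (Suc t) = answers n \<sigma> z t @ [black_pegs n z (\<sigma> (answers n \<sigma> z t))]"

text \<open>Rounds are counted from 0: the guess of round \<open>t\<close> is made after \<open>t\<close> answers.\<close>

definition nth_guess :: "nat \<Rightarrow> strategy \<Rightarrow> code \<Rightarrow> nat \<Rightarrow> code" where
  "nth_guess n \<sigma> z t = \<sigma> (answers n \<sigma> z t)"

definition wins_within :: "nat \<Rightarrow> nat \<Rightarrow> strategy \<Rightarrow> real \<Rightarrow> bool" where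
  "wins_within n k \<sigma> B \<longleftrightarrow>
     valid_strategy n k \<sigma> \<and>
     (\<forall>z \<in> codes n k. \<exists>t. real (Suc t) \<le> B \<and> nth_guess n \<sigma> z t = z)"

section \<open>Polynomial time\<close>

text \<open>
  The machine model is a random access machine in structured form: while programs over
  finitely many zero-initialised arrays of natural numbers (a scalar variable is cell 0 of
  an array), with unit cost for every operation.  The arithmetic operations are only
  addition and truncated subtraction, so that the largest number in memory at most doubles
  with each operation and stored numbers have at most linearly many bits in the running
  time; hence polynomial time here is polynomial time on Turing machines.  (Unit-cost
  multiplication would destroy this.)
\<close>

type_synonym vname = string
type_synonym state = "vname \<Rightarrow> nat \<Rightarrow> nat"

datatype aexp = Num nat | Cell vname aexp | Plus aexp aexp | Monus aexp aexp

datatype bexp = Less aexp aexp | Neg bexp | Conj bexp bexp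

datatype com =
    Skip
  | Assign vname aexp aexp  (* array, index, value *)
  | Seq com com
  | If bexp com com
  | While bexp com

primrec aval :: "aexp \<Rightarrow> state \<Rightarrow> nat" where
  "aval (Num c) s = c"
| "aval (Cell x i) s = s x (aval i s)"
| "aval (Plus a b) s = aval a s + aval b s"
| "aval (Monus a b) s = aval a s - aval b s"

primrec acost :: "aexp \<Rightarrow> nat" where
  "acost (Num c) = 1"
| "acost (Cell x i) = 1 + acost i"
| "acost (Plus a b) = 1 + acost a + acost b"
| "acost (Monus a b) = 1 + acost a + acost b"

primrec bval :: "bexp \<Rightarrow> state \<Rightarrow> bool" where
  "bval (Less a b) s = (aval a s < aval b s)"
| "bval (Neg b) s = (\<not> bval b s)"
| "bval (Conj b c) s = (bval b s \<and> bval c s)"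

primrec bcost :: "bexp \<Rightarrow> nat" where
  "bcost (Less a b) = 1 + acost a + acost b"
| "bcost (Neg b) = 1 + bcost b"
| "bcost (Conj b c) = 1 + bcost b + bcost c"

text \<open>\<open>exec p s m s'\<close>: started in \<open>s\<close>, \<open>p\<close> halts in \<open>s'\<close> after exactly \<open>m\<close> steps.\<close>

inductive exec :: "com \<Rightarrow> state \<Rightarrow> nat \<Rightarrow> state \<Rightarrow> bool" where
  Skip: "exec Skip s 1 s"
| Assign: "exec (Assign x i a) s (1 + acost i + acost a)
     (s(x := (s x)(aval i s := aval a s)))"
| Seq: "exec p s m s' \<Longrightarrow> exec q s' m' s'' \<Longrightarrow> exec (Seq p q) s (m + m') s''"
| IfTrue: "bval b s \<Longrightarrow> exec p s m s' \<Longrightarrow> exec (If b p q) s (1 + bcost b + m) s'"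
| IfFalse: "\<not> bval b s \<Longrightarrow> exec q s m s' \<Longrightarrow> exec (If b p q) s (1 + bcost b + m) s'"
| WhileFalse: "\<not> bval b s \<Longrightarrow> exec (While b p) s (1 + bcost b) s"
| WhileTrue: "bval b s \<Longrightarrow> exec p s m s' \<Longrightarrow> exec (While b p) s' m' s'' \<Longrightarrow>
     exec (While b p) s (1 + bcost b + m + m') s''"

definition input_state :: "nat \<Rightarrow> nat \<Rightarrow> nat list \<Rightarrow> state" where
  "input_state n k as = (\<lambda>_ _. 0)
     (''n'' := (\<lambda>_. 0)(0 := n),
      ''k'' := (\<lambda>_. 0)(0 := k),
      ''t'' := (\<lambda>_. 0)(0 := length as),
      ''answer'' := (\<lambda>i. if i < length as then as ! i else 0))"

text \<open>
  One fixed program serves all \<open>n\<close> and \<open>k\<close>: given \<open>n\<close>, \<open>k\<close> and the answers so far, it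
  leaves the next guess in cells \<open>1\<close> to \<open>n\<close> of the array \<open>guess\<close>.  Only situations in which
  a guess has to be made matter, that is, answer sequences of games not yet won.
\<close>

definition polynomial_time :: "(nat \<Rightarrow> nat \<Rightarrow> strategy) \<Rightarrow> bool" where
  "polynomial_time \<sigma> \<longleftrightarrow>
     (\<exists>p c d. \<forall>n\<ge>1. \<forall>k\<ge>1. \<forall>z \<in> codes n k. \<forall>t.
        (\<forall>s<t. nth_guess n (\<sigma> n k) z s \<noteq> z) \<longrightarrow>
        (\<exists>m s'. exec p (input_state n k (answers n (\<sigma> n k) z t)) m s' \<and>
           m \<le> c * (n + k) ^ d \<and>
           (\<forall>i \<in> {1..n}. s' ''guess'' i = nth_guess n (\<sigma> n k) z t i)))"

end

theory Submission
  imports Defs "HOL-Library.Nat_Bijection"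
begin

text \<open>
  One strategy serves both parts.  It first asks the \<open>k\<close> constant guesses.  Guesses using only the
  colours 1 and 2 then reveal where these two colours are, hence a colour that is wrong at each
  position.  Filling up with these, Codebreaker can query the number of matches of any partial
  guess.

  The positions are the leaves of a binary tree, and level by level one determines for every node
  and colour how often the colour occurs below the node.  The root counts are known, and a left child
  determines its sibling, so that the \<open>2 ^ l\<close> nodes of level \<open>l\<close> can be treated in
  parallel: in round \<open>r\<close> every node contributes its colour of rank \<open>r\<close> by frequency, which
  occurs at most \<open>w / (r + 1)\<close> times among the \<open>w\<close> leaves below.  The unknown left counts are numbers of
  \<open>j = O(1 + log (w / (r + 1)))\<close> bits, and the detecting matrix of Lindstroem finds
  \<open>2 ^ l\<close> of them with \<open>O(2 ^ l j / (l + 1))\<close> subset queries.  Summing over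
  \<open>r < min k w\<close> and all levels gives \<open>O(n (1 / (D + 1) + ln (L / (D + 1))))\<close> questions, where
  \<open>L\<close> is about \<open>log n\<close> and \<open>D\<close> about \<open>log (n / k)\<close>.

  For the running time, the strategy is written in a small language of bounded loops, compiled to the
  random access machine.
\<close>

section \<open>A language with bounded loops\<close>

text \<open>An answer about \<open>2 ^ l\<close> nodes at once carries roughly \<open>l\<close>
  bits, which is why level \<open>l\<close> gains a factor \<open>l + 1\<close> over asking node by
  node; the sum of \<open>1 / (l + 1)\<close> over the levels is the source of the iterated
  logarithm. Sorting colours by frequency removes the other logarithm: the bit lengths of
  \<open>w / (r + 1)\<close> over all ranks \<open>r\<close> add up to \<open>O(w)\<close>, whereas
  \<open>w\<close> counts of full length would cost \<open>O(w log w)\<close>. If \<open>k\<close>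
  is much smaller than \<open>w\<close>, only \<open>k\<close> colours are counted, and the cost of
  a level falls geometrically from level \<open>D\<close> towards the root. The obstacle on the
  machine side is that a strategy sees nothing but the list of answers. Each call therefore replays
  the program from the start, and correctness is transferred from one run with an oracle that knows
  the code. Cutting loops off makes the time bound a matter of syntax; the price is that arithmetic
  is truncated and must be shown exact on the numbers that occur.\<close>

primrec itr :: "(nat \<Rightarrow> 'a \<Rightarrow> 'a) \<Rightarrow> nat \<Rightarrow> 'a \<Rightarrow> 'a" where
  "itr f 0 x = x"
| "itr f (Suc n) x = f n (itr f n x)"

definition upd :: "vname \<Rightarrow> nat \<Rightarrow> nat \<Rightarrow> state \<Rightarrow> state" where
  "upd x i c s = s(x := (s x)(i := c))"

text \<open>
  Variables are de Bruijn indices into an environment.  All loops are cut off after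
  \<open>s ''N'' 0\<close> rounds, which makes every program polynomial in that number.
\<close>

datatype ex = ENum nat | EVar nat | ECell vname ex | EAdd ex ex | ESub ex ex
  | EIf ex ex ex ex | ERec ex ex ex

primrec eval :: "ex \<Rightarrow> (nat \<Rightarrow> nat) \<Rightarrow> state \<Rightarrow> nat" where
  "eval (ENum c) v s = c"
| "eval (EVar i) v s = v i"
| "eval (ECell x a) v s = s x (eval a v s)"
| "eval (EAdd a b) v s = eval a v s + eval b v s"
| "eval (ESub a b) v s = eval a v s - eval b v s"
| "eval (EIf a b c d) v s = (if eval a v s < eval b v s then eval c v s else eval d v s)"
| "eval (ERec a b e) v s =
     itr (\<lambda>i x. eval e (case_nat i (case_nat x v)) s) (min (eval a v s) (s ''N'' 0)) (eval b v s)"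

primrec ereads :: "ex \<Rightarrow> vname set" where
  "ereads (ENum c) = {}"
| "ereads (EVar i) = {}"
| "ereads (ECell x a) = insert x (ereads a)"
| "ereads (EAdd a b) = ereads a \<union> ereads b"
| "ereads (ESub a b) = ereads a \<union> ereads b"
| "ereads (EIf a b c d) = ereads a \<union> ereads b \<union> ereads c \<union> ereads d"
| "ereads (ERec a b e) = insert ''N'' (ereads a \<union> ereads b \<union> ereads e)"

datatype st = SSkip | SAsk | SSet vname ex ex | SSeq st st | SIf ex ex st st | SFor ex st

text \<open>\<open>SAsk\<close> has no meaning of its own: the oracle \<open>A\<close> is a
  parameter, so that one program can run both with the replaying \<open>ask\<close> and with
  \<open>honest\<close>.\<close>

primrec run :: "(state \<Rightarrow> state) \<Rightarrow> st \<Rightarrow> (nat \<Rightarrow> nat) \<Rightarrow> state \<Rightarrow> state" where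
  "run A SSkip v s = s"
| "run A SAsk v s = A s"
| "run A (SSet x a b) v s = upd x (eval a v s) (eval b v s) s"
| "run A (SSeq p q) v s = run A q v (run A p v s)"
| "run A (SIf a b p q) v s = (if eval a v s < eval b v s then run A p v s else run A q v s)"
| "run A (SFor b p) v s =
     itr (\<lambda>i. run A p (case_nat i v)) (min (eval b v s) (s ''N'' 0)) s"

primrec sreads :: "st \<Rightarrow> vname set" where
  "sreads SSkip = {}"
| "sreads SAsk = {}"
| "sreads (SSet x a b) = ereads a \<union> ereads b"
| "sreads (SSeq p q) = sreads p \<union> sreads q"
| "sreads (SIf a b p q) = ereads a \<union> ereads b \<union> sreads p \<union> sreads q"
| "sreads (SFor b p) = insert ''N'' (ereads b \<union> sreads p)"

primrec swrites :: "st \<Rightarrow> vname set" where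
  "swrites SSkip = {}"
| "swrites SAsk = {}"
| "swrites (SSet x a b) = {x}"
| "swrites (SSeq p q) = swrites p \<union> swrites q"
| "swrites (SIf a b p q) = swrites p \<union> swrites q"
| "swrites (SFor b p) = swrites p"

lemma eval_cong: "(\<And>x. x \<in> ereads e \<Longrightarrow> s x = s' x) \<Longrightarrow> eval e v s = eval e v s'"
proof (induction e arbitrary: v)
  case (ERec a b e)
  have "eval a v s = eval a v s'" "eval b v s = eval b v s'" "s ''N'' = s' ''N''"
    using ERec by auto
  moreover have "eval e w s = eval e w s'" for w
    using ERec by auto
  ultimately show ?case by simp
qed auto

section \<open>Compilation\<close>

text \<open>Weakens the exact cost of \<open>exec\<close> to an upper bound, so that the branches of
  a conditional and the rounds of a loop can share one bound.\<close>

definition runs :: "com \<Rightarrow> state \<Rightarrow> nat \<Rightarrow> state \<Rightarrow> bool" where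
  "runs p s b s' \<longleftrightarrow> (\<exists>m\<le>b. exec p s m s')"

lemma runs_mono: "runs p s b s' \<Longrightarrow> b \<le> b' \<Longrightarrow> runs p s b' s'"
  unfolding runs_def by (meson order_trans)

lemma runs_Skip: "runs Skip s 1 s"
  unfolding runs_def by (blast intro: exec.Skip)

lemma runs_Assign: "runs (Assign x a b) s (1 + acost a + acost b) (upd x (aval a s) (aval b s) s)"
  unfolding runs_def upd_def by (blast intro: exec.Assign)

lemma runs_Seq: "runs p s b s' \<Longrightarrow> runs q s' b' s'' \<Longrightarrow> runs (Seq p q) s (b + b') s''"
  unfolding runs_def by (meson add_mono exec.Seq)

lemma runs_If:
  assumes "bval c s \<Longrightarrow> runs p s b s'" "\<not> bval c s \<Longrightarrow> runs q s b s'"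
  shows "runs (If c p q) s (1 + bcost c + b) s'"
proof (cases "bval c s")
  case True
  then obtain m where "m \<le> b" "exec p s m s'" using assms(1) by (auto simp: runs_def)
  then show ?thesis
    unfolding runs_def using exec.IfTrue[OF True] by (meson add_left_mono)
next
  case False
  then obtain m where "m \<le> b" "exec q s m s'" using assms(2) by (auto simp: runs_def)
  then show ?thesis
    unfolding runs_def using exec.IfFalse[OF False] by (meson add_left_mono)
qed

lemma runs_while_step:
  assumes "bval c s" "runs p s b s'" "runs (While c p) s' b' s''"
  shows "runs (While c p) s (1 + bcost c + b + b') s''"
proof -
  obtain m m' where "m \<le> b" "exec p s m s'" "m' \<le> b'" "exec (While c p) s' m' s''"
    using assms by (auto simp: runs_def)
  then show ?thesis
    unfolding runs_def using exec.WhileTrue[OF assms(1)]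
    by (intro exI[of _ "1 + bcost c + m + m'"]) auto
qed

abbreviation stk :: "nat \<Rightarrow> aexp" where
  "stk d \<equiv> Cell ''stack'' (Num d)"

abbreviation put :: "nat \<Rightarrow> aexp \<Rightarrow> com" where
  "put d a \<equiv> Assign ''stack'' (Num d) a"

lemma runs_put:
  "b \<ge> 2 + acost a \<Longrightarrow> runs (put d a) s b (upd ''stack'' d (aval a s) s)"
  by (rule runs_mono[OF runs_Assign[of "''stack''" "Num d" a s, simplified]]) auto

text \<open>The induction counts the remaining rounds \<open>x\<close>, the counter being
  \<open>b - x\<close>. Each test of the guard costs 6: \<open>bcost\<close> is 5 for two stack
  cells with constant index, and the loop adds 1.\<close>

lemma runs_count_loop:
  assumes I: "I 0 s"
    and ctr: "\<And>i s. I i s \<Longrightarrow> s ''stack'' ci = i \<and> s ''stack'' bi = b"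
    and step: "\<And>i s. i < b \<Longrightarrow> I i s \<Longrightarrow> \<exists>s'. runs p s c s' \<and> I (Suc i) s'"
  shows "\<exists>s'. runs (While (Less (stk ci) (stk bi)) p) s ((b + 1) * (c + 6)) s' \<and> I b s'"
proof -
  let ?W = "While (Less (stk ci) (stk bi)) p"
  have "\<exists>s'. runs ?W s ((x + 1) * (c + 6)) s' \<and> I b s'" if "I (b - x) s" "x \<le> b" for x s
    using that
  proof (induction x arbitrary: s)
    case 0
    then have "\<not> bval (Less (stk ci) (stk bi)) s" using ctr[of b s] by auto
    from exec.WhileFalse[OF this, of p] have "runs ?W s 6 s"
      unfolding runs_def by (intro exI[of _ 6]) (simp add: numeral_eq_Suc)
    then show ?case using 0 runs_mono[of ?W s 6 s "c + 6"] by auto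
  next
    case (Suc x)
    then obtain s1 where s1: "runs p s c s1" "I (Suc (b - Suc x)) s1"
      using step[of "b - Suc x" s] by auto
    have "Suc (b - Suc x) = b - x" using Suc.prems by simp
    then obtain s2 where s2: "runs ?W s1 ((x + 1) * (c + 6)) s2" "I b s2"
      using Suc.IH[of s1] s1 Suc.prems by auto
    have "bval (Less (stk ci) (stk bi)) s" using ctr[OF Suc.prems(1)] Suc.prems(2) by auto
    from runs_while_step[OF this s1(1) s2(1)]
    have "runs ?W s (6 + c + (x + 1) * (c + 6)) s2" by (simp add: numeral_eq_Suc)
    then show ?case using s2(2) by (auto simp: algebra_simps)
  qed
  from this[of b s] I show ?thesis by simp
qed

section \<open>Compilation of expressions\<close>

definition keeps :: "nat \<Rightarrow> state \<Rightarrow> state \<Rightarrow> bool" where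
  "keeps d s s' \<longleftrightarrow> (\<forall>i<d. s' ''stack'' i = s ''stack'' i)"

definition same :: "state \<Rightarrow> state \<Rightarrow> bool" where
  "same s s' \<longleftrightarrow> (\<forall>x. x \<noteq> ''stack'' \<longrightarrow> s' x = s x)"

lemma same_refl: "same s s" by (simp add: same_def)
lemma same_put: "same s s' \<Longrightarrow> same s (upd ''stack'' d c s')" by (simp add: same_def upd_def)
lemma keeps_refl: "keeps d s s" by (simp add: keeps_def)
lemma keeps_trans: "keeps d s s' \<Longrightarrow> keeps d' s' s'' \<Longrightarrow> d \<le> d' \<Longrightarrow> keeps d s s''"
  by (simp add: keeps_def)
lemma keeps_put: "keeps d s s' \<Longrightarrow> d \<le> d' \<Longrightarrow> keeps d s (upd ''stack'' d' c s')"
  by (simp add: keeps_def upd_def)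
lemma stack_put: "upd ''stack'' d c s ''stack'' i = (if i = d then c else s ''stack'' i)"
  by (simp add: upd_def)

text \<open>Stack discipline: variable \<open>i\<close> lives in cell \<open>pos i\<close> below
  \<open>d\<close>, the result is left in cell \<open>d\<close>, and nothing below \<open>d\<close>
  changes. A recursion keeps its bound in \<open>d\<close>, the accumulator in \<open>d + 1\<close>
  and the counter in \<open>d + 2\<close>; its body sees the counter as variable 0 and the
  accumulator as variable 1.\<close>

primrec cmp :: "ex \<Rightarrow> (nat \<Rightarrow> nat) \<Rightarrow> nat \<Rightarrow> com" where
  "cmp (ENum c) pos d = put d (Num c)"
| "cmp (EVar i) pos d = put d (stk (pos i))"
| "cmp (ECell x a) pos d = Seq (cmp a pos d) (put d (Cell x (stk d)))"
| "cmp (EAdd a b) pos d =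
     Seq (cmp a pos d) (Seq (cmp b pos (d + 1)) (put d (Plus (stk d) (stk (d + 1)))))"
| "cmp (ESub a b) pos d =
     Seq (cmp a pos d) (Seq (cmp b pos (d + 1)) (put d (Monus (stk d) (stk (d + 1)))))"
| "cmp (EIf a b e f) pos d =
     Seq (cmp a pos d) (Seq (cmp b pos (d + 1))
       (If (Less (stk d) (stk (d + 1))) (cmp e pos d) (cmp f pos d)))"
| "cmp (ERec a b e) pos d =
     Seq (cmp a pos d)
    (Seq (If (Less (Cell ''N'' (Num 0)) (stk d)) (put d (Cell ''N'' (Num 0))) Skip)
    (Seq (cmp b pos (d + 1))
    (Seq (put (d + 2) (Num 0))
    (Seq (While (Less (stk (d + 2)) (stk d))
           (Seq (cmp e (case_nat (d + 2) (case_nat (d + 1) pos)) (d + 3))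
           (Seq (put (d + 1) (stk (d + 3)))
                (put (d + 2) (Plus (stk (d + 2)) (Num 1))))))
         (put d (stk (d + 1)))))))"

primrec ecost :: "ex \<Rightarrow> nat \<Rightarrow> nat" where
  "ecost (ENum c) N = 20"
| "ecost (EVar i) N = 20"
| "ecost (ECell x a) N = ecost a N + 20"
| "ecost (EAdd a b) N = ecost a N + ecost b N + 20"
| "ecost (ESub a b) N = ecost a N + ecost b N + 20"
| "ecost (EIf a b c d) N = ecost a N + ecost b N + ecost c N + ecost d N + 20"
| "ecost (ERec a b e) N = ecost a N + ecost b N + 40 + (N + 1) * (ecost e N + 40)"

lemma clip_runs:
  assumes "b \<ge> 20"
  shows "runs (If (Less (Cell ''N'' (Num 0)) (stk d)) (put d (Cell ''N'' (Num 0))) Skip) s b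
           (upd ''stack'' d (min (s ''stack'' d) (s ''N'' 0)) s)"
proof -
  have "runs (If (Less (Cell ''N'' (Num 0)) (stk d)) (put d (Cell ''N'' (Num 0))) Skip) s
     (1 + bcost (Less (Cell ''N'' (Num 0)) (stk d)) + 4)
           (upd ''stack'' d (min (s ''stack'' d) (s ''N'' 0)) s)"
  proof (rule runs_If)
    assume *: "bval (Less (Cell ''N'' (Num 0)) (stk d)) s"
    have "runs (put d (Cell ''N'' (Num 0))) s 4 (upd ''stack'' d (s ''N'' 0) s)"
      using runs_put[of "Cell ''N'' (Num 0)" 4 d s] by simp
    with * show "runs (put d (Cell ''N'' (Num 0))) s 4
        (upd ''stack'' d (min (s ''stack'' d) (s ''N'' 0)) s)" by (simp add: min_def)
  next
    assume *: "\<not> bval (Less (Cell ''N'' (Num 0)) (stk d)) s"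
    then have "upd ''stack'' d (min (s ''stack'' d) (s ''N'' 0)) s = s"
      by (auto simp: upd_def min_def fun_eq_iff)
    then show "runs Skip s 4 (upd ''stack'' d (min (s ''stack'' d) (s ''N'' 0)) s)"
      using runs_mono[OF runs_Skip] by auto
  qed
  then show ?thesis using assms by (auto elim!: runs_mono)
qed

text \<open>Two states are involved because the source semantics has no stack: \<open>s\<close> is
  the machine state, \<open>s0\<close> the state in which the source is evaluated, and they agree
  outside the stack array.\<close>

definition compiled :: "ex \<Rightarrow> bool" where
  "compiled e \<longleftrightarrow> (\<forall>pos d s s0 v. (\<forall>i. pos i < d) \<longrightarrow> (\<forall>i. s ''stack'' (pos i) = v i) \<longrightarrow> same s0 s \<longrightarrow>
     (\<exists>s'. runs (cmp e pos d) s (ecost e (s0 ''N'' 0)) s' \<and> same s0 s' \<and> keeps d s s' \<and>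
        s' ''stack'' d = eval e v s0))"

lemma compiledD:
  assumes "compiled e" "\<And>i. pos i < d" "\<And>i. s ''stack'' (pos i) = v i" "same s0 s"
  shows "\<exists>s'. runs (cmp e pos d) s (ecost e (s0 ''N'' 0)) s' \<and> same s0 s' \<and> keeps d s s' \<and>
    s' ''stack'' d = eval e v s0 \<and> (\<forall>i. s' ''stack'' (pos i) = v i)"
proof -
  obtain s' where s': "runs (cmp e pos d) s (ecost e (s0 ''N'' 0)) s'" "same s0 s'" "keeps d s s'"
    "s' ''stack'' d = eval e v s0"
    using assms unfolding compiled_def by blast
  moreover have "s' ''stack'' (pos i) = v i" for i
    using s'(3) assms(2,3)[of i] by (simp add: keeps_def)
  ultimately show ?thesis by auto
qed

text \<open>In continuation form: the code \<open>c\<close> that consumes both operands is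
  arbitrary, which matches the right-nested \<open>Seq\<close> of every construct with two
  operands.\<close>

lemma compiled_pairE:
  assumes "compiled a" "compiled b" "\<And>i. pos i < d" "\<And>i. s ''stack'' (pos i) = v i" "same s0 s"
  obtains s' where
    "\<And>c B t. runs c s' B t \<Longrightarrow> runs (Seq (cmp a pos d) (Seq (cmp b pos (d + 1)) c)) s
       (ecost a (s0 ''N'' 0) + ecost b (s0 ''N'' 0) + B) t"
    "same s0 s'" "keeps d s s'" "s' ''stack'' d = eval a v s0" "s' ''stack'' (d + 1) = eval b v s0"
    "\<And>i. s' ''stack'' (pos i) = v i"
proof -
  obtain s1 where s1: "runs (cmp a pos d) s (ecost a (s0 ''N'' 0)) s1" "same s0 s1" "keeps d s s1"
    "s1 ''stack'' d = eval a v s0" "\<And>i. s1 ''stack'' (pos i) = v i"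
    using compiledD[of a pos d s v s0, OF assms(1,3-5)] by auto
  have p1: "pos i < d + 1" for i using assms(3)[of i] by simp
  obtain s2 where
    s2: "runs (cmp b pos (d + 1)) s1 (ecost b (s0 ''N'' 0)) s2" "same s0 s2" "keeps (d + 1) s1 s2"
      "s2 ''stack'' (d + 1) = eval b v s0" "\<And>i. s2 ''stack'' (pos i) = v i"
    using compiledD[of b pos "d + 1" s1 v s0, OF assms(2) p1 s1(5,2)] by auto
  show thesis
  proof (rule that[of s2])
    show "runs (Seq (cmp a pos d) (Seq (cmp b pos (d + 1)) c)) s
       (ecost a (s0 ''N'' 0) + ecost b (s0 ''N'' 0) + B) t" if "runs c s2 B t" for c B t
      using runs_Seq[OF s1(1) runs_Seq[OF s2(1) that]] by (simp add: add.assoc)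
    show "keeps d s s2" using keeps_trans[OF s1(3) s2(3)] by simp
    show "s2 ''stack'' d = eval a v s0" using s1(4) s2(3) by (simp add: keeps_def)
  qed (fact s2)+
qed

lemma runs_put_stack:
  assumes "aval a s = c" "acost a \<le> 10" "same s0 s" "keeps d t s"
  shows "\<exists>s'. runs (put d a) s 20 s' \<and> same s0 s' \<and> keeps d t s' \<and> s' ''stack'' d = c"
  using runs_put[of a 20 d s] assms
  by (intro exI[of _ "upd ''stack'' d c s"]) (simp add: same_put keeps_put stack_put)

lemma compiled_binary:
  assumes "compiled a" "compiled b"
    and op: "\<And>x y s. aval (op x y) s = f (aval x s) (aval y s)" "\<And>x y. acost (op x y) = 1 + acost x + acost y"
    and e: "\<And>pos d. cmp e pos d =
        Seq (cmp a pos d) (Seq (cmp b pos (d + 1)) (put d (op (stk d) (stk (d + 1)))))"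
      "\<And>v s. eval e v s = f (eval a v s) (eval b v s)" "\<And>N. ecost e N = ecost a N + ecost b N + 20"
  shows "compiled e"
  unfolding compiled_def
proof (intro allI impI)
  fix pos :: "nat \<Rightarrow> nat" and d s s0 v
  assume p: "\<forall>i. pos i < d" "\<forall>i. s ''stack'' (pos i) = v i" "same s0 s"
  obtain s1 where s1: "\<And>c B t. runs c s1 B t \<Longrightarrow> runs (Seq (cmp a pos d) (Seq (cmp b pos (d + 1)) c)) s
     (ecost a (s0 ''N'' 0) + ecost b (s0 ''N'' 0) + B) t" "same s0 s1" "keeps d s s1"
    "s1 ''stack'' d = eval a v s0" "s1 ''stack'' (d + 1) = eval b v s0"
    by (rule compiled_pairE[OF assms(1,2), of pos d s v s0]) (use p in auto)
  obtain s2 where s2: "runs (put d (op (stk d) (stk (d + 1)))) s1 20 s2" "same s0 s2" "keeps d s s2"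
    "s2 ''stack'' d = eval e v s0"
    using runs_put_stack[OF _ _ s1(2,3), of "op (stk d) (stk (d + 1))" "eval e v s0"] s1(4,5)
    by (auto simp: op e(2))
  then show "\<exists>s'. runs (cmp e pos d) s (ecost e (s0 ''N'' 0)) s' \<and> same s0 s' \<and>
      keeps d s s' \<and> s' ''stack'' d = eval e v s0"
    unfolding e using s1(1)[OF s2(1)] by blast
qed

lemma cmp_correct: "''stack'' \<notin> ereads e \<Longrightarrow> compiled e"
proof (induction e)
  case (ENum c)
  show ?case
    unfolding compiled_def using runs_put_stack[of "Num c"] by (simp add: keeps_refl)
next
  case (EVar i)
  show ?case
    unfolding compiled_def using runs_put_stack[of "stk _"] by (simp add: keeps_refl)
next
  case (ECell x a)
  show ?case
    unfolding compiled_def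
  proof (intro allI impI)
    fix pos :: "nat \<Rightarrow> nat" and d s s0 v
    assume p: "\<forall>i. pos i < d" "\<forall>i. s ''stack'' (pos i) = v i" "same s0 s"
    have c: "compiled a" using ECell by simp
    have p': "\<And>i. pos i < d" "\<And>i. s ''stack'' (pos i) = v i" using p by auto
    obtain s1 where s1: "runs (cmp a pos d) s (ecost a (s0 ''N'' 0)) s1"
      "same s0 s1" "keeps d s s1" "s1 ''stack'' d = eval a v s0"
      using compiledD[of a pos d s v s0, OF c p' p(3)] by auto
    have "x \<noteq> ''stack''" using ECell.prems by auto
    then have "s1 x = s0 x" using s1(2) by (simp add: same_def)
    then obtain s2 where s2: "runs (put d (Cell x (stk d))) s1 20 s2" "same s0 s2" "keeps d s s2"
      "s2 ''stack'' d = s0 x (eval a v s0)"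
      using runs_put_stack[of "Cell x (stk d)" s1 _ s0 d s] s1 by auto
    show "\<exists>s'. runs (cmp (ECell x a) pos d) s (ecost (ECell x a) (s0 ''N'' 0)) s' \<and> same s0 s' \<and>
        keeps d s s' \<and> s' ''stack'' d = eval (ECell x a) v s0"
      using runs_Seq[OF s1(1) s2(1)] s2 by (intro exI[of _ s2]) simp
  qed
next
  case (EAdd a b)
  then show ?case
    by (intro compiled_binary[where f = "(+)" and op = Plus and e = "EAdd a b"]) auto
next
  case (ESub a b)
  then show ?case
    by (intro compiled_binary[where f = "(-)" and op = Monus and e = "ESub a b"]) auto
next
  case (EIf a b e f)
  show ?case
    unfolding compiled_def
  proof (intro allI impI)
    fix pos :: "nat \<Rightarrow> nat" and d s s0 v
    assume p: "\<forall>i. pos i < d" "\<forall>i. s ''stack'' (pos i) = v i" "same s0 s"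
    have c: "compiled a" "compiled b" "compiled e" "compiled f" using EIf by auto
    obtain s1 where s1: "\<And>c B t. runs c s1 B t \<Longrightarrow> runs (Seq (cmp a pos d) (Seq (cmp b pos (d + 1)) c)) s
       (ecost a (s0 ''N'' 0) + ecost b (s0 ''N'' 0) + B) t" "same s0 s1" "keeps d s s1"
      "s1 ''stack'' d = eval a v s0" "s1 ''stack'' (d + 1) = eval b v s0"
      "\<And>i. s1 ''stack'' (pos i) = v i"
      by (rule compiled_pairE[of a b pos d s v s0, OF c(1,2)]) (use p in auto)
    have p': "\<And>i. pos i < d" using p(1) by simp
    obtain s2 where s2: "runs (cmp e pos d) s1 (ecost e (s0 ''N'' 0)) s2" "same s0 s2"
      "keeps d s1 s2" "s2 ''stack'' d = eval e v s0"
      using compiledD[of e pos d s1 v s0, OF c(3) p' s1(6,2)] by auto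
    obtain s3 where s3: "runs (cmp f pos d) s1 (ecost f (s0 ''N'' 0)) s3" "same s0 s3"
      "keeps d s1 s3" "s3 ''stack'' d = eval f v s0"
      using compiledD[of f pos d s1 v s0, OF c(4) p' s1(6,2)] by auto
    let ?t = "if eval a v s0 < eval b v s0 then s2 else s3"
    have "runs (If (Less (stk d) (stk (d + 1))) (cmp e pos d) (cmp f pos d)) s1
        (1 + bcost (Less (stk d) (stk (d + 1))) + (ecost e (s0 ''N'' 0) + ecost f (s0 ''N'' 0))) ?t"
      by (rule runs_If) (use s1(4,5) s2(1) s3(1) in \<open>auto elim: runs_mono\<close>)
    from runs_mono[OF s1(1)[OF this], of "ecost (EIf a b e f) (s0 ''N'' 0)"]
    show "\<exists>s'. runs (cmp (EIf a b e f) pos d) s (ecost (EIf a b e f) (s0 ''N'' 0)) s' \<and> same s0 s' \<and>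
        keeps d s s' \<and> s' ''stack'' d = eval (EIf a b e f) v s0"
      using s2 s3 keeps_trans[OF s1(3)] by (intro exI[of _ ?t]) simp
  qed
next
  case (ERec a b e)
  show ?case
    unfolding compiled_def
  proof (intro allI impI)
    fix pos :: "nat \<Rightarrow> nat" and d s s0 v
    assume p: "\<forall>i. pos i < d" "\<forall>i. s ''stack'' (pos i) = v i" "same s0 s"
    let ?N = "s0 ''N'' 0"
    let ?F = "\<lambda>i x. eval e (case_nat i (case_nat x v)) s0"
    let ?b = "min (eval a v s0) ?N"
    have c: "compiled a" "compiled b" "compiled e" using ERec by auto
    have p': "\<And>i. pos i < d" "\<And>i. s ''stack'' (pos i) = v i" using p by auto
    obtain s1 where s1: "runs (cmp a pos d) s (ecost a ?N) s1" "same s0 s1" "keeps d s s1"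
        "s1 ''stack'' d = eval a v s0" "\<And>i. s1 ''stack'' (pos i) = v i"
      using compiledD[of a pos d s v s0, OF c(1) p' p(3)] by auto
    define s2 where "s2 = upd ''stack'' d ?b s1"
    have "s1 ''N'' = s0 ''N''" using s1(2) by (simp add: same_def)
    then have r2: "runs (If (Less (Cell ''N'' (Num 0)) (stk d)) (put d (Cell ''N'' (Num 0))) Skip) s1 20 s2"
      using clip_runs[of 20 d s1] s1(4) by (simp add: s2_def)
    have s2: "same s0 s2" "keeps d s s2" "s2 ''stack'' d = ?b"
      using s1 by (auto simp: s2_def same_put keeps_put stack_put)
    have p1: "pos i < d + 1" for i using p'(1)[of i] by simp
    have v2: "s2 ''stack'' (pos i) = v i" for i
      using s2(2) p'[of i] by (simp add: keeps_def)
    obtain s3 where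
      s3: "runs (cmp b pos (d + 1)) s2 (ecost b ?N) s3" "same s0 s3" "keeps (d + 1) s2 s3"
        "s3 ''stack'' (d + 1) = eval b v s0"
      using compiledD[of b pos "d + 1" s2 v s0, OF c(2) p1 v2 s2(1)] by auto
    define s4 where "s4 = upd ''stack'' (d + 2) 0 s3"
    have r4: "runs (put (d + 2) (Num 0)) s3 20 s4"
      using runs_put[of "Num 0" 20 "d + 2" s3] by (simp add: s4_def)
    let ?I = "\<lambda>i t. same s0 t \<and> keeps d s t \<and> t ''stack'' d = ?b \<and>
        t ''stack'' (d + 1) = itr ?F i (eval b v s0) \<and> t ''stack'' (d + 2) = i"
    let ?body = "Seq (cmp e (case_nat (d + 2) (case_nat (d + 1) pos)) (d + 3))
             (Seq (put (d + 1) (stk (d + 3))) (put (d + 2) (Plus (stk (d + 2)) (Num 1))))"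
    have "\<exists>s'. runs (While (Less (stk (d + 2)) (stk d)) ?body) s4
        ((?b + 1) * ((ecost e ?N + 20) + 6)) s' \<and> ?I ?b s'"
    proof (rule runs_count_loop[where I = ?I])
      show "?I 0 s4"
        using s2 s3 by (auto simp: s4_def same_put stack_put keeps_def)
    next
      fix i t assume "?I i t"
      then show "t ''stack'' (d + 2) = i \<and> t ''stack'' d = ?b" by simp
    next
      fix i t assume i: "i < ?b" and I: "?I i t"
      let ?pos = "case_nat (d + 2) (case_nat (d + 1) pos)"
      let ?v = "case_nat i (case_nat (itr ?F i (eval b v s0)) v)"
      have p3: "?pos l < d + 3" for l
        using p'(1)[of "l - 2"] by (auto split: nat.split simp: numeral_eq_Suc)
      have "t ''stack'' (pos l) = v l" for l
        using I p'[of l] by (simp add: keeps_def)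
      then have v3: "t ''stack'' (?pos l) = ?v l" for l
        using I by (auto split: nat.split)
      have st: "same s0 t" using I by simp
      obtain t1 where t1: "runs (cmp e ?pos (d + 3)) t (ecost e ?N) t1" "same s0 t1"
        "keeps (d + 3) t t1" "t1 ''stack'' (d + 3) = eval e ?v s0"
        using compiledD[of e ?pos "d + 3" t ?v s0, OF c(3) p3 v3 st] by auto
      define t2 where "t2 = upd ''stack'' (d + 1) (itr ?F (Suc i) (eval b v s0)) t1"
      define t3 where "t3 = upd ''stack'' (d + 2) (Suc i) t2"
      have q2: "runs (put (d + 1) (stk (d + 3))) t1 8 t2"
        using runs_put[of "stk (d + 3)" 8 "d + 1" t1] t1(4) by (simp add: t2_def)
      have "t2 ''stack'' (d + 2) = i" using t1(3) I by (simp add: t2_def stack_put keeps_def)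
      then have q3: "runs (put (d + 2) (Plus (stk (d + 2)) (Num 1))) t2 8 t3"
        using runs_put[of "Plus (stk (d + 2)) (Num 1)" 8 "d + 2" t2] by (simp add: t3_def)
      have "runs ?body t (ecost e ?N + 20) t3"
        using runs_Seq[OF t1(1) runs_Seq[OF q2 q3]] by (auto elim: runs_mono)
      moreover have "?I (Suc i) t3"
        using t1(2,3) I by (auto simp: t3_def t2_def stack_put keeps_def intro!: same_put)
      ultimately show "\<exists>s'. runs ?body t (ecost e ?N + 20) s' \<and> ?I (Suc i) s'" by blast
    qed
    then obtain s5 where s5: "runs (While (Less (stk (d + 2)) (stk d)) ?body) s4
        ((?b + 1) * (ecost e ?N + 20 + 6)) s5" "?I ?b s5" by blast
    have "(?b + 1) * (ecost e ?N + 20 + 6) \<le> (?N + 1) * (ecost e ?N + 26)"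
      by (intro mult_mono) auto
    then have s5': "runs (While (Less (stk (d + 2)) (stk d)) ?body) s4
        ((?N + 1) * (ecost e ?N + 26)) s5" using runs_mono[OF s5(1)] by blast
    define s6 where "s6 = upd ''stack'' d (eval (ERec a b e) v s0) s5"
    have r6: "runs (put d (stk (d + 1))) s5 10 s6"
      using runs_put[of "stk (d + 1)" 10 d s5] s5(2) by (simp add: s6_def)
    have "ecost a ?N + (20 + (ecost b ?N + (20 + ((?N + 1) * (ecost e ?N + 26) + 10))))
        \<le> ecost (ERec a b e) ?N" by (simp add: algebra_simps)
    from runs_mono[OF runs_Seq[OF s1(1) runs_Seq[OF r2 runs_Seq[OF s3(1)
        runs_Seq[OF r4 runs_Seq[OF s5' r6]]]]] this]
    have "runs (cmp (ERec a b e) pos d) s (ecost (ERec a b e) ?N) s6" by simp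
    moreover have "same s0 s6" "keeps d s s6" "s6 ''stack'' d = eval (ERec a b e) v s0"
      using s5(2) by (auto simp: s6_def stack_put intro!: same_put keeps_put)
    ultimately show "\<exists>s'. runs (cmp (ERec a b e) pos d) s (ecost (ERec a b e) ?N) s' \<and> same s0 s' \<and>
        keeps d s s' \<and> s' ''stack'' d = eval (ERec a b e) v s0" by blast
  qed
qed

section \<open>Compilation of statements\<close>

primrec cms :: "(nat \<Rightarrow> com) \<Rightarrow> st \<Rightarrow> (nat \<Rightarrow> nat) \<Rightarrow> nat \<Rightarrow> com" where
  "cms pa SSkip pos d = Skip"
| "cms pa SAsk pos d = pa d"
| "cms pa (SSet x a b) pos d =
     Seq (cmp a pos d) (Seq (cmp b pos (d + 1)) (Assign x (stk d) (stk (d + 1))))"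
| "cms pa (SSeq p q) pos d = Seq (cms pa p pos d) (cms pa q pos d)"
| "cms pa (SIf a b p q) pos d =
     Seq (cmp a pos d) (Seq (cmp b pos (d + 1))
       (If (Less (stk d) (stk (d + 1))) (cms pa p pos d) (cms pa q pos d)))"
| "cms pa (SFor b p) pos d =
     Seq (cmp b pos d)
    (Seq (If (Less (Cell ''N'' (Num 0)) (stk d)) (put d (Cell ''N'' (Num 0))) Skip)
    (Seq (put (d + 1) (Num 0))
         (While (Less (stk (d + 1)) (stk d))
           (Seq (cms pa p (case_nat (d + 1) pos) (d + 2))
                (put (d + 1) (Plus (stk (d + 1)) (Num 1)))))))"

primrec scost :: "(nat \<Rightarrow> nat) \<Rightarrow> st \<Rightarrow> nat \<Rightarrow> nat" where
  "scost ca SSkip N = 20"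
| "scost ca SAsk N = ca N"
| "scost ca (SSet x a b) N = ecost a N + ecost b N + 20"
| "scost ca (SSeq p q) N = scost ca p N + scost ca q N"
| "scost ca (SIf a b p q) N = ecost a N + ecost b N + scost ca p N + scost ca q N + 20"
| "scost ca (SFor b p) N = ecost b N + 40 + (N + 1) * (scost ca p N + 40)"

text \<open>\<open>pa d\<close> may use the stack cells from \<open>d\<close> on. The condition
  \<open>d > 0\<close> leaves at least one cell below for the constant environment in which
  \<open>ask_body\<close> is compiled; the last conjunct keeps the loop limit fixed.\<close>

definition implements :: "(nat \<Rightarrow> com) \<Rightarrow> (nat \<Rightarrow> nat) \<Rightarrow> (state \<Rightarrow> state) \<Rightarrow> bool" where
  "implements pa ca A \<longleftrightarrow> (\<forall>d>0. \<forall>s0 s1. same s0 s1 \<longrightarrow>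
     (\<exists>s'. runs (pa d) s1 (ca (s0 ''N'' 0)) s' \<and> same (A s0) s' \<and> keeps d s1 s' \<and>
        A s0 ''N'' = s0 ''N''))"

lemma same_upd: "same s s' \<Longrightarrow> same (upd x i c s) (upd x i c s')"
  by (simp add: same_def upd_def)

lemma cms_correct:
  assumes A: "implements pa ca A"
    and "''stack'' \<notin> sreads p" "''stack'' \<notin> swrites p" "''N'' \<notin> swrites p"
    and "\<And>i. pos i < d" "\<And>i. s ''stack'' (pos i) = v i" "same s0 s"
  shows "\<exists>s'. runs (cms pa p pos d) s (scost ca p (s0 ''N'' 0)) s' \<and> same (run A p v s0) s' \<and>
           keeps d s s' \<and> run A p v s0 ''N'' = s0 ''N''"
  using assms(2-)
proof (induction p arbitrary: pos d s v s0)
  case SSkip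
  then show ?case
    using runs_mono[OF runs_Skip, of 20 s] by (intro exI[of _ s]) (simp add: keeps_refl)
next
  case SAsk
  have "d > 0" using SAsk.prems(4)[of 0] by simp
  then show ?case using A SAsk.prems(6) by (auto simp: implements_def)
next
  case (SSet x a b)
  then have c: "compiled a" "compiled b" by (auto intro: cmp_correct)
  obtain s2 where s2: "\<And>c B t. runs c s2 B t \<Longrightarrow> runs (Seq (cmp a pos d) (Seq (cmp b pos (d + 1)) c)) s
     (ecost a (s0 ''N'' 0) + ecost b (s0 ''N'' 0) + B) t" "same s0 s2" "keeps d s s2"
    "s2 ''stack'' d = eval a v s0" "s2 ''stack'' (d + 1) = eval b v s0"
    by (rule compiled_pairE[of a b pos d s v s0, OF c SSet.prems(4-6)]) auto
  have "runs (Assign x (stk d) (stk (d + 1))) s2 20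
      (upd x (eval a v s0) (eval b v s0) s2)"
    using runs_mono[OF runs_Assign[of x "stk d" "stk (d + 1)" s2], of 20] s2(4,5) by simp
  moreover have "keeps d s (upd x (eval a v s0) (eval b v s0) s2)"
    using s2(3) SSet.prems(2) by (auto simp: keeps_def upd_def)
  moreover have "upd x (eval a v s0) (eval b v s0) s0 ''N'' = s0 ''N''"
    using SSet.prems(3) by (auto simp: upd_def)
  ultimately show ?case
    using s2(1)[of "Assign x (stk d) (stk (d + 1))" 20] same_upd[OF s2(2)]
    by (intro exI[of _ "upd x (eval a v s0) (eval b v s0) s2"]) simp
next
  case (SSeq p q)
  from SSeq.prems have r: "''stack'' \<notin> sreads p" "''stack'' \<notin> swrites p" "''N'' \<notin> swrites p"
    "''stack'' \<notin> sreads q" "''stack'' \<notin> swrites q" "''N'' \<notin> swrites q" by auto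
  obtain s1 where s1: "runs (cms pa p pos d) s (scost ca p (s0 ''N'' 0)) s1"
    "same (run A p v s0) s1" "keeps d s s1" "run A p v s0 ''N'' = s0 ''N''"
    using SSeq.IH(1)[of pos d s v s0, OF r(1-3) SSeq.prems(4-6)] by blast
  have v1: "s1 ''stack'' (pos i) = v i" for i
    using s1(3) SSeq.prems(4,5)[of i] by (simp add: keeps_def)
  obtain s2 where s2: "runs (cms pa q pos d) s1 (scost ca q (s0 ''N'' 0)) s2"
    "same (run A q v (run A p v s0)) s2" "keeps d s1 s2"
    "run A q v (run A p v s0) ''N'' = s0 ''N''"
    using SSeq.IH(2)[of pos d s1 v "run A p v s0", OF r(4-6) SSeq.prems(4) v1 s1(2)] s1(4)
    by auto
  show ?case
    using runs_Seq[OF s1(1) s2(1)] s2 keeps_trans[OF s1(3) s2(3)]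
    by (intro exI[of _ s2]) simp
next
  case (SIf a b p q)
  from SIf.prems have r: "''stack'' \<notin> sreads p" "''stack'' \<notin> swrites p" "''N'' \<notin> swrites p"
    "''stack'' \<notin> sreads q" "''stack'' \<notin> swrites q" "''N'' \<notin> swrites q" by auto
  have c: "compiled a" "compiled b" using SIf.prems by (auto intro: cmp_correct)
  obtain s2 where s2: "\<And>c B t. runs c s2 B t \<Longrightarrow> runs (Seq (cmp a pos d) (Seq (cmp b pos (d + 1)) c)) s
     (ecost a (s0 ''N'' 0) + ecost b (s0 ''N'' 0) + B) t" "same s0 s2" "keeps d s s2"
    "s2 ''stack'' d = eval a v s0" "s2 ''stack'' (d + 1) = eval b v s0"
    "\<And>i. s2 ''stack'' (pos i) = v i"
    by (rule compiled_pairE[of a b pos d s v s0, OF c SIf.prems(4-6)]) auto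
  obtain s3 where s3: "runs (cms pa p pos d) s2 (scost ca p (s0 ''N'' 0)) s3"
    "same (run A p v s0) s3" "keeps d s2 s3" "run A p v s0 ''N'' = s0 ''N''"
    using SIf.IH(1)[of pos d s2 v s0, OF r(1-3) SIf.prems(4) s2(6) s2(2)] by blast
  obtain s4 where s4: "runs (cms pa q pos d) s2 (scost ca q (s0 ''N'' 0)) s4"
    "same (run A q v s0) s4" "keeps d s2 s4" "run A q v s0 ''N'' = s0 ''N''"
    using SIf.IH(2)[of pos d s2 v s0, OF r(4-6) SIf.prems(4) s2(6) s2(2)] by blast
  let ?t = "if eval a v s0 < eval b v s0 then s3 else s4"
  have "runs (If (Less (stk d) (stk (d + 1))) (cms pa p pos d) (cms pa q pos d)) s2
     (1 + bcost (Less (stk d) (stk (d + 1))) + (scost ca p (s0 ''N'' 0) + scost ca q (s0 ''N'' 0))) ?t"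
    by (rule runs_If) (use s2(4,5) s3(1) s4(1) in \<open>auto elim: runs_mono\<close>)
  from runs_mono[OF s2(1)[OF this], of "scost ca (SIf a b p q) (s0 ''N'' 0)"]
  show ?case
    using s3 s4 keeps_trans[OF s2(3)] by (intro exI[of _ ?t]) simp
next
  case (SFor b p)
  let ?N = "s0 ''N'' 0"
  let ?F = "\<lambda>i. run A p (case_nat i v)"
  let ?b = "min (eval b v s0) ?N"
  from SFor.prems have r: "''stack'' \<notin> ereads b"
    "''stack'' \<notin> sreads p" "''stack'' \<notin> swrites p" "''N'' \<notin> swrites p" by auto
  obtain s1 where s1: "runs (cmp b pos d) s (ecost b ?N) s1" "same s0 s1" "keeps d s s1"
      "s1 ''stack'' d = eval b v s0" "\<And>i. s1 ''stack'' (pos i) = v i"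
    using compiledD[of b pos d s v s0, OF cmp_correct[OF r(1)] SFor.prems(4-6)] by auto
  define s2 where "s2 = upd ''stack'' d ?b s1"
  have "s1 ''N'' = s0 ''N''" using s1(2) by (simp add: same_def)
  then have r2: "runs (If (Less (Cell ''N'' (Num 0)) (stk d)) (put d (Cell ''N'' (Num 0))) Skip) s1 20 s2"
    using clip_runs[of 20 d s1] s1(4) by (simp add: s2_def)
  define s3 where "s3 = upd ''stack'' (d + 1) 0 s2"
  have r3: "runs (put (d + 1) (Num 0)) s2 10 s3"
    using runs_put[of "Num 0" 10 "d + 1" s2] by (simp add: s3_def)
  let ?I = "\<lambda>i t. same (itr ?F i s0) t \<and> keeps d s t \<and> t ''stack'' d = ?b \<and>
      t ''stack'' (d + 1) = i \<and> itr ?F i s0 ''N'' = s0 ''N''"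
  let ?body = "Seq (cms pa p (case_nat (d + 1) pos) (d + 2))
                (put (d + 1) (Plus (stk (d + 1)) (Num 1)))"
  have "\<exists>s'. runs (While (Less (stk (d + 1)) (stk d)) ?body) s3
      ((?b + 1) * ((scost ca p ?N + 20) + 6)) s' \<and> ?I ?b s'"
  proof (rule runs_count_loop[where I = ?I])
    show "?I 0 s3"
      using s1(2,3) by (auto simp: s3_def s2_def stack_put intro!: same_put keeps_put)
  next
    fix i t assume "?I i t"
    then show "t ''stack'' (d + 1) = i \<and> t ''stack'' d = ?b" by simp
  next
    fix i t assume i: "i < ?b" and I: "?I i t"
    let ?pos = "case_nat (d + 1) pos"
    have p: "?pos l < d + 2" for l
      using SFor.prems(4)[of "l - 1"] by (auto split: nat.split)
    have tp: "t ''stack'' (?pos l) = case_nat i v l" for l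
      using I SFor.prems(4,5)[of "l - 1"] by (auto split: nat.split simp: keeps_def)
    have sm: "same (itr ?F i s0) t" using I by simp
    obtain t1 where t1: "runs (cms pa p ?pos (d + 2)) t (scost ca p (itr ?F i s0 ''N'' 0)) t1"
      "same (run A p (case_nat i v) (itr ?F i s0)) t1" "keeps (d + 2) t t1"
      "run A p (case_nat i v) (itr ?F i s0) ''N'' = itr ?F i s0 ''N''"
      using SFor.IH[of ?pos "d + 2" t "case_nat i v" "itr ?F i s0", OF r(2-4) p tp sm] by blast
    define t2 where "t2 = upd ''stack'' (d + 1) (Suc i) t1"
    have "t1 ''stack'' (d + 1) = i" using t1(3) I by (simp add: keeps_def)
    then have q2: "runs (put (d + 1) (Plus (stk (d + 1)) (Num 1))) t1 10 t2"
      using runs_put[of "Plus (stk (d + 1)) (Num 1)" 10 "d + 1" t1] by (simp add: t2_def)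
    have "runs ?body t (scost ca p ?N + 20) t2"
      using runs_Seq[OF t1(1) q2] I by (auto elim: runs_mono)
    moreover have "?I (Suc i) t2"
      using t1(2-4) I by (auto simp: t2_def stack_put keeps_def intro!: same_put)
    ultimately show "\<exists>s'. runs ?body t (scost ca p ?N + 20) s' \<and> ?I (Suc i) s'" by blast
  qed
  then obtain s4 where s4: "runs (While (Less (stk (d + 1)) (stk d)) ?body) s3
      ((?b + 1) * (scost ca p ?N + 20 + 6)) s4" "?I ?b s4" by blast
  have "(?b + 1) * (scost ca p ?N + 20 + 6) \<le> (?N + 1) * (scost ca p ?N + 26)"
    by (intro mult_mono) auto
  then have s4': "runs (While (Less (stk (d + 1)) (stk d)) ?body) s3
      ((?N + 1) * (scost ca p ?N + 26)) s4" using runs_mono[OF s4(1)] by blast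
  have "ecost b ?N + (20 + (10 + (?N + 1) * (scost ca p ?N + 26))) \<le> scost ca (SFor b p) ?N"
    by (simp add: algebra_simps)
  from runs_mono[OF runs_Seq[OF s1(1) runs_Seq[OF r2 runs_Seq[OF r3 s4']]] this]
  have "runs (cms pa (SFor b p) pos d) s (scost ca (SFor b p) ?N) s4" by simp
  then show ?case using s4(2) by (intro exI[of _ s4]) simp
qed

section \<open>Polynomial bounds on the cost\<close>

definition poly_bounded :: "(nat \<Rightarrow> nat) \<Rightarrow> bool" where
  "poly_bounded f \<longleftrightarrow> (\<exists>c d. \<forall>N. f N \<le> c * (N + 1) ^ d)"

lemma poly_bounded_const: "poly_bounded (\<lambda>_. c)"
  unfolding poly_bounded_def by (intro exI[of _ c] exI[of _ 0]) simp

lemma poly_bounded_Suc: "poly_bounded (\<lambda>N. N + 1)"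
  unfolding poly_bounded_def by (intro exI[of _ 1] exI[of _ 1]) simp

lemma poly_bounded_add:
  assumes "poly_bounded f" "poly_bounded g"
  shows "poly_bounded (\<lambda>N. f N + g N)"
proof -
  obtain c d c' d' where f: "\<And>N. f N \<le> c * (N + 1) ^ d" and g: "\<And>N. g N \<le> c' * (N + 1) ^ d'"
    using assms by (auto simp: poly_bounded_def)
  have "f N + g N \<le> (c + c') * (N + 1) ^ (d + d')" for N
  proof -
    have "(N + 1) ^ d \<le> (N + 1) ^ (d + d')" "(N + 1) ^ d' \<le> (N + 1) ^ (d + d')"
      by (auto intro!: power_increasing)
    then have "c * (N + 1) ^ d \<le> c * (N + 1) ^ (d + d')" "c' * (N + 1) ^ d' \<le> c' * (N + 1) ^ (d + d')"
      by auto
    then show ?thesis using f[of N] g[of N] unfolding distrib_right by linarith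
  qed
  then show ?thesis unfolding poly_bounded_def by blast
qed

lemma poly_bounded_mult:
  assumes "poly_bounded f" "poly_bounded g"
  shows "poly_bounded (\<lambda>N. f N * g N)"
proof -
  obtain c d c' d' where f: "\<And>N. f N \<le> c * (N + 1) ^ d" and g: "\<And>N. g N \<le> c' * (N + 1) ^ d'"
    using assms by (auto simp: poly_bounded_def)
  have "f N * g N \<le> (c * c') * (N + 1) ^ (d + d')" for N
    using mult_mono[OF f[of N] g[of N]] by (simp add: power_add mult_ac)
  then show ?thesis unfolding poly_bounded_def by blast
qed

lemmas poly_bounded_intros =
  poly_bounded_const poly_bounded_add poly_bounded_mult poly_bounded_Suc

text \<open>The payoff of cutting off the loops: a loop multiplies the cost of its body by
  \<open>N + 1\<close> and everything else only adds, so the nesting depth bounds the degree and no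
  loop invariant enters.\<close>

lemma poly_bounded_ecost: "poly_bounded (ecost e)"
  by (induction e; unfold ecost.simps[abs_def]; (intro poly_bounded_intros; assumption)?)

lemma poly_bounded_scost:
  assumes "poly_bounded ca"
  shows "poly_bounded (scost ca p)"
  by (induction p; unfold scost.simps[abs_def];
      (intro poly_bounded_intros poly_bounded_ecost assms; assumption)?)

section \<open>Strategies from programs\<close>

text \<open>A strategy must return a code for every list of answers, also for inconsistent ones.
  Mapping illegal colours to 1 makes every program a valid strategy as soon as
  \<open>k \<ge> 1\<close>.\<close>

definition clamp :: "nat \<Rightarrow> nat \<Rightarrow> nat" where
  "clamp k g = (if 1 \<le> g \<and> g \<le> k then g else 1)"

definition clamp_ex :: "ex \<Rightarrow> ex" where
  "clamp_ex g = EIf (ENum 0) g (EIf g (EAdd (ECell ''k'' (ENum 0)) (ENum 1)) g (ENum 1)) (ENum 1)"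

lemma eval_clamp_ex: "eval (clamp_ex g) v s = clamp (s ''k'' 0) (eval g v s)"
  by (auto simp: clamp_ex_def clamp_def)

text \<open>
  With \<open>q\<close> the number of questions asked so far, asking the guess in \<open>G\<close> reads the answer
  number \<open>q\<close>; if this answer is not yet known (\<open>q = t\<close>), the guess is the one to be output.
\<close>

definition ask_body :: st where
  "ask_body = SSeq
     (SIf (ECell ''q'' (ENum 0)) (EAdd (ECell ''t'' (ENum 0)) (ENum 1))
       (SIf (ECell ''t'' (ENum 0)) (EAdd (ECell ''q'' (ENum 0)) (ENum 1))
         (SFor (ECell ''n'' (ENum 0))
            (SSet ''guess'' (EAdd (EVar 0) (ENum 1))
               (clamp_ex (ECell ''G'' (EAdd (EVar 0) (ENum 1))))))
         SSkip)
       SSkip)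
    (SSeq (SSet ''ans'' (ENum 0) (ECell ''answer'' (ECell ''q'' (ENum 0))))
          (SSet ''q'' (ENum 0) (EAdd (ECell ''q'' (ENum 0)) (ENum 1))))"

definition ask :: "state \<Rightarrow> state" where
  "ask s = run id ask_body (\<lambda>_. 0) s"

lemma itr_fill:
  assumes "\<And>i s'. i < b \<Longrightarrow> (\<And>y. y \<noteq> x \<Longrightarrow> s' y = s y) \<Longrightarrow> F i s' = upd x (Suc i) (f i) s'"
  shows "itr F b s = s(x := (\<lambda>j. if 1 \<le> j \<and> j \<le> b then f (j - 1) else s x j))"
  using assms
proof (induction b)
  case 0
  then show ?case by (auto simp: fun_eq_iff)
next
  case (Suc b)
  have IH: "itr F b s = s(x := (\<lambda>j. if 1 \<le> j \<and> j \<le> b then f (j - 1) else s x j))"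
    using Suc by auto
  have "F b (itr F b s) = upd x (Suc b) (f b) (itr F b s)"
    by (rule Suc.prems) (auto simp: IH)
  then show ?case
    by (auto simp: IH upd_def fun_eq_iff le_Suc_eq)
qed

lemma run_fill:
  assumes "\<And>v s s'. (\<And>y. y \<noteq> x \<Longrightarrow> s' y = s y) \<Longrightarrow> eval e v s' = eval e v s"
  shows "run A (SFor b (SSet x (EAdd (EVar 0) (ENum 1)) e)) v s =
    s(x := (\<lambda>j. if 1 \<le> j \<and> j \<le> min (eval b v s) (s ''N'' 0)
                 then eval e (case_nat (j - 1) v) s else s x j))"
proof -
  have "itr (\<lambda>i s. upd x (Suc i) (eval e (case_nat i v) s) s) (min (eval b v s) (s ''N'' 0)) s =
    s(x := (\<lambda>j. if 1 \<le> j \<and> j \<le> min (eval b v s) (s ''N'' 0)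
                 then eval e (case_nat (j - 1) v) s else s x j))"
  proof (rule itr_fill[where f = "\<lambda>i. eval e (case_nat i v) s"])
    fix i s' assume "\<And>y. y \<noteq> x \<Longrightarrow> s' y = s y"
    then have "eval e (case_nat i v) s' = eval e (case_nat i v) s" by (rule assms)
    then show "upd x (Suc i) (eval e (case_nat i v) s') s' =
        upd x (Suc i) (eval e (case_nat i v) s) s'" by simp
  qed
  moreover have "run A (SSet x (EAdd (EVar 0) (ENum 1)) e) (case_nat i v) =
      (\<lambda>s. upd x (Suc i) (eval e (case_nat i v) s) s)" for i
    by (rule ext) simp
  ultimately show ?thesis by (simp only: run.simps(6))
qed

text \<open>Outside the scope of \<open>itr_fill\<close>, as the loop reads the array that it
  writes; each cell is read only in the round that overwrites it.\<close>

lemma itr_clamp: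
  "itr (\<lambda>i s. upd ''guess'' (Suc i) (clamp (s ''k'' 0) (s ''guess'' (Suc i))) s) b s =
   s(''guess'' := (\<lambda>j. if 1 \<le> j \<and> j \<le> b then clamp (s ''k'' 0) (s ''guess'' j) else s ''guess'' j))"
proof (induction b)
  case 0
  then show ?case by (auto simp: fun_eq_iff)
next
  case (Suc b)
  then show ?case by (auto simp: upd_def fun_eq_iff le_Suc_eq)
qed

lemma run_ask_body:
  "run id ask_body v s = (let q = s ''q'' 0; s1 = (if q = s ''t'' 0 then
        s(''guess'' := (\<lambda>j. if 1 \<le> j \<and> j \<le> min (s ''n'' 0) (s ''N'' 0)
           then clamp (s ''k'' 0) (s ''G'' j) else s ''guess'' j)) else s)
      in upd ''q'' 0 (q + 1) (upd ''ans'' 0 (s ''answer'' q) s1))"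
proof -
  let ?s1 = "s(''guess'' := (\<lambda>j. if 1 \<le> j \<and> j \<le> min (s ''n'' 0) (s ''N'' 0)
           then clamp (s ''k'' 0) (s ''G'' j) else s ''guess'' j))"
  define f where "f = SFor (ECell ''n'' (ENum 0)) (SSet ''guess'' (EAdd (EVar 0) (ENum 1))
     (clamp_ex (ECell ''G'' (EAdd (EVar 0) (ENum 1)))))"
  have f: "run id f v s = ?s1"
    unfolding f_def
    by (subst run_fill) (auto simp: eval_clamp_ex fun_eq_iff simp del: run.simps)
  show ?thesis
    unfolding ask_body_def f_def[symmetric]
    by (auto simp: f upd_def less_Suc_eq Let_def)
qed

lemmas ask_eq = run_ask_body[of "\<lambda>_. 0", folded ask_def]

lemma run_frame:
  assumes "\<And>s. A s x = s x" "x \<notin> swrites p"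
  shows "run A p v s x = s x"
  using assms(2)
proof (induction p arbitrary: v s)
  case (SFor b p)
  have "itr (\<lambda>i. run A p (case_nat i v)) m s x = s x" for m
    by (induction m) (use SFor in auto)
  then show ?case by simp
qed (auto simp: assms(1) upd_def)

lemma implements_ask:
  "implements (cms (\<lambda>_. Skip) ask_body (\<lambda>_. 0)) (scost (\<lambda>_. 20) ask_body) ask"
  unfolding implements_def
proof (intro allI impI)
  fix d :: nat and s0 s1 :: state
  assume d: "0 < d" and ss: "same s0 s1"
  \<comment> \<open>\<open>ask_body\<close> contains no question itself, so its own oracle is taken
    to be \<open>id\<close>, implemented by \<open>Skip\<close>.\<close>
  have i: "implements (\<lambda>_. Skip) (\<lambda>_. 20) id"
    unfolding implements_def using runs_mono[OF runs_Skip, of 20] keeps_refl by auto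
  define v where "v = (\<lambda>i::nat. s1 ''stack'' 0)"
  have "run id ask_body v s0 = ask s0" by (simp only: run_ask_body ask_eq)
  moreover have "\<exists>s'. runs (cms (\<lambda>_. Skip) ask_body (\<lambda>_. 0) d) s1
      (scost (\<lambda>_. 20) ask_body (s0 ''N'' 0)) s' \<and> same (run id ask_body v s0) s' \<and>
      keeps d s1 s' \<and> run id ask_body v s0 ''N'' = s0 ''N''"
    using cms_correct[OF i, of ask_body "\<lambda>_. 0" d s1 v s0] d ss
    by (auto simp: ask_body_def clamp_ex_def v_def)
  ultimately show "\<exists>s'. runs (cms (\<lambda>_. Skip) ask_body (\<lambda>_. 0) d) s1
      (scost (\<lambda>_. 20) ask_body (s0 ''N'' 0)) s' \<and> same (ask s0) s' \<and>
      keeps d s1 s' \<and> ask s0 ''N'' = s0 ''N''" by simp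
qed

text \<open>The tree depth \<open>L\<close> will satisfy \<open>2 ^ L \<le> 2 * n\<close>, so node
  numbers, which are below \<open>2 ^ Suc L\<close>, stay within \<open>4 * n\<close>; the rest
  leaves room for the colours and for small additive terms. Additions alone compute the
  value.\<close>

definition init_state :: "nat \<Rightarrow> nat \<Rightarrow> nat list \<Rightarrow> state" where
  "init_state n k as = upd ''N'' 0 (4 * n + 4 * k + 8) (input_state n k as)"

text \<open>The program is rerun from scratch on each call and replays the questions already
  answered. \<open>ask\<close> copies the guess of question number \<open>length as\<close> to
  \<open>guess\<close>; the run then goes on to its end with meaningless answers.\<close>

definition strategy_of :: "st \<Rightarrow> nat \<Rightarrow> nat \<Rightarrow> strategy" where
  "strategy_of p n k as =
     (\<lambda>i\<in>{1..n}. clamp k (run ask p (\<lambda>_. 0) (init_state n k as) ''guess'' i))"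

lemma strategy_of_codes: "k \<ge> 1 \<Longrightarrow> strategy_of p n k as \<in> codes n k"
  by (auto simp: strategy_of_def codes_def clamp_def)

lemma polynomial_time_strategy_of:
  assumes "''stack'' \<notin> sreads p" "''stack'' \<notin> swrites p"
    "''N'' \<notin> swrites p" "''n'' \<notin> swrites p" "''k'' \<notin> swrites p"
  shows "polynomial_time (strategy_of p)"
proof -
  \<comment> \<open>The machine clamps the array once more at the end, as \<open>strategy_of\<close>
    does, so that the outputs coincide also if a run never reaches question
    \<open>t\<close>.\<close>
  let ?out = "SFor (ECell ''n'' (ENum 0)) (SSet ''guess'' (EAdd (EVar 0) (ENum 1))
               (clamp_ex (ECell ''guess'' (EAdd (EVar 0) (ENum 1)))))"
  let ?p = "SSeq p ?out"
  let ?pa = "cms (\<lambda>_. Skip) ask_body (\<lambda>_. 0)" and ?ca = "scost (\<lambda>_. 20) ask_body"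
  let ?N = "Plus (Plus (Plus (Cell ''n'' (Num 0)) (Cell ''n'' (Num 0)))
    (Plus (Cell ''n'' (Num 0)) (Cell ''n'' (Num 0)))) (Plus (Plus (Plus (Cell ''k'' (Num 0)) (Cell ''k'' (Num 0)))
    (Plus (Cell ''k'' (Num 0)) (Cell ''k'' (Num 0)))) (Num 8))"
  let ?init = "Assign ''N'' (Num 0) ?N"
  let ?c = "Seq ?init (cms ?pa ?p (\<lambda>_. 0) 1)"
  have "poly_bounded (scost ?ca ?p)"
    by (intro poly_bounded_scost poly_bounded_const)
  then obtain c d where cd: "\<And>N. scost ?ca ?p N \<le> c * (N + 1) ^ d"
    by (auto simp: poly_bounded_def)
  have main: "\<exists>m s'. exec ?c (input_state n k as) m s' \<and> m \<le> (c * 17 ^ d + 100) * (n + k) ^ d \<and>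
       (\<forall>i \<in> {1..n}. s' ''guess'' i = strategy_of p n k as i)"
    if "n \<ge> 1" "k \<ge> 1" for n k as
  proof -
    let ?s = "init_state n k as"
    have r1: "runs ?init (input_state n k as) 100 ?s"
    proof -
      have av: "aval ?N (input_state n k as) = 4 * n + 4 * k + 8" by (simp add: input_state_def)
      have "runs ?init (input_state n k as) (1 + acost (Num 0) + acost ?N)
         (upd ''N'' (aval (Num 0) (input_state n k as)) (aval ?N (input_state n k as)) (input_state n k as))"
        by (rule runs_Assign)
      then show ?thesis
        unfolding init_state_def av aval.simps(1) by (rule runs_mono) simp
    qed
    obtain s' where s': "runs (cms ?pa ?p (\<lambda>_. 0) 1) ?s (scost ?ca ?p (?s ''N'' 0)) s'"
      "same (run ask ?p (\<lambda>_. 0) ?s) s'"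
      using cms_correct[OF implements_ask, of ?p "\<lambda>_. 0" 1 ?s "\<lambda>_. 0" ?s] assms
      by (auto simp: clamp_ex_def same_refl init_state_def input_state_def upd_def)
    obtain m where m: "exec ?c (input_state n k as) m s'" "m \<le> 100 + scost ?ca ?p (?s ''N'' 0)"
      using runs_Seq[OF r1 s'(1)] unfolding runs_def by blast
    have "?s ''N'' 0 + 1 = 4 * (n + k) + 9" by (simp add: init_state_def upd_def)
    also have "\<dots> \<le> 17 * (n + k)" using that by simp
    finally have "(?s ''N'' 0 + 1) ^ d \<le> 17 ^ d * (n + k) ^ d"
      by (metis power_mono power_mult_distrib zero_le)
    then have "scost ?ca ?p (?s ''N'' 0) \<le> c * (17 ^ d * (n + k) ^ d)"
      using cd[of "?s ''N'' 0"] by (meson mult_le_mono2 order_trans)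
    moreover have "100 \<le> 100 * (n + k) ^ d" using that by simp
    ultimately have "m \<le> (c * 17 ^ d + 100) * (n + k) ^ d"
      using m(2) by (simp only: distrib_right mult.assoc)
    moreover have "\<forall>i \<in> {1..n}. s' ''guess'' i = strategy_of p n k as i"
    proof
      fix i assume i: "i \<in> {1..n}"
      define r where "r = run ask p (\<lambda>_. 0) ?s"
      have "r x = ?s x" if "x = ''n'' \<or> x = ''k'' \<or> x = ''N''" for x
        unfolding r_def
        by (rule run_frame) (use that assms in \<open>auto simp: ask_eq Let_def upd_def\<close>)
      then have r: "r ''n'' 0 = n" "r ''k'' 0 = k" "r ''N'' 0 = 4 * n + 4 * k + 8"
        by (auto simp: init_state_def input_state_def upd_def)
      have F: "run ask (SSet ''guess'' (EAdd (EVar 0) (ENum 1))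
            (clamp_ex (ECell ''guess'' (EAdd (EVar 0) (ENum 1))))) (case_nat j (\<lambda>_. 0)) =
          (\<lambda>s. upd ''guess'' (Suc j) (clamp (s ''k'' 0) (s ''guess'' (Suc j))) s)" for j
        by (rule ext) (simp add: eval_clamp_ex)
      have "run ask ?p (\<lambda>_. 0) ?s =
          itr (\<lambda>i s. upd ''guess'' (Suc i) (clamp (s ''k'' 0) (s ''guess'' (Suc i))) s)
            (min (r ''n'' 0) (r ''N'' 0)) r"
        by (simp only: run.simps(4,6) F eval.simps r_def)
      then have "run ask ?p (\<lambda>_. 0) ?s ''guess'' i = clamp k (r ''guess'' i)"
        unfolding itr_clamp r using i by simp
      then have "run ask ?p (\<lambda>_. 0) ?s ''guess'' i = strategy_of p n k as i"
        using i by (simp add: strategy_of_def r_def del: run.simps)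
      moreover have "s' ''guess'' = run ask ?p (\<lambda>_. 0) ?s ''guess''"
        using s'(2) by (simp add: same_def)
      ultimately show "s' ''guess'' i = strategy_of p n k as i" by simp
    qed
    ultimately show ?thesis using m(1) by blast
  qed
  show ?thesis
    unfolding polynomial_time_def nth_guess_def
    by (rule exI[of _ ?c], rule exI[of _ "c * 17 ^ d + 100"], rule exI[of _ d],
        intro allI impI ballI) (rule main)
qed

section \<open>Runs against an honest Codemaker\<close>

definition guess_of :: "nat \<Rightarrow> nat \<Rightarrow> state \<Rightarrow> code" where
  "guess_of n k s = (\<lambda>i\<in>{1..n}. clamp k (s ''G'' i))"

text \<open>States hold only numbers, so the log stores a guess as one number. The log belongs to
  the proof, not to the strategy: the compiled program neither reads nor writes it.\<close>

definition enc :: "nat \<Rightarrow> code \<Rightarrow> nat" where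
  "enc n g = list_encode (map g [1..<Suc n])"

definition dec :: "nat \<Rightarrow> nat \<Rightarrow> code" where
  "dec n x = (\<lambda>i\<in>{1..n}. list_decode x ! (i - 1))"

lemma dec_enc: "dec n (enc n g) = restrict g {1..n}"
  by (auto simp: dec_def enc_def fun_eq_iff nth_append restrict_def simp del: upt_Suc)

lemma dec_enc_guess_of: "dec n (enc n (guess_of n k s)) = guess_of n k s"
  by (simp add: dec_enc guess_of_def)

text \<open>
  The honest oracle answers from the secret code, without consulting a list of answers.  It
  records the guesses, which lets the answers of the real game be recovered from one run.
\<close>

definition honest :: "nat \<Rightarrow> nat \<Rightarrow> code \<Rightarrow> state \<Rightarrow> state" where
  "honest n k z s = upd ''log'' (s ''q'' 0) (enc n (guess_of n k s))
     (upd ''q'' 0 (s ''q'' 0 + 1) (upd ''ans'' 0 (black_pegs n z (guess_of n k s)) s))"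

text \<open>The variables on which the two oracles may differ, together with the stack of the
  compiler. A program that neither reads nor writes them learns about the oracle only through
  \<open>ans\<close>.\<close>

definition hidden :: "vname set" where
  "hidden = {''stack'', ''t'', ''answer'', ''guess'', ''q'', ''log''}"

definition inputs :: "vname set" where
  "inputs = {''n'', ''k'', ''N''}"

text \<open>For a \<open>P\<close> about hidden variables only: assignments of the program cannot
  touch them, so nothing but the oracle could break \<open>P\<close>.\<close>

lemma run_invariant:
  assumes "\<And>s s'. (\<And>x. x \<in> hidden \<Longrightarrow> s x = s' x) \<Longrightarrow> P s \<Longrightarrow> P s'"
    and "\<And>s. P s \<Longrightarrow> P (A s)"
    and "swrites p \<inter> hidden = {}" "P s"
  shows "P (run A p v s)"
  using assms(3,4)
proof (induction p arbitrary: v s)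
  case (SSet x a b)
  then show ?case
    by (auto intro!: assms(1)[of s] simp: upd_def)
next
  case (SFor b p)
  have "P (itr (\<lambda>i. run A p (case_nat i v)) m s)" for m
    by (induction m) (use SFor in auto)
  then show ?case by simp
qed (auto simp: assms(2) Int_Un_distrib2)

context
  fixes n k t :: nat and z :: code and as :: "nat \<Rightarrow> nat"
begin

text \<open>Up to question \<open>t\<close> the run with \<open>ask\<close> on the answers
  \<open>as\<close> and the run with \<open>honest\<close> proceed in lockstep.\<close>

definition agree :: "state \<Rightarrow> state \<Rightarrow> bool" where
  "agree s1 s2 \<longleftrightarrow> (\<forall>x. x \<notin> hidden \<longrightarrow> s1 x = s2 x) \<and> s1 ''n'' 0 = n \<and> s1 ''k'' 0 = k \<and>
     n \<le> s1 ''N'' 0 \<and> s1 ''q'' 0 = s2 ''q'' 0 \<and> s1 ''q'' 0 \<le> t \<and> s1 ''t'' 0 = t \<and>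
     (\<forall>i<t. s1 ''answer'' i = as i)"

definition past1 :: "code \<Rightarrow> state \<Rightarrow> bool" where
  "past1 g s1 \<longleftrightarrow> s1 ''t'' 0 = t \<and> s1 ''q'' 0 > t \<and> (\<forall>i\<in>{1..n}. s1 ''guess'' i = g i)"

definition past2 :: "code \<Rightarrow> state \<Rightarrow> bool" where
  "past2 g s2 \<longleftrightarrow> s2 ''q'' 0 > t \<and> dec n (s2 ''log'' t) = g \<and> (\<forall>i\<in>{1..n}. clamp k (g i) = g i)"

definition lied :: "state \<Rightarrow> bool" where
  "lied s2 \<longleftrightarrow> (\<exists>i<t. i < s2 ''q'' 0 \<and> as i \<noteq> black_pegs n z (dec n (s2 ''log'' i)))"

text \<open>After question \<open>t\<close> the runs may drift apart, but the guess is already fixed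
  on both sides: in \<open>guess\<close> by \<open>ask\<close>, in cell \<open>t\<close> of the log
  by \<open>honest\<close>. The third case gives up when an answer disagrees with the logged guess,
  so that true answers need not be assumed in advance.\<close>

definition simrel :: "state \<Rightarrow> state \<Rightarrow> bool" where
  "simrel s1 s2 \<longleftrightarrow> agree s1 s2 \<or> (\<exists>g. past1 g s1 \<and> past2 g s2) \<or> lied s2"

lemma run_past1: "swrites p \<inter> hidden = {} \<Longrightarrow> past1 g s \<Longrightarrow> past1 g (run ask p v s)"
proof (rule run_invariant)
  fix s s' :: state
  assume e: "\<And>x. x \<in> hidden \<Longrightarrow> s x = s' x" and p: "past1 g s"
  have "s ''t'' = s' ''t''" "s ''q'' = s' ''q''" "s ''guess'' = s' ''guess''"
    by (auto intro!: e simp: hidden_def)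
  with p show "past1 g s'" by (simp add: past1_def)
qed (auto simp: past1_def ask_eq Let_def upd_def)

lemma run_past2: "swrites p \<inter> hidden = {} \<Longrightarrow> past2 g s \<Longrightarrow> past2 g (run (honest n k z) p v s)"
proof (rule run_invariant)
  fix s s' :: state
  assume e: "\<And>x. x \<in> hidden \<Longrightarrow> s x = s' x" and p: "past2 g s"
  have "s ''log'' = s' ''log''" "s ''q'' = s' ''q''"
    by (auto intro!: e simp: hidden_def)
  with p show "past2 g s'" by (simp add: past2_def)
qed (auto simp: past2_def honest_def upd_def)

lemma run_lied: "swrites p \<inter> hidden = {} \<Longrightarrow> lied s \<Longrightarrow> lied (run (honest n k z) p v s)"
proof (rule run_invariant)
  fix s s' :: state
  assume e: "\<And>x. x \<in> hidden \<Longrightarrow> s x = s' x" and p: "lied s"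
  have "s ''log'' = s' ''log''" "s ''q'' = s' ''q''"
    by (auto intro!: e simp: hidden_def)
  with p show "lied s'" by (simp add: lied_def)
next
  fix s assume "lied s"
  then obtain i where i: "i < t" "i < s ''q'' 0" "as i \<noteq> black_pegs n z (dec n (s ''log'' i))"
    by (auto simp: lied_def)
  then show "lied (honest n k z s)"
    unfolding lied_def by (intro exI[of _ i]) (auto simp: honest_def upd_def)
qed auto

lemma simrel_ask:
  assumes "agree s1 s2"
  shows "simrel (ask s1) (honest n k z s2)"
proof -
  from assms have e: "\<And>x. x \<notin> hidden \<Longrightarrow> s1 x = s2 x" and s: "s1 ''n'' 0 = n" "s1 ''k'' 0 = k"
     "n \<le> s1 ''N'' 0" "s1 ''q'' 0 = s2 ''q'' 0" "s1 ''q'' 0 \<le> t" "s1 ''t'' 0 = t"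
     "\<forall>i<t. s1 ''answer'' i = as i"
    by (auto simp: agree_def)
  have "s1 ''G'' = s2 ''G''" by (rule e) (simp add: hidden_def)
  then have g: "guess_of n k s1 = guess_of n k s2" by (simp add: guess_of_def)
  show ?thesis
  proof (cases "s1 ''q'' 0 = t")
    case True
    have "past1 (guess_of n k s1) (ask s1)"
      unfolding past1_def using s True by (auto simp: ask_eq Let_def upd_def guess_of_def)
    moreover have "past2 (guess_of n k s1) (honest n k z s2)"
      unfolding past2_def using s True
      by (auto simp: honest_def upd_def dec_enc_guess_of g) (auto simp: guess_of_def clamp_def)
    ultimately show ?thesis by (auto simp: simrel_def)
  next
    case False
    show ?thesis
    proof (cases "lied (honest n k z s2)")
      case True
      then show ?thesis by (simp add: simrel_def)
    next
      case nl: False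
      let ?q = "s2 ''q'' 0"
      have q: "?q < t" using False s by simp
      have "as ?q = black_pegs n z (guess_of n k s2)"
        using nl q by (auto simp: lied_def honest_def upd_def dec_enc_guess_of)
      then have "agree (ask s1) (honest n k z s2)"
        using s e q False by (auto simp: agree_def ask_eq Let_def honest_def upd_def hidden_def)
      then show ?thesis by (simp add: simrel_def)
    qed
  qed
qed

lemma agree_eval:
  assumes "agree s1 s2" "ereads e \<inter> hidden = {}"
  shows "eval e v s1 = eval e v s2"
  by (rule eval_cong) (use assms in \<open>auto simp: agree_def\<close>)

text \<open>Without agreement the control flow of the two runs is unrelated; the remaining
  alternatives survive because they are invariants of each run separately.\<close>

lemma simrel_dead:
  assumes "\<not> agree s1 s2" "simrel s1 s2" "swrites p \<inter> (hidden \<union> inputs) = {}"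
  shows "simrel (run ask p v s1) (run (honest n k z) p v s2)"
proof -
  have p: "swrites p \<inter> hidden = {}" using assms(3) by auto
  from assms(1,2) consider g where "past1 g s1" "past2 g s2" | "lied s2"
    by (auto simp: simrel_def)
  then show ?thesis
  proof cases
    case 1
    from run_past1[OF p this(1)] run_past2[OF p this(2)] show ?thesis
      unfolding simrel_def by blast
  next
    case 2
    from run_lied[OF p this] show ?thesis unfolding simrel_def by blast
  qed
qed

lemma simrel_run:
  assumes "sreads p \<inter> hidden = {}" "swrites p \<inter> (hidden \<union> inputs) = {}" "simrel s1 s2"
  shows "simrel (run ask p v s1) (run (honest n k z) p v s2)"
  using assms
proof (induction p arbitrary: v s1 s2)
  case SSkip
  then show ?case by simp
next
  case SAsk
  show ?case
  proof (cases "agree s1 s2")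
    case 1: True
    then show ?thesis by (simp add: simrel_ask)
  next
    case False
    show ?thesis by (rule simrel_dead[OF False SAsk(3) SAsk(2)])
  qed
next
  case (SSet x a b)
  show ?case
  proof (cases "agree s1 s2")
    case 1: True
    have x: "x \<notin> hidden" "x \<notin> inputs" using SSet(2) by auto
    then have u: "upd x i c s y = s y" if "y \<in> hidden \<or> y \<in> inputs" for y i c s
      using that by (auto simp: upd_def)
    have h: "''q'' \<in> hidden" "''t'' \<in> hidden" "''answer'' \<in> hidden"
        "''n'' \<in> inputs" "''k'' \<in> inputs" "''N'' \<in> inputs"
      by (simp_all add: hidden_def inputs_def)
    have ev: "eval a v s1 = eval a v s2" "eval b v s1 = eval b v s2"
      using SSet(1) agree_eval[OF 1] by auto
    have "upd x i c s1 y = upd x i c s2 y" if "y \<notin> hidden" for i c y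
    proof -
      have "s1 y = s2 y" using 1 that by (simp add: agree_def)
      then show ?thesis by (auto simp: upd_def)
    qed
    then have "agree (run ask (SSet x a b) v s1) (run (honest n k z) (SSet x a b) v s2)"
      using 1 by (simp add: agree_def ev u h)
    then show ?thesis by (simp add: simrel_def)
  next
    case False
    show ?thesis by (rule simrel_dead[OF False SSet(3) SSet(2)])
  qed
next
  case (SSeq p q)
  have "simrel (run ask p v s1) (run (honest n k z) p v s2)"
    by (rule SSeq.IH(1)) (use SSeq.prems in auto)
  then have "simrel (run ask q v (run ask p v s1)) (run (honest n k z) q v (run (honest n k z) p v s2))"
    by (intro SSeq.IH(2)) (use SSeq.prems in auto)
  then show ?case by simp
next
  case (SIf a b p q)
  show ?case
  proof (cases "agree s1 s2")
    case 1: True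
    have "simrel (run ask p v s1) (run (honest n k z) p v s2)"
      "simrel (run ask q v s1) (run (honest n k z) q v s2)"
      using SIf.prems by (auto intro!: SIf.IH)
    moreover have "eval a v s1 = eval a v s2" "eval b v s1 = eval b v s2"
      by (rule agree_eval[OF 1], use SIf.prems in auto)+
    ultimately show ?thesis by simp
  next
    case False
    show ?thesis by (rule simrel_dead[OF False SIf.prems(3) SIf.prems(2)])
  qed
next
  case (SFor b p)
  show ?case
  proof (cases "agree s1 s2")
    case 1: True
    \<comment> \<open>The bound of the loop is evaluated once, while the states still agree; a later
      round may end the agreement, which \<open>simrel\<close> allows.\<close>
    have "simrel (itr (\<lambda>i. run ask p (case_nat i v)) m s1)
                 (itr (\<lambda>i. run (honest n k z) p (case_nat i v)) m s2)" for m
    proof (induction m)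
      case 0
      show ?case using SFor.prems(3) by simp
    next
      case (Suc m)
      have "sreads p \<inter> hidden = {}" "swrites p \<inter> (hidden \<union> inputs) = {}"
        using SFor.prems by auto
      from SFor.IH[OF this Suc] show ?case by simp
    qed
    moreover have "s1 ''N'' = s2 ''N''" using 1 by (auto simp: agree_def hidden_def)
    moreover have "eval b v s1 = eval b v s2"
      by (rule agree_eval[OF 1]) (use SFor.prems in auto)
    ultimately show ?thesis by simp
  next
    case False
    show ?thesis by (rule simrel_dead[OF False SFor.prems(3) SFor.prems(2)])
  qed
qed

end

lemma strategy_of_honest:
  assumes p: "sreads p \<inter> hidden = {}" "swrites p \<inter> (hidden \<union> inputs) = {}"
    and h: "h = run (honest n k z) p (\<lambda>_. 0) (init_state n k [])"
    and t: "t < h ''q'' 0"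
    and as: "length as = t" "\<And>i. i < t \<Longrightarrow> as ! i = black_pegs n z (dec n (h ''log'' i))"
  shows "strategy_of p n k as = dec n (h ''log'' t)"
proof -
  let ?as = "\<lambda>i. as ! i" and ?s = "run ask p (\<lambda>_. 0) (init_state n k as)"
  have "agree n k t ?as (init_state n k as) (init_state n k [])"
    using as(1) by (auto simp: agree_def init_state_def input_state_def upd_def hidden_def)
  then have "simrel n k t z ?as ?s h"
    unfolding h by (intro simrel_run p) (simp add: simrel_def)
  moreover have "\<not> lied n t z ?as h" using as(2) by (auto simp: lied_def)
  moreover have "\<not> agree n k t ?as ?s h" using t by (auto simp: agree_def)
  ultimately obtain g where g: "past1 n t g ?s" "past2 n k t g h" by (auto simp: simrel_def)
  have "strategy_of p n k as = restrict g {1..n}"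
    using g by (auto simp: strategy_of_def past1_def past2_def fun_eq_iff restrict_def)
  moreover have "restrict g {1..n} = dec n (h ''log'' t)"
    using g(2) by (auto simp: past2_def dec_def)
  ultimately show ?thesis by simp
qed

text \<open>One honest run describes the whole game: by induction on the round, the answers of the
  real game are the pegs of the logged guesses, and \<open>strategy_of_honest\<close> then yields
  the next logged guess.\<close>

theorem strategy_of_wins:
  assumes p: "sreads p \<inter> hidden = {}" "swrites p \<inter> (hidden \<union> inputs) = {}"
    and k: "k \<ge> 1"
    and win: "\<And>z. z \<in> codes n k \<Longrightarrow> \<exists>q. real (Suc q) \<le> B \<and>
      (let h = run (honest n k z) p (\<lambda>_. 0) (init_state n k []) in
        h ''q'' 0 = Suc q \<and> dec n (h ''log'' q) = z)"
  shows "wins_within n k (strategy_of p n k) B"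
  unfolding wins_within_def valid_strategy_def
proof (intro conjI allI ballI strategy_of_codes k)
  fix z assume z: "z \<in> codes n k"
  define h where "h = run (honest n k z) p (\<lambda>_. 0) (init_state n k [])"
  from win[OF z] obtain q where q: "real (Suc q) \<le> B" "h ''q'' 0 = Suc q" "dec n (h ''log'' q) = z"
    by (auto simp: h_def Let_def)
  let ?\<sigma> = "strategy_of p n k"
  let ?b = "\<lambda>i. black_pegs n z (dec n (h ''log'' i))"
  have g: "strategy_of p n k (map ?b [0..<i]) = dec n (h ''log'' i)" if "i \<le> q" for i
    by (rule strategy_of_honest[OF p h_def]) (use that q(2) in auto)
  have "answers n ?\<sigma> z i = map ?b [0..<i]" if "i \<le> q" for i
    using that by (induction i) (auto simp: g)
  then have "nth_guess n ?\<sigma> z q = z" using g[of q] q(3) by (simp add: nth_guess_def)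
  then show "\<exists>t. real (Suc t) \<le> B \<and> nth_guess n ?\<sigma> z t = z" using q(1) by blast
qed

section \<open>Expressible functions and statements\<close>

text \<open>Only the existence of a syntax tree matters. With the closure rules in
  \<open>expr_intros\<close>, functions are written in HOL and their trees are found by introduction
  rules; disjointness from \<open>hidden\<close> is what the simulation demands.\<close>

definition expr :: "((nat \<Rightarrow> nat) \<Rightarrow> state \<Rightarrow> nat) \<Rightarrow> bool" where
  "expr f \<longleftrightarrow> (\<exists>e. ereads e \<inter> hidden = {} \<and> (\<forall>v s. eval e v s = f v s))"

definition cond :: "((nat \<Rightarrow> nat) \<Rightarrow> state \<Rightarrow> bool) \<Rightarrow> bool" where
  "cond P \<longleftrightarrow> expr (\<lambda>v s. of_bool (P v s))"

named_theorems expr_intros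

lemma expr_const [expr_intros]: "expr (\<lambda>v s. c)"
  unfolding expr_def by (rule exI[of _ "ENum c"]) simp

lemma expr_var [expr_intros]: "expr (\<lambda>v s. v c)"
  unfolding expr_def by (rule exI[of _ "EVar c"]) simp

lemma expr_cell [expr_intros]: "x \<notin> hidden \<Longrightarrow> expr a \<Longrightarrow> expr (\<lambda>v s. s x (a v s))"
  unfolding expr_def by (elim exE, rule_tac x = "ECell x e" in exI) auto

lemma expr_add [expr_intros]: "expr a \<Longrightarrow> expr b \<Longrightarrow> expr (\<lambda>v s. a v s + b v s)"
  unfolding expr_def by (elim exE, rule_tac x = "EAdd e ea" in exI) auto

lemma expr_diff [expr_intros]: "expr a \<Longrightarrow> expr b \<Longrightarrow> expr (\<lambda>v s. a v s - b v s)"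
  unfolding expr_def by (elim exE, rule_tac x = "ESub e ea" in exI) auto

lemma expr_Suc [expr_intros]: "expr a \<Longrightarrow> expr (\<lambda>v s. Suc (a v s))"
  using expr_add[OF _ expr_const, of a 1] by simp

lemma expr_if_less:
  assumes "expr a" "expr b" "expr c" "expr d"
  shows "expr (\<lambda>v s. if a v s < b v s then c v s else d v s)"
proof -
  obtain e1 e2 e3 e4 where
    "ereads e1 \<inter> hidden = {}" "ereads e2 \<inter> hidden = {}"
    "ereads e3 \<inter> hidden = {}" "ereads e4 \<inter> hidden = {}"
    "\<forall>v s. eval e1 v s = a v s" "\<forall>v s. eval e2 v s = b v s"
    "\<forall>v s. eval e3 v s = c v s" "\<forall>v s. eval e4 v s = d v s"
    using assms by (auto simp: expr_def)
  then show ?thesis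
    unfolding expr_def by (intro exI[of _ "EIf e1 e2 e3 e4"]) auto
qed

lemma cond_less [expr_intros]: "expr a \<Longrightarrow> expr b \<Longrightarrow> cond (\<lambda>v s. a v s < b v s)"
  unfolding cond_def of_bool_def by (intro expr_if_less expr_const)

lemma expr_if [expr_intros]:
  assumes "cond P" "expr c" "expr d"
  shows "expr (\<lambda>v s. if P v s then c v s else d v s)"
proof -
  have "expr (\<lambda>v s. if (0::nat) < of_bool (P v s) then c v s else d v s)"
    using assms(1) unfolding cond_def by (intro expr_if_less expr_const assms(2,3))
  moreover have "(\<lambda>v s. if (0::nat) < of_bool (P v s) then c v s else d v s) =
      (\<lambda>v s. if P v s then c v s else d v s)"
    by (auto simp: fun_eq_iff)
  ultimately show ?thesis by simp
qed

lemma cond_not [expr_intros]: "cond P \<Longrightarrow> cond (\<lambda>v s. \<not> P v s)"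
proof -
  assume "cond P"
  then have "expr (\<lambda>v s. if P v s then 0 else 1)" by (intro expr_if expr_const)
  moreover have "(\<lambda>v s. if P v s then 0 else 1) = (\<lambda>v s. of_bool (\<not> P v s) :: nat)"
    by (auto simp: fun_eq_iff)
  ultimately show ?thesis by (simp add: cond_def)
qed

lemma cond_conj [expr_intros]: "cond P \<Longrightarrow> cond Q \<Longrightarrow> cond (\<lambda>v s. P v s \<and> Q v s)"
proof -
  assume "cond P" "cond Q"
  then have "expr (\<lambda>v s. if P v s then of_bool (Q v s) else 0)"
    unfolding cond_def[of Q] by (intro expr_if expr_const)
  moreover have "(\<lambda>v s. if P v s then of_bool (Q v s) else 0) = (\<lambda>v s. of_bool (P v s \<and> Q v s) :: nat)"
    by (auto simp: fun_eq_iff)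
  ultimately show ?thesis by (simp add: cond_def)
qed

lemma cond_disj [expr_intros]: "cond P \<Longrightarrow> cond Q \<Longrightarrow> cond (\<lambda>v s. P v s \<or> Q v s)"
  using cond_not[OF cond_conj[OF cond_not[of P] cond_not[of Q]]] by simp

lemma cond_le [expr_intros]: "expr a \<Longrightarrow> expr b \<Longrightarrow> cond (\<lambda>v s. a v s \<le> b v s)"
  using cond_not[OF cond_less[of b a]] by (simp add: not_less)

lemma cond_eq [expr_intros]: "expr a \<Longrightarrow> expr b \<Longrightarrow> cond (\<lambda>v s. a v s = b v s)"
  unfolding eq_iff[of "_ :: nat"] by (intro cond_conj cond_le)

lemma expr_itr:
  assumes "expr a" "expr b" "expr (\<lambda>v s. f (\<lambda>j. v (Suc (Suc j))) s (v 0) (v 1))"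
  shows "expr (\<lambda>v s. itr (\<lambda>i x. f v s i x) (min (a v s) (s ''N'' 0)) (b v s))"
proof -
  obtain e1 e2 e3 where e:
    "ereads e1 \<inter> hidden = {}" "ereads e2 \<inter> hidden = {}" "ereads e3 \<inter> hidden = {}"
    "\<forall>v s. eval e1 v s = a v s" "\<forall>v s. eval e2 v s = b v s"
    "\<forall>v s. eval e3 v s = f (\<lambda>j. v (Suc (Suc j))) s (v 0) (v 1)"
    using assms by (auto simp: expr_def)
  have "eval (ERec e1 e2 e3) v s = itr (\<lambda>i x. f v s i x) (min (a v s) (s ''N'' 0)) (b v s)" for v s
    using e by simp
  then show ?thesis
    using e(1-3) unfolding expr_def by (intro exI[of _ "ERec e1 e2 e3"]) (auto simp: hidden_def)
qed

lemma itr_add: "itr (\<lambda>i x. x + f i) n 0 = (\<Sum>i<n. f i :: nat)"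
  by (induction n) auto

lemma expr_sum_min [expr_intros]:
  assumes "expr a" "expr (\<lambda>v s. f (\<lambda>j. v (Suc (Suc j))) s (v 0))"
  shows "expr (\<lambda>v s. \<Sum>i<min (a v s) (s ''N'' 0). f v s i)"
  using expr_itr[OF assms(1) expr_const, of "\<lambda>v s i x. x + f v s i" 0] assms(2)
  by (simp add: itr_add expr_add expr_var)

lemma expr_sum [expr_intros]:
  assumes "expr (\<lambda>v s. f (\<lambda>j. v (Suc (Suc j))) s (v 0))"
  shows "expr (\<lambda>v s. \<Sum>i<s ''N'' 0. f v s i)"
  using expr_sum_min[of "\<lambda>v s. s ''N'' 0" f] assms
  by (simp add: expr_cell expr_const hidden_def)

text \<open>The machine has no multiplication, so a product is a sum of equal terms over a loop,
  which clips one factor to \<open>N\<close>. Hence the \<open>min\<close> in the products of the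
  program.\<close>

lemma expr_mult_min [expr_intros]:
  assumes "expr a" "expr (\<lambda>v s. b (\<lambda>j. v (Suc (Suc j))) s)"
  shows "expr (\<lambda>v s. min (a v s) (s ''N'' 0) * b v s)"
  using expr_sum_min[of a "\<lambda>v s i. b v s"] assms by simp

section \<open>Substitution: closure of the expressible functions under composition\<close>

primrec ren :: "(nat \<Rightarrow> nat) \<Rightarrow> ex \<Rightarrow> ex" where
  "ren \<rho> (ENum c) = ENum c"
| "ren \<rho> (EVar i) = EVar (\<rho> i)"
| "ren \<rho> (ECell x a) = ECell x (ren \<rho> a)"
| "ren \<rho> (EAdd a b) = EAdd (ren \<rho> a) (ren \<rho> b)"
| "ren \<rho> (ESub a b) = ESub (ren \<rho> a) (ren \<rho> b)"
| "ren \<rho> (EIf a b c d) = EIf (ren \<rho> a) (ren \<rho> b) (ren \<rho> c) (ren \<rho> d)"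
| "ren \<rho> (ERec a b e) = ERec (ren \<rho> a) (ren \<rho> b)
     (ren (case_nat 0 (case_nat (Suc 0) (\<lambda>i. Suc (Suc (\<rho> i))))) e)"

lemma eval_ren: "eval (ren \<rho> e) v s = eval e (\<lambda>i. v (\<rho> i)) s"
proof (induction e arbitrary: \<rho> v)
  case (ERec a b e)
  have "(\<lambda>i'. case_nat i (case_nat x v) (case_nat 0 (case_nat (Suc 0) (\<lambda>i. Suc (Suc (\<rho> i)))) i'))
      = case_nat i (case_nat x (\<lambda>i. v (\<rho> i)))" for i x
    by (auto simp: fun_eq_iff split: nat.split)
  with ERec show ?case by simp
qed auto

lemma ereads_ren: "ereads (ren \<rho> e) = ereads e"
  by (induction e arbitrary: \<rho>) auto

primrec sub :: "(nat \<Rightarrow> ex) \<Rightarrow> ex \<Rightarrow> ex" where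
  "sub r (ENum c) = ENum c"
| "sub r (EVar i) = r i"
| "sub r (ECell x a) = ECell x (sub r a)"
| "sub r (EAdd a b) = EAdd (sub r a) (sub r b)"
| "sub r (ESub a b) = ESub (sub r a) (sub r b)"
| "sub r (EIf a b c d) = EIf (sub r a) (sub r b) (sub r c) (sub r d)"
| "sub r (ERec a b e) = ERec (sub r a) (sub r b)
     (sub (case_nat (EVar 0) (case_nat (EVar (Suc 0)) (\<lambda>i. ren (\<lambda>j. Suc (Suc j)) (r i)))) e)"

lemma eval_sub: "eval (sub r e) v s = eval e (\<lambda>i. eval (r i) v s) s"
proof (induction e arbitrary: r v)
  case (ERec a b e)
  have "(\<lambda>i'. eval (case_nat (EVar 0) (case_nat (EVar (Suc 0)) (\<lambda>i. ren (\<lambda>j. Suc (Suc j)) (r i))) i')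
        (case_nat i (case_nat x v)) s)
      = case_nat i (case_nat x (\<lambda>i. eval (r i) v s))" for i x
    by (auto simp: fun_eq_iff eval_ren split: nat.split)
  with ERec show ?case by simp
qed auto

lemma ereads_sub: "(\<And>i. ereads (r i) \<inter> H = {}) \<Longrightarrow> ereads e \<inter> H = {} \<Longrightarrow> ereads (sub r e) \<inter> H = {}"
proof (induction e arbitrary: r)
  case (ERec a b e)
  have "ereads (case_nat (EVar 0) (case_nat (EVar (Suc 0)) (\<lambda>i. ren (\<lambda>j. Suc (Suc j)) (r i))) i) \<inter> H = {}" for i
    using ERec.prems(1) by (auto simp: ereads_ren split: nat.split)
  with ERec show ?case by (auto simp: Int_Un_distrib2)
qed (auto simp: Int_Un_distrib2)

text \<open>Lets a function be shown expressible once, with variables as arguments, and then be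
  applied to arbitrary expressible arguments, although the loops inside it shift the
  variables.\<close>

lemma expr_comp:
  assumes "expr (\<lambda>v s. h v s)" "\<And>i. expr (g i)"
  shows "expr (\<lambda>v s. h (\<lambda>i. g i v s) s)"
proof -
  obtain e where e: "ereads e \<inter> hidden = {}" "\<And>v s. eval e v s = h v s"
    using assms(1) by (auto simp: expr_def)
  obtain r where r: "\<And>i. ereads (r i) \<inter> hidden = {}" "\<And>i v s. eval (r i) v s = g i v s"
    using assms(2) unfolding expr_def by metis
  show ?thesis
    unfolding expr_def using ereads_sub[OF r(1) e(1)]
    by (intro exI[of _ "sub r e"]) (auto simp: eval_sub e r)
qed

lemma expr_comp1:
  assumes "expr (\<lambda>v s. h s (v 0))" "expr a"
  shows "expr (\<lambda>v s. h s (a v s))"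
  using expr_comp[OF assms(1), of "\<lambda>i. a"] assms(2) by simp

lemma expr_comp2:
  assumes "expr (\<lambda>v s. h s (v 0) (v 1))" "expr a" "expr b"
  shows "expr (\<lambda>v s. h s (a v s) (b v s))"
  using expr_comp[OF assms(1), of "\<lambda>i. if i = 0 then a else b"] assms(2,3) by simp

lemma expr_comp3:
  assumes "expr (\<lambda>v s. h s (v 0) (v 1) (v 2))" "expr a" "expr b" "expr c"
  shows "expr (\<lambda>v s. h s (a v s) (b v s) (c v s))"
  using expr_comp[OF assms(1), of "\<lambda>i. if i = 0 then a else if i = 1 then b else c"] assms(2-4) by simp

section \<open>Statements as state transformers\<close>

definition seq :: "(state \<Rightarrow> state) \<Rightarrow> (state \<Rightarrow> state) \<Rightarrow> state \<Rightarrow> state" (infixr \<open>;;\<close> 60) where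
  "(f ;; g) s = g (f s)"

definition assign :: "vname \<Rightarrow> (state \<Rightarrow> nat) \<Rightarrow> (state \<Rightarrow> nat) \<Rightarrow> state \<Rightarrow> state" where
  "assign x a b s = upd x (a s) (b s) s"

definition for_st :: "(state \<Rightarrow> nat) \<Rightarrow> (nat \<Rightarrow> state \<Rightarrow> state) \<Rightarrow> state \<Rightarrow> state" where
  "for_st b F s = itr F (min (b s) (s ''N'' 0)) s"

definition fill :: "vname \<Rightarrow> (state \<Rightarrow> nat) \<Rightarrow> (nat \<Rightarrow> state \<Rightarrow> nat) \<Rightarrow> state \<Rightarrow> state" where
  "fill x b f = for_st b (\<lambda>i. assign x (\<lambda>s. Suc i) (f (Suc i)))"

text \<open>A single \<open>p\<close> has to serve all oracles \<open>A\<close>; this uniformity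
  permits comparing its runs with \<open>ask\<close> and \<open>honest\<close>.\<close>

definition prog :: "((state \<Rightarrow> state) \<Rightarrow> (nat \<Rightarrow> nat) \<Rightarrow> state \<Rightarrow> state) \<Rightarrow> bool" where
  "prog F \<longleftrightarrow> (\<exists>p. sreads p \<inter> hidden = {} \<and> swrites p \<inter> (hidden \<union> inputs) = {} \<and>
     (\<forall>A v s. run A p v s = F A v s))"

lemma prog_ask [expr_intros]: "prog (\<lambda>A v. A)"
  unfolding prog_def by (rule exI[of _ SAsk]) simp

lemma prog_seq [expr_intros]: "prog F \<Longrightarrow> prog G \<Longrightarrow> prog (\<lambda>A v. F A v ;; G A v)"
  unfolding prog_def seq_def by (elim exE, rule_tac x = "SSeq p pa" in exI) auto

lemma prog_assign [expr_intros]: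
  assumes "x \<notin> hidden \<union> inputs" "expr (\<lambda>v s. a v s)" "expr (\<lambda>v s. b v s)"
  shows "prog (\<lambda>A v. assign x (a v) (b v))"
proof -
  obtain e1 e2 where
    "ereads e1 \<inter> hidden = {}" "ereads e2 \<inter> hidden = {}"
    "\<forall>v s. eval e1 v s = a v s" "\<forall>v s. eval e2 v s = b v s"
    using assms(2,3) by (auto simp: expr_def)
  then show ?thesis
    using assms(1) unfolding prog_def assign_def by (intro exI[of _ "SSet x e1 e2"]) auto
qed

lemma prog_for [expr_intros]:
  assumes "expr (\<lambda>v s. b v s)" "prog (\<lambda>A v. F A (\<lambda>j. v (Suc j)) (v 0))"
  shows "prog (\<lambda>A v. for_st (b v) (\<lambda>i. F A v i))"
proof -
  obtain e where e: "ereads e \<inter> hidden = {}" "\<forall>v s. eval e v s = b v s"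
    using assms(1) by (auto simp: expr_def)
  obtain p where p: "sreads p \<inter> hidden = {}" "swrites p \<inter> (hidden \<union> inputs) = {}"
    "\<forall>A v s. run A p v s = F A (\<lambda>j. v (Suc j)) (v 0) s"
    using assms(2) by (auto simp: prog_def)
  have "run A p (case_nat i v) = F A v i" for A v i
    using p(3) by (auto simp: fun_eq_iff)
  then have "run A (SFor e p) v s = for_st (b v) (\<lambda>i. F A v i) s" for A v s
    using e(2) by (simp add: for_st_def)
  then show ?thesis
    using e(1) p(1,2) unfolding prog_def
    by (intro exI[of _ "SFor e p"]) (auto simp: hidden_def)
qed

lemma prog_fill [expr_intros]:
  assumes "x \<notin> hidden \<union> inputs" "expr (\<lambda>v s. b v s)"
    "expr (\<lambda>v s. f (\<lambda>j. v (Suc j)) (Suc (v 0)) s)"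
  shows "prog (\<lambda>A v. fill x (b v) (\<lambda>i s. f v i s))"
  unfolding fill_def
  by (intro prog_for prog_assign assms expr_Suc expr_var)

section \<open>The program\<close>

text \<open>
  The functions from \<open>cdiv\<close> to \<open>ccolour\<close> are cut off at their first argument
  \<open>N\<close>, as all loops are; up to \<open>N\<close> they compute what they are named after.
\<close>

definition cdiv :: "nat \<Rightarrow> nat \<Rightarrow> nat \<Rightarrow> nat" where
  "cdiv N a b = (\<Sum>i<N. if min (Suc i) N * b \<le> a then 1 else 0)"

definition cpow :: "nat \<Rightarrow> nat \<Rightarrow> nat" where
  "cpow N x = itr (\<lambda>_ y. y + y) (min x N) 1"

definition cparity :: "nat \<Rightarrow> nat \<Rightarrow> nat" where
  "cparity N x = x - (cdiv N x 2 + cdiv N x 2)"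

definition cbit :: "nat \<Rightarrow> nat \<Rightarrow> nat \<Rightarrow> nat" where
  "cbit N S b = cparity N (cdiv N S (cpow N b))"

definition cpopcount :: "nat \<Rightarrow> nat \<Rightarrow> nat" where
  "cpopcount N S = (\<Sum>b<N. cbit N S b)"

definition ccolumns :: "nat \<Rightarrow> nat \<Rightarrow> nat \<Rightarrow> nat" where
  "ccolumns N j S = cdiv N (cpopcount N S + j - 1) j"

definition cbefore :: "nat \<Rightarrow> nat \<Rightarrow> nat \<Rightarrow> nat" where
  "cbefore N j S = (\<Sum>i<min S N. ccolumns N j i)"

definition cset :: "nat \<Rightarrow> nat \<Rightarrow> nat \<Rightarrow> nat" where
  "cset N j u = (\<Sum>S<N. if cbefore N j (Suc S) \<le> u then 1 else 0)"

definition cexponent :: "nat \<Rightarrow> nat \<Rightarrow> nat \<Rightarrow> nat" where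
  "cexponent N j u = min (u - cbefore N j (cset N j u)) N * j"

definition centry_at :: "nat \<Rightarrow> nat \<Rightarrow> nat \<Rightarrow> nat \<Rightarrow> nat" where
  "centry_at N S t T = (if cparity N (\<Sum>b<N. if cbit N T b = 1 \<and> cbit N S b = 1 then 1 else 0) = 0 \<and>
     (\<Sum>b<N. if cbit N T b = 1 \<and> cbit N S b = 1 \<and> t < (\<Sum>a<min b N. cbit N S a) then 1 else 0) = (0::nat)
     then 1 else 0)"

definition centry :: "nat \<Rightarrow> nat \<Rightarrow> nat \<Rightarrow> nat \<Rightarrow> nat" where
  "centry N j u T = centry_at N (cset N j u) (cexponent N j u) T"

definition cexcess :: "nat \<Rightarrow> nat \<Rightarrow> nat \<Rightarrow> nat" where
  "cexcess N T S = (\<Sum>b<N. if cbit N T b = 1 \<and> cbit N S b = 0 then 1 else 0)"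

definition residual :: "nat \<Rightarrow> nat \<Rightarrow> nat \<Rightarrow> (nat \<Rightarrow> nat) \<Rightarrow> (nat \<Rightarrow> nat) \<Rightarrow> nat \<Rightarrow> nat \<Rightarrow> nat" where
  "residual N m j res val u T =
     res T - (\<Sum>u'<min m N. if u < u' \<and> centry N j u' T = 1 then val u' else 0)"

definition decode :: "nat \<Rightarrow> nat \<Rightarrow> nat \<Rightarrow> (nat \<Rightarrow> nat) \<Rightarrow> (nat \<Rightarrow> nat) \<Rightarrow> nat \<Rightarrow> nat" where
  "decode N m j res val u = cdiv N
    ((\<Sum>T<N. if cexcess N T (cset N j u) = 0 \<and> cparity N (cpopcount N T) = 0 then residual N m j res val u T else 0) -
     (\<Sum>T<N. if cexcess N T (cset N j u) = 0 \<and> cparity N (cpopcount N T) = 1 then residual N m j res val u T else 0))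
    (\<Sum>T<N. if cexcess N T (cset N j u) = 0 \<and> centry N j u T = 1 then 1 else 0)"

definition crank :: "nat \<Rightarrow> nat \<Rightarrow> (nat \<Rightarrow> nat) \<Rightarrow> nat \<Rightarrow> nat \<Rightarrow> nat" where
  "crank N k cnt v c = (\<Sum>c'<N. if 1 \<le> c' \<and> c' \<le> k \<and> (cnt (min v N * N + c) < cnt (min v N * N + c') \<or>
       cnt (min v N * N + c) = cnt (min v N * N + c') \<and> c' < c) then 1 else 0)"

definition ccolour :: "nat \<Rightarrow> nat \<Rightarrow> (nat \<Rightarrow> nat) \<Rightarrow> nat \<Rightarrow> nat \<Rightarrow> nat" where
  "ccolour N k cnt v r = (\<Sum>c<N. if 1 \<le> c \<and> c \<le> k \<and> crank N k cnt v c = r then c else 0)"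

lemma not_hidden [expr_intros]:
  "''N'' \<notin> hidden" "''n'' \<notin> hidden" "''k'' \<notin> hidden" "''m'' \<notin> hidden" "''j'' \<notin> hidden"
  "''off'' \<notin> hidden" "''base'' \<notin> hidden" "''res'' \<notin> hidden" "''val'' \<notin> hidden"
  "''cnt'' \<notin> hidden" "''dum'' \<notin> hidden" "''L'' \<notin> hidden" "''l'' \<notin> hidden" "''r'' \<notin> hidden"
  "''ans'' \<notin> hidden"
  by (auto simp: hidden_def)

lemma not_protected [expr_intros]:
  "''m'' \<notin> hidden \<union> inputs" "''j'' \<notin> hidden \<union> inputs" "''G'' \<notin> hidden \<union> inputs"
  "''off'' \<notin> hidden \<union> inputs" "''base'' \<notin> hidden \<union> inputs" "''res'' \<notin> hidden \<union> inputs"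
  "''val'' \<notin> hidden \<union> inputs" "''cnt'' \<notin> hidden \<union> inputs" "''dum'' \<notin> hidden \<union> inputs"
  "''L'' \<notin> hidden \<union> inputs" "''l'' \<notin> hidden \<union> inputs" "''r'' \<notin> hidden \<union> inputs"
  by (auto simp: hidden_def inputs_def)

lemma expr_cdiv [expr_intros]: "expr a \<Longrightarrow> expr b \<Longrightarrow> expr (\<lambda>v s. cdiv (s ''N'' 0) (a v s) (b v s))"
  by (rule expr_comp2[where h = "\<lambda>s. cdiv (s ''N'' 0)"]) (unfold cdiv_def, intro expr_intros)

lemma expr_cpow [expr_intros]: "expr a \<Longrightarrow> expr (\<lambda>v s. cpow (s ''N'' 0) (a v s))"
  by (rule expr_comp1[where h = "\<lambda>s. cpow (s ''N'' 0)"]) (unfold cpow_def, intro expr_itr expr_intros)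

lemma expr_cparity [expr_intros]: "expr a \<Longrightarrow> expr (\<lambda>v s. cparity (s ''N'' 0) (a v s))"
  unfolding cparity_def by (intro expr_intros)

lemma expr_cbit [expr_intros]: "expr a \<Longrightarrow> expr b \<Longrightarrow> expr (\<lambda>v s. cbit (s ''N'' 0) (a v s) (b v s))"
  unfolding cbit_def by (intro expr_intros)

lemma expr_cpopcount [expr_intros]: "expr a \<Longrightarrow> expr (\<lambda>v s. cpopcount (s ''N'' 0) (a v s))"
  by (rule expr_comp1[where h = "\<lambda>s. cpopcount (s ''N'' 0)"]) (unfold cpopcount_def, intro expr_intros)

lemma expr_ccolumns [expr_intros]: "expr a \<Longrightarrow> expr b \<Longrightarrow> expr (\<lambda>v s. ccolumns (s ''N'' 0) (a v s) (b v s))"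
  unfolding ccolumns_def by (intro expr_intros)

lemma expr_cbefore [expr_intros]: "expr a \<Longrightarrow> expr b \<Longrightarrow> expr (\<lambda>v s. cbefore (s ''N'' 0) (a v s) (b v s))"
  by (rule expr_comp2[where h = "\<lambda>s. cbefore (s ''N'' 0)"]) (unfold cbefore_def, intro expr_intros)

lemma expr_cset [expr_intros]: "expr a \<Longrightarrow> expr b \<Longrightarrow> expr (\<lambda>v s. cset (s ''N'' 0) (a v s) (b v s))"
  by (rule expr_comp2[where h = "\<lambda>s. cset (s ''N'' 0)"]) (unfold cset_def, intro expr_intros)

lemma expr_cexponent [expr_intros]: "expr a \<Longrightarrow> expr b \<Longrightarrow> expr (\<lambda>v s. cexponent (s ''N'' 0) (a v s) (b v s))"
  by (rule expr_comp2[where h = "\<lambda>s. cexponent (s ''N'' 0)"]) (unfold cexponent_def, intro expr_intros)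

lemma expr_centry_at [expr_intros]:
  "expr a \<Longrightarrow> expr b \<Longrightarrow> expr c \<Longrightarrow> expr (\<lambda>v s. centry_at (s ''N'' 0) (a v s) (b v s) (c v s))"
  by (rule expr_comp3[where h = "\<lambda>s. centry_at (s ''N'' 0)"]) (unfold centry_at_def, intro expr_intros)

lemma expr_centry [expr_intros]:
  "expr a \<Longrightarrow> expr b \<Longrightarrow> expr c \<Longrightarrow> expr (\<lambda>v s. centry (s ''N'' 0) (a v s) (b v s) (c v s))"
  unfolding centry_def by (intro expr_intros)

lemma expr_cexcess [expr_intros]: "expr a \<Longrightarrow> expr b \<Longrightarrow> expr (\<lambda>v s. cexcess (s ''N'' 0) (a v s) (b v s))"
  by (rule expr_comp2[where h = "\<lambda>s. cexcess (s ''N'' 0)"]) (unfold cexcess_def, intro expr_intros)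

lemma expr_residual [expr_intros]:
  "expr a \<Longrightarrow> expr b \<Longrightarrow>
   expr (\<lambda>v s. residual (s ''N'' 0) (s ''m'' 0) (s ''j'' 0) (s ''res'') (s ''val'') (a v s) (b v s))"
  by (rule expr_comp2[where h = "\<lambda>s. residual (s ''N'' 0) (s ''m'' 0) (s ''j'' 0) (s ''res'') (s ''val'')"])
    (unfold residual_def, intro expr_intros)

lemma expr_decode [expr_intros]:
  "expr a \<Longrightarrow>
   expr (\<lambda>v s. decode (s ''N'' 0) (s ''m'' 0) (s ''j'' 0) (s ''res'') (s ''val'') (a v s))"
  by (rule expr_comp1[where h = "\<lambda>s. decode (s ''N'' 0) (s ''m'' 0) (s ''j'' 0) (s ''res'') (s ''val'')"])
    (unfold decode_def, intro expr_intros)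

lemma expr_crank [expr_intros]:
  "expr a \<Longrightarrow> expr b \<Longrightarrow> expr (\<lambda>v s. crank (s ''N'' 0) (s ''k'' 0) (s ''cnt'') (a v s) (b v s))"
  by (rule expr_comp2[where h = "\<lambda>s. crank (s ''N'' 0) (s ''k'' 0) (s ''cnt'')"])
    (unfold crank_def, intro expr_intros)

lemma expr_ccolour [expr_intros]:
  "expr a \<Longrightarrow> expr b \<Longrightarrow> expr (\<lambda>v s. ccolour (s ''N'' 0) (s ''k'' 0) (s ''cnt'') (a v s) (b v s))"
  by (rule expr_comp2[where h = "\<lambda>s. ccolour (s ''N'' 0) (s ''k'' 0) (s ''cnt'')"])
    (unfold ccolour_def, intro expr_intros)

text \<open>Answer \<open>T\<close> becomes the \<open>T\<close>-th linear form of the unknowns by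
  adding \<open>off\<close> for each column with entry 1 and subtracting \<open>base\<close>. The
  unknowns are found from the last column to the first, since \<open>residual\<close> subtracts the
  contributions of the later columns.\<close>

definition detect :: "(nat \<Rightarrow> nat \<Rightarrow> state \<Rightarrow> nat) \<Rightarrow> (state \<Rightarrow> state) \<Rightarrow> state \<Rightarrow> state" where
  "detect query A =
     for_st (\<lambda>s. Suc (cset (s ''N'' 0) (s ''j'' 0) (s ''m'' 0 - 1)))
       (\<lambda>T. fill ''G'' (\<lambda>s. s ''n'' 0) (query T) ;; A ;;
          assign ''res'' (\<lambda>s. T) (\<lambda>s. s ''ans'' 0 + (\<Sum>u<min (s ''m'' 0) (s ''N'' 0).
              if centry (s ''N'' 0) (s ''j'' 0) u T = 1 then s ''off'' 0 else 0) - s ''base'' 0)) ;;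
     for_st (\<lambda>s. s ''m'' 0)
       (\<lambda>i. assign ''val'' (\<lambda>s. s ''m'' 0 - 1 - i)
          (\<lambda>s. decode (s ''N'' 0) (s ''m'' 0) (s ''j'' 0) (s ''res'') (s ''val'') (s ''m'' 0 - 1 - i)))"

lemma prog_detect [expr_intros]:
  "expr (\<lambda>v s. query (v 1) (Suc (v 0)) s) \<Longrightarrow> prog (\<lambda>A v. detect query A)"
  unfolding detect_def by (intro expr_intros) simp

definition query_zero :: "nat \<Rightarrow> nat \<Rightarrow> state \<Rightarrow> nat" where
  "query_zero T i s = (if centry (s ''N'' 0) (s ''j'' 0) (i - 1) T = 1 then 1 else 2)"

definition width :: "state \<Rightarrow> nat" where
  "width s = cpow (s ''N'' 0) (s ''L'' 0 - s ''l'' 0)"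

text \<open>Heap numbering: the root is 1, the children of \<open>v\<close> are \<open>2 * v\<close>
  and \<open>2 * v + 1\<close>, and position \<open>i\<close> is the leaf
  \<open>2 ^ L + (i - 1)\<close>. An ancestor arises by dropping low bits.\<close>

definition cancestor :: "nat \<Rightarrow> nat \<Rightarrow> nat \<Rightarrow> nat \<Rightarrow> nat" where
  "cancestor N L l i = cdiv N (cpow N L + (i - 1)) (cpow N (L - l))"

text \<open>Only positions below left children, which have even numbers, of the nodes selected by
  row \<open>T\<close> are tested; the wrong colour \<open>dum\<close> keeps all other positions out
  of the answer.\<close>

definition query_split :: "nat \<Rightarrow> nat \<Rightarrow> state \<Rightarrow> nat" where
  "query_split T i s =
     (if cparity (s ''N'' 0) (cancestor (s ''N'' 0) (s ''L'' 0) (Suc (s ''l'' 0)) i) = 0 \<and>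
         centry (s ''N'' 0) (s ''j'' 0)
           (cancestor (s ''N'' 0) (s ''L'' 0) (s ''l'' 0) i - cpow (s ''N'' 0) (s ''l'' 0)) T = 1
      then ccolour (s ''N'' 0) (s ''k'' 0) (s ''cnt'') (cancestor (s ''N'' 0) (s ''L'' 0) (s ''l'' 0) i) (s ''r'' 0)
      else s ''dum'' i)"

definition node :: "nat \<Rightarrow> state \<Rightarrow> nat" where
  "node B s = cpow (s ''N'' 0) (s ''l'' 0) + B"

definition chosen :: "nat \<Rightarrow> state \<Rightarrow> nat" where
  "chosen B s = ccolour (s ''N'' 0) (s ''k'' 0) (s ''cnt'') (node B s) (s ''r'' 0)"

definition store :: "nat \<Rightarrow> state \<Rightarrow> state" where
  "store B =
     assign ''cnt'' (\<lambda>s. min (node B s + node B s) (s ''N'' 0) * s ''N'' 0 + chosen B s)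
       (\<lambda>s. s ''val'' B) ;;
     assign ''cnt'' (\<lambda>s. min (Suc (node B s + node B s)) (s ''N'' 0) * s ''N'' 0 + chosen B s)
       (\<lambda>s. s ''cnt'' (min (node B s) (s ''N'' 0) * s ''N'' 0 + chosen B s) - s ''val'' B)"

definition split_colour :: "(state \<Rightarrow> state) \<Rightarrow> nat \<Rightarrow> state \<Rightarrow> state" where
  "split_colour A r =
     assign ''r'' (\<lambda>s. 0) (\<lambda>s. r) ;;
     assign ''m'' (\<lambda>s. 0) (\<lambda>s. cpow (s ''N'' 0) (s ''l'' 0)) ;;
     assign ''j'' (\<lambda>s. 0) (\<lambda>s. \<Sum>i<s ''N'' 0. if min (Suc r) (s ''N'' 0) * cpow (s ''N'' 0) i \<le> width s then 1 else 0) ;;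
     detect query_split A ;;
     for_st (\<lambda>s. s ''m'' 0) store"

definition split_level :: "(state \<Rightarrow> state) \<Rightarrow> nat \<Rightarrow> state \<Rightarrow> state" where
  "split_level A l =
     assign ''l'' (\<lambda>s. 0) (\<lambda>s. l) ;;
     for_st (\<lambda>s. if s ''k'' 0 < width s then s ''k'' 0 else width s) (split_colour A)"

text \<open>Cell \<open>v * N + c\<close> of \<open>cnt\<close> belongs to node \<open>v\<close> and
  colour \<open>c\<close>, so \<open>N + c\<close> is the entry of the root.\<close>

definition count_colours :: "(state \<Rightarrow> state) \<Rightarrow> state \<Rightarrow> state" where
  "count_colours A = for_st (\<lambda>s. s ''k'' 0)
     (\<lambda>c. fill ''G'' (\<lambda>s. s ''n'' 0) (\<lambda>i s. Suc c) ;; A ;;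
        assign ''cnt'' (\<lambda>s. s ''N'' 0 + Suc c) (\<lambda>s. s ''ans'' 0))"

text \<open>Asking colour 1 instead of 2 at a position changes the answer by 1, -1 or 0 if the true
  colour is 1, 2 or another one. The shift \<open>off = 1\<close> turns this into the two-bit
  unknowns 2, 0 and 1, hence \<open>j = 2\<close>; \<open>base\<close> is the answer to the constant
  guess 2.\<close>

definition find_zero :: "(state \<Rightarrow> state) \<Rightarrow> state \<Rightarrow> state" where
  "find_zero A =
     assign ''m'' (\<lambda>s. 0) (\<lambda>s. s ''n'' 0) ;;
     assign ''j'' (\<lambda>s. 0) (\<lambda>s. 2) ;;
     assign ''off'' (\<lambda>s. 0) (\<lambda>s. 1) ;;
     assign ''base'' (\<lambda>s. 0) (\<lambda>s. s ''cnt'' (s ''N'' 0 + 2)) ;;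
     detect query_zero A ;;
     fill ''dum'' (\<lambda>s. s ''n'' 0) (\<lambda>i s. if s ''val'' (i - 1) = 2 then 2 else 1)"

text \<open>In the final guess, the counts at a leaf are 0 except for a 1 at the colour of its
  position, so the sum of \<open>c\<close> times its count is this colour.\<close>

definition play :: "(state \<Rightarrow> state) \<Rightarrow> state \<Rightarrow> state" where
  "play A =
     count_colours A ;;
     find_zero A ;;
     assign ''off'' (\<lambda>s. 0) (\<lambda>s. 0) ;;
     assign ''base'' (\<lambda>s. 0) (\<lambda>s. 0) ;;
     assign ''L'' (\<lambda>s. 0) (\<lambda>s. \<Sum>i<s ''N'' 0. if cpow (s ''N'' 0) i < s ''n'' 0 then 1 else 0) ;;
     for_st (\<lambda>s. s ''L'' 0) (split_level A) ;;
     fill ''G'' (\<lambda>s. s ''n'' 0) (\<lambda>i s. \<Sum>c<s ''N'' 0.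
        if c \<le> s ''k'' 0 then min c (s ''N'' 0) *
          s ''cnt'' (min (cpow (s ''N'' 0) (s ''L'' 0) + (i - 1)) (s ''N'' 0) * s ''N'' 0 + c) else 0) ;;
     A"

lemma expr_cancestor [expr_intros]:
  "expr a \<Longrightarrow> expr b \<Longrightarrow> expr c \<Longrightarrow> expr (\<lambda>v s. cancestor (s ''N'' 0) (a v s) (b v s) (c v s))"
  unfolding cancestor_def by (intro expr_intros)

lemma prog_play: "prog (\<lambda>A v. play A)"
proof -
  have node: "expr (\<lambda>v s. node (b v) s)" if "expr (\<lambda>v s. b v)" for b
    unfolding node_def using that by (intro expr_intros)
  have chosen: "expr (\<lambda>v s. chosen (b v) s)" if "expr (\<lambda>v s. b v)" for b
    unfolding chosen_def using that by (intro expr_intros node)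
  have store: "prog (\<lambda>A v. store (b v))" if "expr (\<lambda>v s. b v)" "expr (\<lambda>v s. b (\<lambda>j. v (Suc (Suc j))))" for b
    unfolding store_def using that by (intro expr_intros chosen node)
  have width: "expr (\<lambda>v s. width s)"
    unfolding width_def by (intro expr_intros)
  have colour: "prog (\<lambda>A v. split_colour A (v 0))"
    unfolding split_colour_def query_split_def by (intro expr_intros width store)
  have level: "prog (\<lambda>A v. split_level A (v 0))"
    unfolding split_level_def by (intro expr_intros width colour)
  show ?thesis
    unfolding play_def find_zero_def count_colours_def query_zero_def
    by (intro expr_intros level)
qed

section \<open>Signed sums over subsets\<close>

text \<open>Toggling an element of \<open>X\<close> outside \<open>Y\<close> flips the sign and
  leaves \<open>T \<inter> Y\<close> unchanged, so the terms cancel in pairs.\<close>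

lemma signed_sum_Pow_eq_0:
  fixes h :: "'a set \<Rightarrow> int"
  assumes "finite X" "\<not> X \<subseteq> Y"
  shows "(\<Sum>T\<in>Pow X. (- 1) ^ card T * h (T \<inter> Y)) = 0"
proof -
  obtain b where b: "b \<in> X" "b \<notin> Y" using assms(2) by auto
  define Z where "Z = X - {b}"
  have Z: "X = insert b Z" "b \<notin> Z" "finite Z" using b assms(1) by (auto simp: Z_def)
  let ?f = "\<lambda>T. (- 1) ^ card T * h (T \<inter> Y)"
  have "(\<Sum>T\<in>Pow X. ?f T) = (\<Sum>T\<in>Pow Z. ?f T) + (\<Sum>T\<in>insert b ` Pow Z. ?f T)"
    unfolding Z(1) Pow_insert using Z(2,3) by (intro sum.union_disjoint) auto
  also have "(\<Sum>T\<in>insert b ` Pow Z. ?f T) = (\<Sum>T\<in>Pow Z. ?f (insert b T))"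
    using Z(2) by (intro sum.reindex_cong[of "insert b"] inj_onI) auto
  also have "\<dots> = (\<Sum>T\<in>Pow Z. - ?f T)"
  proof (rule sum.cong)
    fix T assume "T \<in> Pow Z"
    then have "b \<notin> T" "finite T" using Z finite_subset by auto
    then show "?f (insert b T) = - ?f T" using b(2) by simp
  qed simp
  finally show ?thesis by (simp add: sum_negf)
qed

lemma sum_even_subsets:
  assumes "finite X" "X \<noteq> {}"
  shows "(\<Sum>T\<in>Pow X. of_bool (even (card T))) = (2 ^ (card X - 1) :: int)"
proof -
  have "(\<Sum>T\<in>Pow X. (- 1) ^ card T) = (0 :: int)"
    using signed_sum_Pow_eq_0[of X "{}" "\<lambda>_. 1"] assms by simp
  moreover have "2 * (\<Sum>T\<in>Pow X. of_bool (even (card T))) =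
      (\<Sum>T\<in>Pow X. 1 + (- 1) ^ card T :: int)"
    unfolding sum_distrib_left by (rule sum.cong) auto
  ultimately have "2 * (\<Sum>T\<in>Pow X. of_bool (even (card T))) = (2 ^ card X :: int)"
    by (simp add: sum.distrib card_Pow assms)
  moreover have "card X > 0" using assms by (simp add: card_gt_0_iff)
  then have "(2 ^ card X :: int) = 2 * 2 ^ (card X - 1)" by (cases "card X") auto
  ultimately show ?thesis by simp
qed

text \<open>Serves two orders: that of the elements of a set in \<open>card_lowest\<close>, and that
  of the colours by frequency.\<close>

lemma bij_betw_rank:
  assumes "finite X" and irr: "\<And>a. \<not> R a a" and tr: "\<And>a b c. R a b \<Longrightarrow> R b c \<Longrightarrow> R a c"
    and tot: "\<And>a b. a \<in> X \<Longrightarrow> b \<in> X \<Longrightarrow> a \<noteq> b \<Longrightarrow> R a b \<or> R b a"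
  shows "bij_betw (\<lambda>b. card {a \<in> X. R a b}) X {..<card X}"
proof -
  let ?r = "\<lambda>b. card {a \<in> X. R a b}"
  have less: "?r a < ?r b" if "a \<in> X" "R a b" for a b
  proof (rule psubset_card_mono)
    show "{c \<in> X. R c a} \<subset> {c \<in> X. R c b}"
      using that irr tr by blast
  qed (use assms(1) in auto)
  have inj: "inj_on ?r X"
  proof (rule inj_onI, rule ccontr)
    fix a b assume *: "a \<in> X" "b \<in> X" "?r a = ?r b" "a \<noteq> b"
    with tot[of a b] less[of a b] less[of b a] show False by auto
  qed
  have "?r b < card X" if "b \<in> X" for b
    by (rule psubset_card_mono) (use that irr assms(1) in auto)
  then have "?r ` X \<subseteq> {..<card X}" by auto
  moreover have "card (?r ` X) = card {..<card X}" using card_image[OF inj] by simp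
  ultimately have "?r ` X = {..<card X}" by (intro card_subset_eq) auto
  with inj show ?thesis by (simp add: bij_betw_def)
qed

definition lowest :: "nat set \<Rightarrow> nat \<Rightarrow> nat set" where
  "lowest X t = {b \<in> X. card {a \<in> X. a < b} \<le> t}"

lemma card_lowest:
  assumes "finite X" "t < card X"
  shows "card (lowest X t) = Suc t"
proof -
  have b: "bij_betw (\<lambda>b. card {a \<in> X. a < b}) X {..<card X}"
    by (rule bij_betw_rank) (use assms in auto)
  have "bij_betw (\<lambda>b. card {a \<in> X. a < b}) (lowest X t) {..t}"
  proof (rule bij_betw_subset[OF b])
    show "(\<lambda>b. card {a \<in> X. a < b}) ` lowest X t = {..t}"
    proof
      show "{..t} \<subseteq> (\<lambda>b. card {a \<in> X. a < b}) ` lowest X t"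
      proof
        fix i assume "i \<in> {..t}"
        then obtain b where "b \<in> X" "i = card {a \<in> X. a < b}"
        proof -
          have "i \<in> (\<lambda>b. card {a \<in> X. a < b}) ` X"
            using bij_betw_imp_surj_on[OF b] \<open>i \<in> {..t}\<close> assms(2) by simp
          then show thesis using that by auto
        qed
        then show "i \<in> (\<lambda>b. card {a \<in> X. a < b}) ` lowest X t"
          using \<open>i \<in> {..t}\<close> by (auto simp: lowest_def)
      qed
    qed (auto simp: lowest_def)
  qed (auto simp: lowest_def)
  then show ?thesis using bij_betw_same_card by fastforce
qed

text \<open>Lindstroem's columns. The entry depends on \<open>T\<close> only through
  \<open>T \<inter> X\<close>, which makes signed sums over the subsets of a set not contained in
  \<open>X\<close> vanish. Over the subsets of \<open>X\<close> itself, evenness makes all signs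
  positive, and \<open>t + 1\<close> elements have \<open>2 ^ t\<close> even subsets.\<close>

definition entry_at :: "nat set \<Rightarrow> nat \<Rightarrow> nat set \<Rightarrow> nat" where
  "entry_at X t T = of_bool (even (card (T \<inter> X)) \<and> T \<inter> X \<subseteq> lowest X t)"

lemma signed_sum_entry_at:
  assumes "finite X" "t < card X"
  shows "(\<Sum>T\<in>Pow X. (- 1) ^ card T * int (entry_at X t T)) = 2 ^ t"
proof -
  have sub: "lowest X t \<subseteq> X" by (auto simp: lowest_def)
  have c: "card (lowest X t) = Suc t" by (rule card_lowest[OF assms])
  have f: "finite (lowest X t)" using sub assms(1) finite_subset by blast
  have "(\<Sum>T\<in>Pow X. (- 1) ^ card T * int (entry_at X t T)) =
      (\<Sum>T\<in>Pow (lowest X t). (- 1) ^ card T * int (entry_at X t T))"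
    by (rule sum.mono_neutral_right) (use assms(1) sub in \<open>auto simp: entry_at_def Int_absorb2\<close>)
  also have "\<dots> = (\<Sum>T\<in>Pow (lowest X t). of_bool (even (card T)))"
    by (rule sum.cong) (use sub in \<open>auto simp: entry_at_def Int_absorb2\<close>)
  also have "\<dots> = 2 ^ (card (lowest X t) - 1)"
    by (rule sum_even_subsets) (use f c in auto)
  finally show ?thesis by (simp add: c)
qed

lemma signed_sum_entry_at_0:
  assumes "finite X" "\<not> X \<subseteq> Y"
  shows "(\<Sum>T\<in>Pow X. (- 1) ^ card T * int (entry_at Y t T)) = 0"
  using signed_sum_Pow_eq_0[OF assms, of "\<lambda>Z. int (entry_at Y t Z)"]
  by (simp add: entry_at_def inf_assoc)

section \<open>The detecting matrix\<close>

text \<open>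
  Rows and columns are labelled by finite sets, coded as numbers.  A set \<open>X\<close> labels
  \<open>\<lceil>card X / j\<rceil>\<close> columns, whose signed sums over the subsets of \<open>X\<close> are
  \<open>1, 2 ^ j, 2 ^ (2 * j), \<dots>\<close>.  From the signed sum of the answers one thus reads off the
  \<open>j\<close>-bit unknowns of these columns as consecutive blocks of binary digits.
\<close>

definition columns :: "nat \<Rightarrow> nat \<Rightarrow> nat" where
  "columns j S = (card (set_decode S) + j - 1) div j"

definition before :: "nat \<Rightarrow> nat \<Rightarrow> nat" where
  "before j S = (\<Sum>i<S. columns j i)"

text \<open>Columns are numbered in blocks, the block of the set \<open>S\<close> starting at
  \<open>before j S\<close>; counting the blocks that end by column \<open>u\<close> gives the label
  of its own block. It also bounds the rows: for \<open>m\<close> columns the codes up to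
  \<open>set_of j (m - 1)\<close> suffice.\<close>

definition set_of :: "nat \<Rightarrow> nat \<Rightarrow> nat" where
  "set_of j u = card {S. before j (Suc S) \<le> u}"

definition exponent :: "nat \<Rightarrow> nat \<Rightarrow> nat" where
  "exponent j u = (u - before j (set_of j u)) * j"

definition entry :: "nat \<Rightarrow> nat \<Rightarrow> nat \<Rightarrow> nat" where
  "entry j u T = entry_at (set_decode (set_of j u)) (exponent j u) (set_decode T)"

lemma set_decode_nonempty: "S > 0 \<Longrightarrow> card (set_decode S) > 0"
  by (metis card_gt_0_iff finite_set_decode gr_implies_not0 set_decode_inverse set_encode_empty)

lemma columns_pos: "j \<ge> 1 \<Longrightarrow> S > 0 \<Longrightarrow> columns j S \<ge> 1"
  using set_decode_nonempty[of S] by (simp add: columns_def Suc_leI div_greater_zero_iff)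

lemma columns_0: "j \<ge> 1 \<Longrightarrow> columns j 0 = 0"
  by (simp add: columns_def)

lemma before_mono: "S \<le> S' \<Longrightarrow> before j S \<le> before j S'"
  unfolding before_def by (rule sum_mono2) auto

lemma before_ge: "j \<ge> 1 \<Longrightarrow> before j (Suc S) \<ge> S"
proof (induction S)
  case (Suc S)
  then show ?case using columns_pos[of j "Suc S"] by (simp add: before_def)
qed simp

text \<open>Turns thresholds defined by counting into initial segments; applied to
  \<open>set_of\<close>, \<open>depth\<close> and \<open>bits\<close>.\<close>

lemma down_closed_eq:
  fixes A :: "nat set"
  assumes "finite A" "\<And>x y. y \<in> A \<Longrightarrow> x \<le> y \<Longrightarrow> x \<in> A"
  shows "A = {..<card A}"
proof (cases "A = {}")
  case False
  have "A = {..Max A}" using assms False Max_in by (auto intro: Max_ge)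
  then have "card A = Suc (Max A)" by (metis card_atMost)
  with \<open>A = {..Max A}\<close> show ?thesis by (simp add: lessThan_Suc_atMost)
qed simp

lemma set_of_set:
  assumes "j \<ge> 1"
  shows "{S. before j (Suc S) \<le> u} = {..<set_of j u}"
  unfolding set_of_def
proof (rule down_closed_eq)
  have "{S. before j (Suc S) \<le> u} \<subseteq> {..u}" using before_ge[OF assms] order_trans by auto
  then show "finite {S. before j (Suc S) \<le> u}" by (rule finite_subset) simp
  fix x y assume "y \<in> {S. before j (Suc S) \<le> u}" "x \<le> y"
  then show "x \<in> {S. before j (Suc S) \<le> u}" using before_mono[of "Suc x" "Suc y" j] by simp
qed

lemma less_set_of_iff: "j \<ge> 1 \<Longrightarrow> S < set_of j u \<longleftrightarrow> before j (Suc S) \<le> u"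
  using set_of_set[of j u] by auto

lemma set_of_bounds:
  assumes "j \<ge> 1"
  shows "before j (set_of j u) \<le> u" "u < before j (Suc (set_of j u))"
proof -
  show "u < before j (Suc (set_of j u))" using less_set_of_iff[OF assms, of "set_of j u" u] by simp
  show "before j (set_of j u) \<le> u"
  proof (cases "set_of j u")
    case (Suc S)
    then show ?thesis using less_set_of_iff[OF assms, of S u] by simp
  qed (simp add: before_def)
qed

lemma set_of_le: "j \<ge> 1 \<Longrightarrow> set_of j u \<le> Suc u"
  using set_of_bounds(1)[of j u] before_ge[of j "set_of j u - 1"] by (cases "set_of j u") auto

lemma set_of_pos: "j \<ge> 1 \<Longrightarrow> set_of j u > 0"
  using less_set_of_iff[of j 0 u] by (simp add: before_def columns_0)

lemma set_of_mono: "j \<ge> 1 \<Longrightarrow> u \<le> u' \<Longrightarrow> set_of j u \<le> set_of j u'"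
  using less_set_of_iff[of j "set_of j u'" u] set_of_bounds(2)[of j u'] by (meson le_trans linorder_not_less)

lemma set_of_eq_iff:
  assumes "j \<ge> 1"
  shows "set_of j u = S \<longleftrightarrow> before j S \<le> u \<and> u < before j (Suc S)"
proof
  assume *: "before j S \<le> u \<and> u < before j (Suc S)"
  have "\<not> S < set_of j u" using less_set_of_iff[OF assms, of S u] * by simp
  moreover have "\<not> set_of j u < S"
    using set_of_bounds(2)[OF assms, of u] before_mono[of "Suc (set_of j u)" S j] * by auto
  ultimately show "set_of j u = S" by simp
qed (use set_of_bounds[OF assms, of u] in auto)

text \<open>Rounding up in \<open>columns\<close> is harmless: the last column of a block may have
  fewer than \<open>j\<close> elements left, but its exponent is still below the size of the set,
  which is what \<open>signed_sum_entry_at\<close> requires.\<close>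

lemma exponent_less:
  assumes "j \<ge> 1"
  shows "exponent j u < card (set_decode (set_of j u))"
proof -
  let ?c = "card (set_decode (set_of j u))" and ?q = "u - before j (set_of j u)"
  have "?q < columns j (set_of j u)" using set_of_bounds[OF assms, of u] by (simp add: before_def)
  then have "Suc ?q \<le> (?c + j - 1) div j" by (simp add: columns_def Suc_leI)
  then have "Suc ?q * j \<le> ?c + j - 1"
    using less_eq_div_iff_mult_less_eq[of j "Suc ?q" "?c + j - 1"] assms by linarith
  then show ?thesis using assms by (simp add: exponent_def)
qed

lemma digits_less:
  fixes w :: "nat \<Rightarrow> nat"
  assumes "\<And>i. i < q \<Longrightarrow> w i < 2 ^ j"
  shows "(\<Sum>i<q. 2 ^ (i * j) * w i) < 2 ^ (q * j)"
  using assms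
proof (induction q)
  case (Suc q)
  have "(\<Sum>i<Suc q. 2 ^ (i * j) * w i) < 2 ^ (q * j) + 2 ^ (q * j) * w q"
    using Suc by simp
  also have "\<dots> = 2 ^ (q * j) * Suc (w q)" by simp
  also have "\<dots> \<le> 2 ^ (q * j) * 2 ^ j" using Suc.prems[of q] by (intro mult_le_mono2) simp
  finally show ?case by (simp add: power_add[symmetric] add.commute)
qed simp

text \<open>
  Supersets of the set coded by \<open>S\<close> have codes at least \<open>S\<close>, so the signed sum over its
  subsets is blind to all columns before those of \<open>S\<close>.
\<close>

lemma decode_correct:
  assumes j: "j \<ge> 1" and v: "\<And>u'. u' \<le> u \<Longrightarrow> v u' < 2 ^ j"
    and V_def: "V = (\<Sum>T\<in>Pow (set_decode (set_of j u)). (- 1) ^ card T *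
       int (\<Sum>u'\<le>u. entry j u' (set_encode T) * v u'))"
  shows "V div 2 ^ exponent j u = int (v u)" "V \<ge> 0"
proof -
  define s where "s = set_of j u"
  let ?X = "set_decode s"
  have "V = (\<Sum>T\<in>Pow ?X. \<Sum>u'\<le>u. (- 1) ^ card T * int (entry j u' (set_encode T)) * int (v u'))"
    unfolding s_def V_def by (simp add: sum_distrib_left mult.assoc)
  also have "\<dots> = (\<Sum>u'\<le>u. (\<Sum>T\<in>Pow ?X. (- 1) ^ card T * int (entry j u' (set_encode T))) * int (v u'))"
    unfolding sum_distrib_right by (rule sum.swap)
  also have "\<dots> = (\<Sum>u'\<le>u. (\<Sum>T\<in>Pow ?X. (- 1) ^ card T * int (entry_at (set_decode (set_of j u')) (exponent j u') T)) * int (v u'))"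
  proof (rule sum.cong[OF refl], rule arg_cong[where f = "\<lambda>x. x * _"], rule sum.cong[OF refl])
    fix u' T assume "T \<in> Pow ?X"
    then have "finite T" by (auto intro: finite_subset[OF _ finite_set_decode])
    then show "(- 1) ^ card T * int (entry j u' (set_encode T)) =
        (- 1) ^ card T * int (entry_at (set_decode (set_of j u')) (exponent j u') T)"
      by (simp add: entry_def)
  qed
  also have "\<dots> = (\<Sum>u'\<le>u. if set_of j u' = s then 2 ^ exponent j u' * int (v u') else 0)"
  proof (rule sum.cong[OF refl])
    fix u' assume u': "u' \<in> {..u}"
    then have le: "set_of j u' \<le> s" using set_of_mono[OF j] by (simp add: s_def)
    show "(\<Sum>T\<in>Pow ?X. (- 1) ^ card T * int (entry_at (set_decode (set_of j u')) (exponent j u') T)) * int (v u') =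
        (if set_of j u' = s then 2 ^ exponent j u' * int (v u') else 0)"
    proof (cases "set_of j u' = s")
      case True
      then show ?thesis
        using signed_sum_entry_at[of ?X "exponent j u'"] exponent_less[OF j, of u'] by simp
    next
      case False
      then have "\<not> ?X \<subseteq> set_decode (set_of j u')"
        using le subset_decode_imp_le[of s "set_of j u'"] by auto
      then show ?thesis using False signed_sum_entry_at_0[of ?X] by simp
    qed
  qed
  also have "\<dots> = (\<Sum>u'\<in>{before j s..u}. 2 ^ exponent j u' * int (v u'))"
  proof -
    have "set_of j u' = s \<longleftrightarrow> before j s \<le> u'" if "u' \<le> u" for u'
      using set_of_eq_iff[OF j, of u' s] set_of_bounds(2)[OF j, of u] that by (auto simp: s_def)
    then show ?thesis
      by (intro sum.mono_neutral_cong_right) auto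
  qed
  also have "\<dots> = int (\<Sum>i<Suc (u - before j s). 2 ^ (i * j) * v (before j s + i))"
  proof -
    have b: "before j s \<le> u" using set_of_bounds(1)[OF j, of u] by (simp add: s_def)
    have "{before j s..u} = (\<lambda>i. before j s + i) ` {..<Suc (u - before j s)}"
    proof (intro equalityI subsetI)
      fix x assume "x \<in> {before j s..u}"
      then show "x \<in> (\<lambda>i. before j s + i) ` {..<Suc (u - before j s)}"
        by (intro image_eqI[of _ _ "x - before j s"]) auto
    qed (use b in auto)
    then have "(\<Sum>u'\<in>{before j s..u}. 2 ^ exponent j u' * int (v u')) =
        (\<Sum>i<Suc (u - before j s). 2 ^ exponent j (before j s + i) * int (v (before j s + i)))"
      by (simp add: sum.reindex del: sum.lessThan_Suc)
    also have "\<dots> = (\<Sum>i<Suc (u - before j s). 2 ^ (i * j) * int (v (before j s + i)))"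
    proof (rule sum.cong[OF refl])
      fix i assume "i \<in> {..<Suc (u - before j s)}"
      then have "set_of j (before j s + i) = s"
        using set_of_eq_iff[OF j, of "before j s + i" s] set_of_bounds(2)[OF j, of u] b by (auto simp: s_def)
      then show "2 ^ exponent j (before j s + i) * int (v (before j s + i)) = 2 ^ (i * j) * int (v (before j s + i))"
        by (simp add: exponent_def)
    qed
    finally show ?thesis by simp
  qed
  finally have V: "V = int (\<Sum>i<Suc (u - before j s). 2 ^ (i * j) * v (before j s + i))" .
  then show "V \<ge> 0" by (simp only: of_nat_0_le_iff)
  have b: "before j s \<le> u" using set_of_bounds(1)[OF j, of u] by (simp add: s_def)
  \<comment> \<open>Since only columns up to \<open>u\<close> are summed, \<open>v u\<close> is the
    leading digit in base \<open>2 ^ j\<close>; the lower digits stay below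
    \<open>2 ^ exponent j u\<close>, and the division drops them.\<close>
  have "(\<Sum>i<u - before j s. 2 ^ (i * j) * v (before j s + i)) < 2 ^ ((u - before j s) * j)"
    by (rule digits_less) (use v in auto)
  then have "(\<Sum>i<Suc (u - before j s). 2 ^ (i * j) * v (before j s + i)) div 2 ^ exponent j u = v u"
    using b by (simp add: exponent_def s_def)
  then show "V div 2 ^ exponent j u = int (v u)"
    unfolding V by (metis of_nat_numeral of_nat_power zdiv_int)
qed

text \<open>Half of all bits are set. This is the capacity, in binary digits, of the first
  \<open>2 ^ g\<close> sets and the origin of the logarithmic saving.\<close>

lemma sum_card_set_decode: "2 * (\<Sum>i<2 ^ g. card (set_decode i)) = g * 2 ^ g"
proof (induction g)
  case (Suc g)
  have "{..<2 ^ Suc g} = {..<2 ^ g} \<union> (\<lambda>i. 2 ^ g + i) ` {..<2 ^ g :: nat}"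
  proof (intro equalityI subsetI)
    fix x :: nat assume "x \<in> {..<2 ^ Suc g}"
    then show "x \<in> {..<2 ^ g} \<union> (\<lambda>i. 2 ^ g + i) ` {..<2 ^ g}"
      by (cases "x < 2 ^ g") (auto simp: image_iff intro!: bexI[of _ "x - 2 ^ g"])
  qed auto
  then have "(\<Sum>i<2 ^ Suc g. card (set_decode i)) = (\<Sum>i<2 ^ g. card (set_decode i)) +
      (\<Sum>i<2 ^ g. card (set_decode (2 ^ g + i)))"
    by (simp add: sum.union_disjoint sum.reindex disjoint_iff image_iff)
  also have "(\<Sum>i<2 ^ g. card (set_decode (2 ^ g + i))) = (\<Sum>i<2 ^ g. Suc (card (set_decode i)))"
  proof (rule sum.cong[OF refl])
    fix i :: nat assume "i \<in> {..<2 ^ g}"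
    then have "g \<notin> set_decode i" by (simp add: set_decode_def)
    then show "card (set_decode (2 ^ g + i)) = Suc (card (set_decode i))"
      by (simp add: set_decode_plus_power_2)
  qed
  finally show ?case using Suc by (simp add: sum.distrib sum_Suc algebra_simps)
qed simp

text \<open>The blocks before that of the last column fit into \<open>m\<close> columns of
  \<open>j\<close> bits, which bounds their capacity \<open>g * 2 ^ g / 2\<close> by
  \<open>m * j\<close>. The number \<open>m\<close> need not be a power of two, since the unknowns
  are nodes in one application and the \<open>n\<close> positions in the other.\<close>

lemma rows_bound:
  assumes j: "j \<ge> 1" and m: "2 ^ l \<le> m"
  shows "Suc (set_of j (m - 1)) * Suc l \<le> 12 * m * j"
proof -
  define s where "s = set_of j (m - 1)"
  have m1: "m \<ge> 1" using m by (meson le_trans one_le_numeral one_le_power)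
  have s1: "s \<ge> 1" using set_of_pos[OF j, of "m - 1"] by (simp add: s_def)
  have cs: "before j s < m" using set_of_bounds(1)[OF j, of "m - 1"] m1 by (simp add: s_def)
  obtain g where g: "2 ^ g \<le> s" "s < 2 ^ Suc g"
    using ex_power_ivl1[of 2 s] s1 by auto
  have "before j (2 ^ g) < m" using before_mono[OF g(1), of j] cs by simp
  moreover have "before j (2 ^ g) \<ge> 2 ^ g - 1"
    using before_ge[OF j, of "2 ^ g - 1"] by simp
  ultimately have gm: "2 ^ g \<le> m" by linarith
  have "(\<Sum>i<2 ^ g. card (set_decode i)) \<le> (\<Sum>i<2 ^ g. columns j i * j)"
  proof (rule sum_mono)
    fix i :: nat
    let ?c = "card (set_decode i)"
    have "?c + j - 1 = columns j i * j + (?c + j - 1) mod j" by (simp add: columns_def)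
    moreover have "(?c + j - 1) mod j \<le> j - 1" using j by (metis One_nat_def Suc_pred less_Suc_eq_le mod_less_divisor less_le_trans zero_less_one)
    ultimately show "?c \<le> columns j i * j" using j by linarith
  qed
  also have "\<dots> = before j (2 ^ g) * j" by (simp add: before_def sum_distrib_right)
  also have "\<dots> \<le> m * j" using \<open>before j (2 ^ g) < m\<close> by simp
  finally have gj: "g * 2 ^ g \<le> 2 * (m * j)" using sum_card_set_decode[of g] by linarith
  have M: "Suc s \<le> 2 * 2 ^ g" using g(2) by simp
  \<comment> \<open>Either \<open>l\<close> is at most about \<open>2 * g\<close> and the capacity
    bound applies, giving 12 as 8 + 4, or the number of rows is at most \<open>2 ^ (l / 2)\<close>,
    so small that the factor \<open>Suc l\<close> is absorbed by
    \<open>2 ^ l \<le> m\<close>.\<close>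
  show ?thesis
  proof (cases "l \<le> 2 * g + 1")
    case True
    then have "Suc s * Suc l \<le> 2 * 2 ^ g * (2 * g + 2)"
      using M by (intro mult_le_mono) auto
    also have "\<dots> = 4 * (g * 2 ^ g) + 4 * 2 ^ g" by (simp add: algebra_simps)
    also have "\<dots> \<le> 8 * (m * j) + 4 * (m * j)"
    proof -
      have "2 ^ g \<le> m * j" using mult_le_mono[OF gm j] by simp
      then show ?thesis using gj by linarith
    qed
    finally show ?thesis by (simp add: s_def mult_ac)
  next
    case False
    then obtain d where d: "l = 2 * Suc g + d" by (metis add_Suc_right add_2_eq_Suc' le_Suc_ex mult_Suc_right not_less_eq_eq Suc_eq_plus1 add.commute)
    have "Suc (2 * Suc g + d) \<le> 4 * (X * Y)" if "Suc g \<le> X" "d \<le> Y" "1 \<le> Y" for X Y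
    proof -
      define Z where "Z = X * Y"
      have "Y \<le> Z" "X \<le> Z" unfolding Z_def using that by auto
      then have "Suc g + Suc g + d + 1 \<le> Z + Z + Z + Z" using that by (intro add_mono) auto
      then show ?thesis unfolding Z_def[symmetric] by (simp add: mult_2)
    qed
    from this[of "2 ^ Suc g" "2 ^ d"] have "Suc l \<le> 4 * (2 ^ Suc g * 2 ^ d)"
      unfolding d by (simp only: less_imp_le_nat less_exp one_le_power one_le_numeral)
    then have "Suc s * Suc l \<le> 2 ^ Suc g * (4 * (2 ^ Suc g * 2 ^ d))"
      using M by (intro mult_le_mono) auto
    also have "\<dots> = 4 * (2 ^ (Suc g + Suc g + d))" unfolding power_add by (simp only: mult_ac)
    also have "\<dots> = 4 * 2 ^ l" by (simp only: d mult_2)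
    also have "\<dots> \<le> 12 * (m * j)" using m j by (intro mult_le_mono) (auto intro: order_trans[of _ m "m * j"])
    finally show ?thesis by (simp add: s_def mult_ac)
  qed
qed

section \<open>The program computes the detecting matrix\<close>

lemma cdiv_eq: "b > 0 \<Longrightarrow> cdiv N a b = min N (a div b)"
proof -
  assume b: "b > 0"
  have "cdiv N a b = (\<Sum>i<N. if i < a div b then 1 else 0)"
    unfolding cdiv_def
  proof (rule sum.cong[OF refl])
    fix i assume "i \<in> {..<N}"
    then have "min (Suc i) N = Suc i" by auto
    then show "(if min (Suc i) N * b \<le> a then 1 else 0) = (if i < a div b then 1 else (0::nat))"
      using less_eq_div_iff_mult_less_eq[OF b, of "Suc i" a] by (simp add: Suc_le_eq)
  qed
  also have "\<dots> = card ({..<N} \<inter> {i. i < a div b})"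
    by (simp add: sum.If_cases)
  also have "{..<N} \<inter> {i. i < a div b} = {..<min N (a div b)}" by auto
  finally show ?thesis by simp
qed

lemma cpow_eq: "cpow N x = 2 ^ min x N"
proof -
  have "itr (\<lambda>_ y. y + y) n (1::nat) = 2 ^ n" for n by (induction n) auto
  then show ?thesis by (simp add: cpow_def)
qed

lemma cparity_eq: "x \<le> N \<Longrightarrow> cparity N x = x mod 2"
proof -
  assume "x \<le> N"
  then have "cdiv N x 2 = x div 2" by (simp add: cdiv_eq)
  then show ?thesis by (simp add: cparity_def) presburger
qed

lemma cbit_eq:
  assumes "S \<le> N"
  shows "cbit N S b = of_bool (b \<in> set_decode S)"
proof -
  have "cdiv N S (cpow N b) = S div 2 ^ b"
  proof (cases "b \<le> N")
    case True
    have "S div 2 ^ b \<le> N" using assms div_le_dividend order_trans by blast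
    then show ?thesis using True by (simp add: cdiv_eq cpow_eq)
  next
    case False
    \<comment> \<open>Beyond \<open>N\<close> the power is clipped to \<open>2 ^ N\<close>, which
      still exceeds \<open>S\<close>, so both quotients are 0.\<close>
    have "S < 2 ^ N" using assms less_exp[of N] by (rule le_less_trans)
    moreover have "(2::nat) ^ N \<le> 2 ^ b" using False by (intro power_increasing) auto
    ultimately have "S < 2 ^ b" "S < 2 ^ N" by linarith+
    then show ?thesis using False by (simp add: cdiv_eq cpow_eq)
  qed
  moreover have "S div 2 ^ b \<le> N" using assms div_le_dividend order_trans by blast
  ultimately show ?thesis
    by (simp add: cbit_def cparity_eq set_decode_def odd_iff_mod_2_eq_one of_bool_def)
qed

lemma set_decode_less: "b \<in> set_decode S \<Longrightarrow> b < S"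
proof -
  assume "b \<in> set_decode S"
  then have "S div 2 ^ b \<noteq> 0" by (auto simp: set_decode_def elim: oddE)
  then have "2 ^ b \<le> S" by (metis div_less linorder_not_less)
  then show "b < S" using less_exp[of b] by linarith
qed

lemma sum_if_set:
  fixes N :: nat
  assumes "A \<subseteq> {..<N}"
  shows "(\<Sum>b<N. if b \<in> A then 1 else 0) = card A"
proof -
  have "(\<Sum>b<N. if b \<in> A then 1 else (0::nat)) = card ({..<N} \<inter> A)" by (simp add: sum.If_cases)
  then show ?thesis using assms by (simp add: Int_absorb1)
qed

lemma cbit_1_iff: "S \<le> N \<Longrightarrow> cbit N S b = Suc 0 \<longleftrightarrow> b \<in> set_decode S"
  and cbit_0_iff: "S \<le> N \<Longrightarrow> cbit N S b = 0 \<longleftrightarrow> b \<notin> set_decode S"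
  by (simp_all add: cbit_eq)

lemma set_decode_subset_lessThan: "S \<le> N \<Longrightarrow> set_decode S \<subseteq> {..<N}"
  using set_decode_less by fastforce

lemma card_set_decode_le: "card (set_decode S) \<le> S"
  using card_mono[OF finite_lessThan set_decode_subset_lessThan[OF order_refl]] by simp

lemma cpopcount_eq: "S \<le> N \<Longrightarrow> cpopcount N S = card (set_decode S)"
  using sum_if_set[OF set_decode_subset_lessThan[of S N]]
  by (simp add: cpopcount_def cbit_eq of_bool_def)

lemma columns_le: "j \<ge> 1 \<Longrightarrow> columns j S \<le> S"
proof -
  assume j: "j \<ge> 1"
  let ?c = "card (set_decode S)"
  have "?c \<le> ?c * j" using j by simp
  then have "?c + j - 1 \<le> ?c * j + (j - 1)" using j by linarith
  then have "columns j S \<le> (?c * j + (j - 1)) div j" unfolding columns_def by (rule div_le_mono)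
  also have "\<dots> = ?c" using j by (subst add.commute, subst div_mult_self1) auto
  also have "\<dots> \<le> S" by (rule card_set_decode_le)
  finally show ?thesis .
qed

lemma ccolumns_eq: "j \<ge> 1 \<Longrightarrow> S \<le> N \<Longrightarrow> ccolumns N j S = columns j S"
  using columns_le[of j S] by (simp add: ccolumns_def cdiv_eq cpopcount_eq columns_def)

lemma cbefore_eq: "j \<ge> 1 \<Longrightarrow> S \<le> N \<Longrightarrow> cbefore N j S = before j S"
  by (simp add: cbefore_def before_def ccolumns_eq min_absorb1)

lemma cset_eq:
  assumes "j \<ge> 1" "u < N"
  shows "cset N j u = set_of j u"
proof -
  have "cset N j u = (\<Sum>S<N. if S \<in> {..<set_of j u} then 1 else 0)"
    unfolding cset_def
  proof (rule sum.cong[OF refl])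
    fix S assume "S \<in> {..<N}"
    then have "cbefore N j (Suc S) = before j (Suc S)" using assms(1) by (intro cbefore_eq) auto
    then show "(if cbefore N j (Suc S) \<le> u then 1 else 0) = (if S \<in> {..<set_of j u} then 1 else (0::nat))"
      using less_set_of_iff[OF assms(1), of S u] by simp
  qed
  also have "\<dots> = set_of j u"
    using sum_if_set[of "{..<set_of j u}" N] set_of_le[OF assms(1), of u] assms(2) by simp
  finally show ?thesis .
qed

lemma cexponent_eq: "j \<ge> 1 \<Longrightarrow> u < N \<Longrightarrow> cexponent N j u = exponent j u"
  using set_of_le[of j u] by (simp add: cexponent_def exponent_def cset_eq cbefore_eq)

lemma centry_at_eq:
  assumes "S \<le> N" "T \<le> N"
  shows "centry_at N S t T = entry_at (set_decode S) t (set_decode T)"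
proof -
  let ?S = "set_decode S" and ?T = "set_decode T"
  have "(\<Sum>b<N. if cbit N T b = 1 \<and> cbit N S b = 1 then 1 else 0) = card (?T \<inter> ?S)"
    using sum_if_set[of "?T \<inter> ?S" N] set_decode_subset_lessThan[OF assms(1)]
    by (simp add: cbit_1_iff assms) (meson Int_lower2 order_trans)
  moreover have "card (?T \<inter> ?S) \<le> N"
    using card_mono[OF finite_lessThan[of N], of "?T \<inter> ?S"] set_decode_subset_lessThan[OF assms(1)] by auto
  ultimately have 1: "cparity N (\<Sum>b<N. if cbit N T b = 1 \<and> cbit N S b = 1 then 1 else 0) = 0 \<longleftrightarrow>
      even (card (?T \<inter> ?S))"
    by (simp add: cparity_eq even_iff_mod_2_eq_zero)
  have s: "(\<Sum>a<b. cbit N S a) = card {a \<in> ?S. a < b}" for b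
  proof -
    have "(\<Sum>a<b. cbit N S a) = card ({..<b} \<inter> ?S)"
      by (simp add: cbit_eq assms of_bool_def sum.If_cases)
    also have "{..<b} \<inter> ?S = {a \<in> ?S. a < b}" by auto
    finally show ?thesis .
  qed
  have "(\<Sum>b<N. if cbit N T b = 1 \<and> cbit N S b = 1 \<and> t < (\<Sum>a<min b N. cbit N S a) then 1 else 0) = (0::nat)
      \<longleftrightarrow> (\<forall>b<N. \<not> (b \<in> ?T \<and> b \<in> ?S \<and> t < card {a \<in> ?S. a < b}))"
    by (auto simp: cbit_1_iff[OF assms(1)] cbit_1_iff[OF assms(2)] s)
  also have "\<dots> \<longleftrightarrow> ?T \<inter> ?S \<subseteq> lowest ?S t"
    using set_decode_subset_lessThan[OF assms(1)] by (fastforce simp: lowest_def)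
  finally show ?thesis using 1 by (simp add: centry_at_def entry_at_def)
qed

lemma centry_eq: "j \<ge> 1 \<Longrightarrow> u < N \<Longrightarrow> T \<le> N \<Longrightarrow> centry N j u T = entry j u T"
  using set_of_le[of j u] by (simp add: centry_def cset_eq cexponent_eq centry_at_eq entry_def)

lemma cexcess_eq:
  assumes "S \<le> N" "T \<le> N"
  shows "cexcess N T S = 0 \<longleftrightarrow> set_decode T \<subseteq> set_decode S"
proof -
  have "cexcess N T S = 0 \<longleftrightarrow> (\<forall>b<N. \<not> (b \<in> set_decode T \<and> b \<notin> set_decode S))"
    by (auto simp: cexcess_def cbit_1_iff[OF assms(2)] cbit_0_iff[OF assms(1)])
  also have "\<dots> \<longleftrightarrow> set_decode T \<subseteq> set_decode S"
    using set_decode_subset_lessThan[OF assms(2)] by auto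
  finally show ?thesis .
qed

lemma entry_01: "entry j u T \<noteq> Suc 0 \<Longrightarrow> entry j u T = 0"
  by (auto simp: entry_def entry_at_def split: if_splits)

text \<open>Natural numbers suffice for the signed sum: rows of even and odd size are added up
  separately, and the difference is not truncated because the signed sum is nonnegative.\<close>

lemma decode_eq:
  assumes j: "j \<ge> 1" and m: "m \<le> N" "u < m" "set_of j (m - 1) < N"
    and v: "\<And>u'. u' < m \<Longrightarrow> v u' < 2 ^ j" "v u \<le> N"
    and res: "\<And>T. T \<le> set_of j (m - 1) \<Longrightarrow> res T = (\<Sum>u'<m. entry j u' T * v u')"
    and val: "\<And>u'. u < u' \<Longrightarrow> u' < m \<Longrightarrow> val u' = v u'"
  shows "decode N m j res val u = v u"
proof -
  define s where "s = set_of j u"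
  let ?X = "set_decode s"
  have cset: "cset N j u = s" using m j by (simp add: cset_eq s_def)
  have sm: "s \<le> set_of j (m - 1)" using set_of_mono[OF j, of u "m - 1"] m by (simp add: s_def)
  then have sN: "s < N" using m by simp
  have residual: "residual N m j res val u T = (\<Sum>u'\<le>u. entry j u' T * v u')" if T: "T \<le> s" for T
  proof -
    have "(\<Sum>u'<min m N. if u < u' \<and> centry N j u' T = 1 then val u' else 0) =
        (\<Sum>u'<m. if u < u' then entry j u' T * v u' else 0)"
      using m T sN j
      by (intro sum.cong) (auto simp: centry_eq val dest: entry_01)
    also have "\<dots> = (\<Sum>u'\<in>{u<..<m}. entry j u' T * v u')"
      by (rule sum.mono_neutral_cong_right) auto
    finally have 1: "(\<Sum>u'<min m N. if u < u' \<and> centry N j u' T = 1 then val u' else 0) =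
        (\<Sum>u'\<in>{u<..<m}. entry j u' T * v u')" .
    have "{..<m} = {..u} \<union> {u<..<m}" using m by auto
    then have "res T = (\<Sum>u'\<le>u. entry j u' T * v u') + (\<Sum>u'\<in>{u<..<m}. entry j u' T * v u')"
      using T sm by (simp add: res sum.union_disjoint disjoint_iff)
    then show ?thesis unfolding residual_def 1 by simp
  qed
  let ?R = "\<lambda>T. \<Sum>u'\<le>u. entry j u' T * v u'"
  let ?A = "{T. T < N \<and> set_decode T \<subseteq> ?X}"
  have le: "T \<le> s" if "set_decode T \<subseteq> ?X" for T using that by (rule subset_decode_imp_le)
  \<comment> \<open>The code of a set is at least that of each of its subsets, so running over
    \<open>T < N\<close> meets all subsets of \<open>?X\<close>.\<close>
  have A: "bij_betw set_encode (Pow ?X) ?A"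
  proof (rule bij_betwI[of _ _ _ set_decode])
    show "set_encode \<in> Pow ?X \<rightarrow> ?A"
    proof
      fix T assume "T \<in> Pow ?X"
      moreover from this have "finite T" by (auto intro: finite_subset[OF _ finite_set_decode])
      ultimately show "set_encode T \<in> ?A" using le[of "set_encode T"] sN by auto
    qed
  qed (auto simp: finite_subset[OF _ finite_set_decode])
  have sgn: "(\<Sum>T<N. if cexcess N T s = 0 \<and> cparity N (cpopcount N T) = p then f T else 0) =
      (\<Sum>T\<in>?A. if card (set_decode T) mod 2 = p then f T else 0)" for p and f :: "nat \<Rightarrow> nat"
  proof -
    have "cparity N (cpopcount N T) = card (set_decode T) mod 2" if "T < N" for T
      using that card_set_decode_le[of T] by (simp add: cpopcount_eq cparity_eq)
    then show ?thesis
      using sN by (intro sum.mono_neutral_cong_right) (auto simp: cexcess_eq)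
  qed
  let ?E = "\<Sum>T\<in>?A. if card (set_decode T) mod 2 = 0 then ?R T else 0"
  let ?O = "\<Sum>T\<in>?A. if card (set_decode T) mod 2 = 1 then ?R T else 0"
  have E: "(\<Sum>T<N. if cexcess N T s = 0 \<and> cparity N (cpopcount N T) = p then residual N m j res val u T else 0) =
      (\<Sum>T\<in>?A. if card (set_decode T) mod 2 = p then ?R T else 0)" for p
    unfolding sgn by (rule sum.cong) (use residual le in auto)
  let ?V = "\<Sum>T\<in>Pow ?X. (- 1) ^ card T * int (?R (set_encode T))"
  have "int ?E - int ?O = (\<Sum>T\<in>?A. (- 1) ^ card (set_decode T) * int (?R T))"
    unfolding of_nat_sum sum_subtractf[symmetric]
    by (rule sum.cong) (auto simp: odd_iff_mod_2_eq_one[symmetric] even_iff_mod_2_eq_zero[symmetric])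
  also have "\<dots> = (\<Sum>T\<in>Pow ?X. (- 1) ^ card (set_decode (set_encode T)) * int (?R (set_encode T)))"
    by (rule sum.reindex_bij_betw[OF A, symmetric])
  also have "\<dots> = ?V"
    by (rule sum.cong) (auto dest!: finite_subset[OF _ finite_set_decode])
  finally have EO: "int ?E - int ?O = ?V" .
  have V: "?V div 2 ^ exponent j u = int (v u)" "?V \<ge> 0"
    using decode_correct[OF j _ refl, of u v] v m unfolding s_def by auto
  then have "?E - ?O = nat ?V" using EO by linarith
  \<comment> \<open>The divisor is obtained by counting: within \<open>?X\<close>, column
    \<open>u\<close> has nonzero entries only at rows of even size, so the count is the signed
    sum.\<close>
  have W: "(\<Sum>T<N. if cexcess N T s = 0 \<and> centry N j u T = 1 then 1 else 0) = (2 ^ exponent j u :: nat)"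
  proof -
    have "(\<Sum>T<N. if cexcess N T s = 0 \<and> centry N j u T = 1 then 1 else 0) = (\<Sum>T\<in>?A. entry j u T)"
      using sN m j by (intro sum.mono_neutral_cong_right) (auto simp: cexcess_eq centry_eq dest: entry_01)
    also have "\<dots> = (\<Sum>T\<in>Pow ?X. entry j u (set_encode T))"
      by (rule sum.reindex_bij_betw[OF A, symmetric])
    also have "\<dots> = (\<Sum>T\<in>Pow ?X. entry_at ?X (exponent j u) T)"
      by (rule sum.cong) (auto simp: entry_def s_def dest!: finite_subset[OF _ finite_set_decode])
    finally have "int (\<Sum>T<N. if cexcess N T s = 0 \<and> centry N j u T = 1 then 1 else 0) =
        (\<Sum>T\<in>Pow ?X. int (entry_at ?X (exponent j u) T))" by simp
    also have "\<dots> = (\<Sum>T\<in>Pow ?X. (- 1) ^ card T * int (entry_at ?X (exponent j u) T))"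
      by (rule sum.cong) (auto simp: entry_at_def Int_absorb2)
    also have "\<dots> = int (2 ^ exponent j u)"
      using signed_sum_entry_at[of ?X "exponent j u"] exponent_less[OF j, of u] by (simp add: s_def)
    finally show ?thesis by (simp only: of_nat_eq_iff)
  qed
  have "decode N m j res val u = cdiv N (?E - ?O) (2 ^ exponent j u)"
    unfolding decode_def cset E W ..
  also have "\<dots> = min N ((?E - ?O) div 2 ^ exponent j u)" by (rule cdiv_eq) simp
  also have "(?E - ?O) div 2 ^ exponent j u = v u"
  proof -
    have "int ((?E - ?O) div 2 ^ exponent j u) = ?V div 2 ^ exponent j u"
      using V(2) \<open>?E - ?O = nat ?V\<close> by (simp add: zdiv_int)
    then show ?thesis using V(1) by simp
  qed
  finally show ?thesis using v(2) by simp
qed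

section \<open>Correctness of the program\<close>

definition only :: "vname set \<Rightarrow> state \<Rightarrow> state \<Rightarrow> bool" where
  "only W s s' \<longleftrightarrow> (\<forall>y. y \<notin> W \<longrightarrow> s' y = s y)"

lemma only_refl: "only W s s"
  by (simp add: only_def)

lemma only_trans: "only W s s' \<Longrightarrow> only W s' s'' \<Longrightarrow> only W s s''"
  by (simp add: only_def)

lemma onlyD: "only W s s' \<Longrightarrow> y \<notin> W \<Longrightarrow> s' y = s y"
  by (simp add: only_def)

lemma only_upd: "only W s s' \<Longrightarrow> x \<in> W \<Longrightarrow> only W s (upd x i c s')"
  by (auto simp: only_def upd_def)

lemma for_st_inv:
  assumes "b = min (bd s) (s ''N'' 0)" "I 0 s" "\<And>i t. i < b \<Longrightarrow> I i t \<Longrightarrow> I (Suc i) (F i t)"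
  shows "I b (for_st bd F s)"
proof -
  have "I i (itr F i s)" if "i \<le> b" for i
    using that by (induction i) (auto simp: assms)
  then show ?thesis by (simp add: for_st_def assms(1))
qed

lemma fill_eq:
  assumes "\<And>j s'. 1 \<le> j \<Longrightarrow> j \<le> min (b s) (s ''N'' 0) \<Longrightarrow> only {x} s s' \<Longrightarrow> f j s' = h j"
  shows "fill x b f s =
    s(x := (\<lambda>j. if 1 \<le> j \<and> j \<le> min (b s) (s ''N'' 0) then h j else s x j))"
proof -
  let ?B = "min (b s) (s ''N'' 0)"
  have "itr (\<lambda>i. assign x (\<lambda>s. Suc i) (f (Suc i))) ?B s =
      s(x := (\<lambda>j. if 1 \<le> j \<and> j \<le> ?B then h (Suc (j - 1)) else s x j))"
  proof (rule itr_fill[where f = "\<lambda>i. h (Suc i)"])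
    fix i s' assume "i < ?B" "\<And>y. y \<noteq> x \<Longrightarrow> s' y = s y"
    then have "f (Suc i) s' = h (Suc i)" by (intro assms) (auto simp: only_def)
    then show "assign x (\<lambda>s. Suc i) (f (Suc i)) s' = upd x (Suc i) (h (Suc i)) s'"
      by (simp add: assign_def)
  qed
  then show ?thesis
    by (auto simp: fill_def for_st_def fun_eq_iff)
qed

text \<open>Keeps the cells of the two-dimensional table \<open>cnt\<close> apart, colours being
  smaller than \<open>N\<close>.\<close>

lemma cell_inj:
  fixes c c' v v' N :: nat
  assumes "c < N" "c' < N"
  shows "v * N + c = v' * N + c' \<longleftrightarrow> v = v' \<and> c = c'"
proof
  assume *: "v * N + c = v' * N + c'"
  have "(v * N + c) div N = v" "(v' * N + c') div N = v'" using assms by auto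
  with * show "v = v' \<and> c = c'" by auto
qed simp

lemma sum_delta_cond:
  fixes N :: nat and f :: "nat \<Rightarrow> nat"
  assumes "\<And>c. c < N \<Longrightarrow> P c \<longleftrightarrow> c = a" "a < N"
  shows "(\<Sum>c<N. if P c then f c else 0) = f a"
proof -
  have "(\<Sum>c<N. if P c then f c else 0) = (\<Sum>c<N. if c = a then f c else 0)"
    by (rule sum.cong) (use assms in auto)
  also have "\<dots> = f a" using assms(2) by (simp add: sum.delta')
  finally show ?thesis .
qed

text \<open>The binary logarithm of \<open>n \<ge> 1\<close>, rounded up. Like \<open>bits\<close>,
  it is defined by counting because the program computes it by a bounded sum.\<close>

definition depth :: "nat \<Rightarrow> nat" where
  "depth n = card {i. 2 ^ i < n}"

text \<open>The length of \<open>w div Suc r\<close> in binary.\<close>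

definition bits :: "nat \<Rightarrow> nat \<Rightarrow> nat" where
  "bits w r = card {i. Suc r * 2 ^ i \<le> w}"

lemma depth_set: "{i. 2 ^ i < n} = {..<depth n}"
  unfolding depth_def
proof (rule down_closed_eq)
  have "i \<le> n" if "2 ^ i < n" for i using that less_exp[of i] by linarith
  then have "{i. 2 ^ i < n} \<subseteq> {..n}" by auto
  then show "finite {i. 2 ^ i < n}" by (rule finite_subset) simp
next
  fix x y :: nat assume "y \<in> {i. 2 ^ i < n}" "x \<le> y"
  then show "x \<in> {i. 2 ^ i < n}"
    using le_less_trans[OF power_increasing[of x y "2::nat"], of n] by simp
qed

lemma depth_ge: "n \<le> 2 ^ depth n"
proof -
  have "depth n \<notin> {i. 2 ^ i < n}" by (subst depth_set) simp
  then show ?thesis by simp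
qed

lemma depth_le: "n \<ge> 1 \<Longrightarrow> 2 ^ depth n \<le> 2 * n"
proof (cases "depth n")
  case (Suc d)
  then have "d \<in> {i. 2 ^ i < n}" by (subst depth_set) simp
  then show ?thesis using Suc by simp
qed simp

lemma depth_le_n: "depth n \<le> n"
proof (cases "depth n")
  case (Suc d)
  then have "d \<in> {i. 2 ^ i < n}" by (subst depth_set) simp
  then have "2 ^ d < n" by simp
  then have "d < n" using less_exp[of d] by linarith
  then show ?thesis using Suc by simp
qed simp

lemma bits_set: "{i. Suc r * 2 ^ i \<le> w} = {..<bits w r}"
  unfolding bits_def
proof (rule down_closed_eq)
  have "i \<le> w" if "Suc r * 2 ^ i \<le> w" for i
  proof -
    have "2 ^ i \<le> w" using that by simp
    then show ?thesis using less_exp[of i] by linarith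
  qed
  then have "{i. Suc r * 2 ^ i \<le> w} \<subseteq> {..w}" by blast
  then show "finite {i. Suc r * 2 ^ i \<le> w}" by (rule finite_subset) simp
next
  fix x y :: nat assume a: "y \<in> {i. Suc r * 2 ^ i \<le> w}" "x \<le> y"
  then have "Suc r * 2 ^ x \<le> Suc r * 2 ^ y" by (intro mult_le_mono2 power_increasing) auto
  with a show "x \<in> {i. Suc r * 2 ^ i \<le> w}" by auto
qed

lemma bits_greater: "w < Suc r * 2 ^ bits w r"
proof -
  have "bits w r \<notin> {i. Suc r * 2 ^ i \<le> w}" by (subst bits_set) simp
  then show ?thesis by simp
qed

lemma bits_pos: "r < w \<Longrightarrow> bits w r \<ge> 1"
proof -
  assume "r < w"
  then have "0 \<in> {i. Suc r * 2 ^ i \<le> w}" by simp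
  then show ?thesis unfolding bits_set by simp
qed

lemma bits_le: "bits w r \<le> w"
proof (cases "bits w r")
  case (Suc b)
  then have "b \<in> {i. Suc r * 2 ^ i \<le> w}" by (subst bits_set) simp
  then have "2 ^ b \<le> w" by simp
  then have "b < w" using less_exp[of b] by linarith
  then show ?thesis using Suc by simp
qed simp

section \<open>The game against a fixed code\<close>

locale game =
  fixes n k :: nat and z :: code
  assumes n: "n \<ge> 1" and k: "k \<ge> 2" and z: "z \<in> codes n k"
begin

abbreviation A :: "state \<Rightarrow> state" where "A \<equiv> honest n k z"

definition NN :: nat where "NN = 4 * n + 4 * k + 8"

definition std :: "state \<Rightarrow> bool" where
  "std s \<longleftrightarrow> s ''n'' 0 = n \<and> s ''k'' 0 = k \<and> s ''N'' 0 = NN"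

lemma std_only: "std s \<Longrightarrow> only W s s' \<Longrightarrow> ''n'' \<notin> W \<Longrightarrow> ''k'' \<notin> W \<Longrightarrow> ''N'' \<notin> W \<Longrightarrow> std s'"
  by (simp add: std_def only_def)

lemma z_range: "i \<in> {1..n} \<Longrightarrow> 1 \<le> z i \<and> z i \<le> k"
  using z by (auto simp: codes_def PiE_iff)

abbreviation WA :: "vname set" where "WA \<equiv> {''G'', ''ans'', ''q'', ''log''}"
abbreviation WD :: "vname set" where "WD \<equiv> {''G'', ''ans'', ''q'', ''log'', ''res'', ''val''}"

lemma ask_fill:
  assumes s: "std s"
    and g: "\<And>i s'. i \<in> {1..n} \<Longrightarrow> only {''G''} s s' \<Longrightarrow> g i s' = c i"
    and c: "\<And>i. i \<in> {1..n} \<Longrightarrow> 1 \<le> c i \<and> c i \<le> k"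
    and s': "s' = A (fill ''G'' (\<lambda>s. s ''n'' 0) g s)"
  shows "only WA s s'" "s' ''ans'' 0 = card {i \<in> {1..n}. z i = c i}" "s' ''q'' 0 = s ''q'' 0 + 1"
    "dec n (s' ''log'' (s ''q'' 0)) = restrict c {1..n}"
proof -
  let ?s1 = "s(''G'' := (\<lambda>j. if 1 \<le> j \<and> j \<le> n then c j else s ''G'' j))"
  have f: "fill ''G'' (\<lambda>s. s ''n'' 0) g s = ?s1"
  proof -
    have "fill ''G'' (\<lambda>s. s ''n'' 0) g s = s(''G'' := (\<lambda>j. if 1 \<le> j \<and>
        j \<le> min (s ''n'' 0) (s ''N'' 0) then c j else s ''G'' j))"
      by (rule fill_eq) (use s g in \<open>simp add: std_def\<close>)
    moreover have "min (s ''n'' 0) (s ''N'' 0) = n" using s by (simp add: std_def NN_def)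
    ultimately show ?thesis by simp
  qed
  have gs: "guess_of n k ?s1 = restrict c {1..n}"
    using c by (auto simp: guess_of_def clamp_def fun_eq_iff restrict_def)
  show "only WA s s'" unfolding s' f honest_def by (auto simp: only_def upd_def)
  have "{i \<in> {1..n}. z i = restrict c {1..n} i} = {i \<in> {1..n}. z i = c i}" by auto
  then show "s' ''ans'' 0 = card {i \<in> {1..n}. z i = c i}"
    unfolding s' f honest_def gs by (simp add: upd_def black_pegs_def)
  show "s' ''q'' 0 = s ''q'' 0 + 1" unfolding s' f honest_def by (simp add: upd_def)
  show "dec n (s' ''log'' (s ''q'' 0)) = restrict c {1..n}"
    unfolding s' f honest_def gs by (simp add: upd_def dec_enc)
qed

text \<open>The caller names the guess \<open>c T\<close> that \<open>query T\<close> produces and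
  shows that its corrected answer is the \<open>T\<close>-th linear form in the unknowns
  \<open>v\<close>. Queries are evaluated in states changed by earlier ones, hence the condition
  \<open>only WD s s'\<close>.\<close>

lemma detect_correct:
  assumes s: "std s" and m: "s ''m'' 0 = m" "1 \<le> m" "m \<le> NN"
    and j: "s ''j'' 0 = j" "1 \<le> j" and M: "Suc (set_of j (m - 1)) \<le> NN"
    and v: "\<And>u. u < m \<Longrightarrow> v u < 2 ^ j" "\<And>u. u < m \<Longrightarrow> v u \<le> NN"
    and query: "\<And>T i s'. T \<le> set_of j (m - 1) \<Longrightarrow> i \<in> {1..n} \<Longrightarrow> only WD s s' \<Longrightarrow> query T i s' = c T i"
    and c: "\<And>T i. T \<le> set_of j (m - 1) \<Longrightarrow> i \<in> {1..n} \<Longrightarrow> 1 \<le> c T i \<and> c T i \<le> k"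
    and ans: "\<And>T. T \<le> set_of j (m - 1) \<Longrightarrow> card {i \<in> {1..n}. z i = c T i} +
        (\<Sum>u<m. if entry j u T = 1 then s ''off'' 0 else 0) - s ''base'' 0 =
        (\<Sum>u<m. entry j u T * v u)"
    and s': "s' = detect query A s"
  shows "only WD s s' \<and> (\<forall>u<m. s' ''val'' u = v u) \<and>
    s' ''q'' 0 = s ''q'' 0 + Suc (set_of j (m - 1))"
proof -
  let ?M = "Suc (set_of j (m - 1))"
  let ?F = "\<lambda>T. fill ''G'' (\<lambda>s. s ''n'' 0) (query T) ;; A ;;
          assign ''res'' (\<lambda>s. T) (\<lambda>s. s ''ans'' 0 + (\<Sum>u<min (s ''m'' 0) (s ''N'' 0).
              if centry (s ''N'' 0) (s ''j'' 0) u T = 1 then s ''off'' 0 else 0) - s ''base'' 0)"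
  let ?b = "\<lambda>s. Suc (cset (s ''N'' 0) (s ''j'' 0) (s ''m'' 0 - 1))"
  define s1 where "s1 = for_st ?b ?F s"
  let ?I = "\<lambda>t st. only WD s st \<and> st ''q'' 0 = s ''q'' 0 + t \<and>
      (\<forall>T<t. st ''res'' T = (\<Sum>u<m. entry j u T * v u))"
  have N: "s ''N'' 0 = NN" using s by (simp add: std_def)
  have I1: "?I ?M s1"
    unfolding s1_def
  proof (rule for_st_inv[where I = ?I])
    have "cset NN j (m - 1) = set_of j (m - 1)" using j m by (intro cset_eq) auto
    then show "?M = min (?b s) (s ''N'' 0)" using N j m M by simp
  next
    show "?I 0 s" by (simp add: only_refl)
  next
    fix T st assume T: "T < ?M" and I: "?I T st"
    then have Tl: "T \<le> set_of j (m - 1)" by simp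
    have st: "std st" by (rule std_only[OF s, of WD]) (use I in auto)
    define t1 where "t1 = A (fill ''G'' (\<lambda>s. s ''n'' 0) (query T) st)"
    have *: "query T i s' = c T i" if "i \<in> {1..n}" "only {''G''} st s'" for i s'
    proof (rule query[OF Tl that(1)])
      show "only WD s s'" using I that(2) by (auto simp: only_def)
    qed
    have t1: "only WA st t1" "t1 ''ans'' 0 = card {i \<in> {1..n}. z i = c T i}"
        "t1 ''q'' 0 = st ''q'' 0 + 1"
      by (rule ask_fill[of st "query T" "c T" t1]; (fact st * c[OF Tl] t1_def))+
    let ?e = "t1 ''ans'' 0 + (\<Sum>u<min (t1 ''m'' 0) (t1 ''N'' 0).
              if centry (t1 ''N'' 0) (t1 ''j'' 0) u T = 1 then t1 ''off'' 0 else 0) - t1 ''base'' 0"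
    have eq: "?F T st = upd ''res'' T ?e t1" by (simp only: seq_def assign_def t1_def)
    have o1: "only WD s t1" using I t1(1) by (auto simp: only_def)
    have cells: "t1 ''m'' = s ''m''" "t1 ''N'' = s ''N''" "t1 ''j'' = s ''j''" "t1 ''off'' = s ''off''"
      "t1 ''base'' = s ''base''" using onlyD[OF o1] by auto
    have "(\<Sum>u<min m NN. if centry NN j u T = 1 then s ''off'' 0 else 0) =
        (\<Sum>u<m. if entry j u T = 1 then s ''off'' 0 else 0)"
      using m j M Tl by (intro sum.cong) (auto simp: centry_eq)
    then have e: "?e = (\<Sum>u<m. entry j u T * v u)"
      unfolding cells t1(2) N m(1) j(1) using ans[OF Tl] by simp
    have "t1 ''res'' = st ''res''" using onlyD[OF t1(1)] by auto
    then show "?I (Suc T) (?F T st)"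
      unfolding eq e using I t1(3) only_upd[OF o1, of "''res''"] by (auto simp: upd_def less_Suc_eq)
  qed
  let ?G = "\<lambda>i. assign ''val'' (\<lambda>s. s ''m'' 0 - 1 - i)
          (\<lambda>s. decode (s ''N'' 0) (s ''m'' 0) (s ''j'' 0) (s ''res'') (s ''val'') (s ''m'' 0 - 1 - i))"
  have s'2: "s' = for_st (\<lambda>s. s ''m'' 0) ?G s1"
    unfolding s' detect_def seq_def s1_def by simp
  let ?J = "\<lambda>t st. only WD s st \<and> st ''q'' 0 = s ''q'' 0 + ?M \<and> st ''res'' = s1 ''res'' \<and>
      (\<forall>u<m. m - t \<le> u \<longrightarrow> st ''val'' u = v u)"
  have "?J m s'"
    unfolding s'2
  proof (rule for_st_inv[where I = ?J])
    have "s1 ''m'' = s ''m''" "s1 ''N'' = s ''N''" using I1 onlyD[of WD s s1] by auto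
    then show "m = min (s1 ''m'' 0) (s1 ''N'' 0)" using m N by simp
  next
    show "?J 0 s1" using I1 by auto
  next
    fix t st assume t: "t < m" and J: "?J t st"
    have cells: "st ''m'' = s ''m''" "st ''N'' = s ''N''" "st ''j'' = s ''j''"
      using J onlyD[of WD s st] by auto
    let ?u = "m - 1 - t"
    have "decode NN m j (st ''res'') (st ''val'') ?u = v ?u"
    proof (rule decode_eq)
      show "st ''res'' T = (\<Sum>u'<m. entry j u' T * v u')" if "T \<le> set_of j (m - 1)" for T
        using that I1 J by simp
      show "st ''val'' u' = v u'" if "?u < u'" "u' < m" for u'
        using that J t by auto
    qed (use j m M v t in auto)
    then have eq: "?G t st = upd ''val'' ?u (v ?u) st"
      by (simp add: assign_def cells N m(1) j(1))
    have "only WD s (upd ''val'' ?u (v ?u) st)" using J by (intro only_upd) auto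
    then show "?J (Suc t) (?G t st)"
      unfolding eq using J t by (auto simp: upd_def)
  qed
  then show ?thesis by auto
qed

definition colour_count :: "nat \<Rightarrow> nat" where
  "colour_count c = card {i \<in> {1..n}. z i = c}"

lemma count_colours_correct:
  assumes s: "std s" and cnt: "\<And>x. s ''cnt'' x = 0"
    and s': "s' = count_colours A s"
  shows "only (WA \<union> {''cnt''}) s s'" "s' ''q'' 0 = s ''q'' 0 + k"
    "\<And>x. s' ''cnt'' x = (if NN + 1 \<le> x \<and> x \<le> NN + k then colour_count (x - NN) else 0)"
proof -
  let ?W = "WA \<union> {''cnt''}"
  let ?I = "\<lambda>t st. only ?W s st \<and> st ''q'' 0 = s ''q'' 0 + t \<and>
     (\<forall>x. st ''cnt'' x = (if NN + 1 \<le> x \<and> x \<le> NN + t then colour_count (x - NN) else 0))"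
  have "?I k s'"
    unfolding s' count_colours_def
  proof (rule for_st_inv[where I = ?I])
    show "k = min (s ''k'' 0) (s ''N'' 0)" using s by (simp add: std_def NN_def)
    show "?I 0 s" using cnt by (simp add: only_refl)
  next
    fix c st assume c: "c < k" and I: "?I c st"
    have st: "std st" by (rule std_only[OF s, of ?W]) (use I in auto)
    define t1 where "t1 = A (fill ''G'' (\<lambda>s. s ''n'' 0) (\<lambda>i s. Suc c) st)"
    have t1: "only WA st t1" "t1 ''ans'' 0 = card {i \<in> {1..n}. z i = Suc c}"
        "t1 ''q'' 0 = st ''q'' 0 + 1"
      using ask_fill(1-3)[OF st _ _ t1_def, of "\<lambda>_. Suc c"] c by auto
    have N: "t1 ''N'' 0 = NN" using onlyD[OF t1(1), of "''N''"] st by (simp add: std_def)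
    have eq: "(fill ''G'' (\<lambda>s. s ''n'' 0) (\<lambda>i s. Suc c) ;; A ;;
        assign ''cnt'' (\<lambda>s. s ''N'' 0 + Suc c) (\<lambda>s. s ''ans'' 0)) st =
        upd ''cnt'' (NN + Suc c) (colour_count (Suc c)) t1"
      by (simp add: seq_def assign_def t1_def[symmetric] N t1(2) colour_count_def)
    have o: "only ?W s (upd ''cnt'' (NN + Suc c) (colour_count (Suc c)) t1)"
      using I t1(1) by (auto simp: only_def upd_def)
    have "t1 ''cnt'' = st ''cnt''" using onlyD[OF t1(1)] by auto
    then show "?I (Suc c) ((fill ''G'' (\<lambda>s. s ''n'' 0) (\<lambda>i s. Suc c) ;; A ;;
        assign ''cnt'' (\<lambda>s. s ''N'' 0 + Suc c) (\<lambda>s. s ''ans'' 0)) st)"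
      unfolding eq using I t1(3) o by (auto simp: upd_def)
  qed
  then show "only (WA \<union> {''cnt''}) s s'" "s' ''q'' 0 = s ''q'' 0 + k"
    "\<And>x. s' ''cnt'' x = (if NN + 1 \<le> x \<and> x \<le> NN + k then colour_count (x - NN) else 0)" by auto
qed

lemma find_zero_correct:
  assumes s: "std s" and cnt: "s ''cnt'' (NN + 2) = colour_count 2"
    and s': "s' = find_zero A s"
  shows "only (WD \<union> {''m'', ''j'', ''off'', ''base'', ''dum''}) s s'"
    "s' ''q'' 0 = s ''q'' 0 + Suc (set_of 2 (n - 1))"
    "\<And>i. i \<in> {1..n} \<Longrightarrow> 1 \<le> s' ''dum'' i \<and> s' ''dum'' i \<le> k \<and> s' ''dum'' i \<noteq> z i"
proof -
  define s1 where "s1 = upd ''base'' 0 (colour_count 2) (upd ''off'' 0 1 (upd ''j'' 0 2 (upd ''m'' 0 n s)))"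
  define s2 where "s2 = detect query_zero A s1"
  define v where "v u = (if z (Suc u) = 1 then 2 else if z (Suc u) = 2 then 0 else (1::nat))" for u
  have N: "s ''N'' 0 = NN" using s by (simp add: std_def)
  have s1: "std s1" using s by (auto simp: s1_def std_def upd_def)
  have M: "set_of 2 (n - 1) \<le> n" using set_of_le[of 2 "n - 1"] n by simp
  let ?c = "\<lambda>T i. if entry 2 (i - 1) T = 1 then 1 else 2 :: nat"
  have s2: "only WD s1 s2" "\<And>u. u < n \<Longrightarrow> s2 ''val'' u = v u"
    "s2 ''q'' 0 = s1 ''q'' 0 + Suc (set_of 2 (n - 1))"
  proof -
    have j: "s1 ''j'' 0 = 2" and m: "s1 ''m'' 0 = n" and N1: "s1 ''N'' 0 = NN"
      and off: "s1 ''off'' 0 = 1" and base: "s1 ''base'' 0 = colour_count 2"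
      using N by (auto simp: s1_def upd_def)
    have query: "query_zero T i s' = ?c T i" if "T \<le> set_of 2 (n - 1)" "i \<in> {1..n}" "only WD s1 s'" for T i s'
    proof -
      have "s' ''N'' 0 = NN" "s' ''j'' 0 = 2"
        using onlyD[OF that(3), of "''N''"] onlyD[OF that(3), of "''j''"] N1 j by auto
      moreover have "centry NN 2 (i - 1) T = entry 2 (i - 1) T"
        by (rule centry_eq) (use that M n in \<open>auto simp: NN_def\<close>)
      ultimately show ?thesis by (simp add: query_zero_def)
    qed
    have ans: "card {i \<in> {1..n}. z i = ?c T i} +
        (\<Sum>u<n. if entry 2 u T = 1 then s1 ''off'' 0 else 0) - s1 ''base'' 0 =
        (\<Sum>u<n. entry 2 u T * v u)" for T
    proof -
      have im: "{1..n} = Suc ` {..<n}" by (simp add: image_Suc_lessThan)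
      have a: "card {i \<in> {1..n}. P i} = (\<Sum>u<n. of_bool (P (Suc u)))" for P :: "nat \<Rightarrow> bool"
      proof -
        have "{i \<in> {1..n}. P i} = Suc ` {u \<in> {..<n}. P (Suc u)}" unfolding im by auto
        then have "card {i \<in> {1..n}. P i} = card {u \<in> {..<n}. P (Suc u)}"
          by (simp add: card_image)
        also have "\<dots> = (\<Sum>u<n. of_bool (P (Suc u)))"
          by (simp add: of_bool_def sum.If_cases Int_def)
        finally show ?thesis .
      qed
      have "card {i \<in> {1..n}. z i = ?c T i} + (\<Sum>u<n. if entry 2 u T = 1 then 1 else 0) =
          (\<Sum>u<n. of_bool (z (Suc u) = ?c T (Suc u)) + (if entry 2 u T = 1 then 1 else 0))"
        unfolding a by (simp only: sum.distrib)
      \<comment> \<open>Position by position: where the entry is 1, the match with colour 1,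
        increased by 1, equals \<open>v u\<close> plus the match that colour 2 would have given;
        elsewhere both sides are the match with colour 2.\<close>
      also have "\<dots> = (\<Sum>u<n. entry 2 u T * v u + of_bool (z (Suc u) = 2))"
        by (rule sum.cong) (auto simp: v_def dest: entry_01)
      also have "\<dots> = (\<Sum>u<n. entry 2 u T * v u) + colour_count 2"
        unfolding colour_count_def a by (simp only: sum.distrib)
      finally show ?thesis unfolding off base by simp
    qed
    have "only WD s1 s2 \<and> (\<forall>u<n. s2 ''val'' u = v u) \<and>
        s2 ''q'' 0 = s1 ''q'' 0 + Suc (set_of 2 (n - 1))"
      by (rule detect_correct[of s1 n 2 v query_zero ?c s2];
        (fact s1 m j n query s2_def | rule ans | use M n k in \<open>simp add: NN_def v_def\<close>))
    then show "only WD s1 s2" "\<And>u. u < n \<Longrightarrow> s2 ''val'' u = v u"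
      "s2 ''q'' 0 = s1 ''q'' 0 + Suc (set_of 2 (n - 1))" by auto
  qed
  let ?f = "\<lambda>i s. if s ''val'' (i - 1) = 2 then 2 else (1::nat)"
  have "find_zero A s = fill ''dum'' (\<lambda>s. s ''n'' 0) ?f s2"
    using s cnt unfolding find_zero_def s2_def s1_def by (simp add: seq_def assign_def std_def upd_def)
  also have "\<dots> = s2(''dum'' := (\<lambda>j. if 1 \<le> j \<and> j \<le> min (s2 ''n'' 0) (s2 ''N'' 0) then ?f j s2 else s2 ''dum'' j))"
    by (rule fill_eq) (auto simp: only_def)
  finally have s'2: "s' = s2(''dum'' := (\<lambda>j. if 1 \<le> j \<and> j \<le> min (s2 ''n'' 0) (s2 ''N'' 0) then ?f j s2 else s2 ''dum'' j))"
    unfolding s' .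
  have st2: "std s2" by (rule std_only[OF s1 s2(1)]) auto
  show "only (WD \<union> {''m'', ''j'', ''off'', ''base'', ''dum''}) s s'"
    using s2(1) unfolding s'2 by (auto simp: only_def s1_def upd_def)
  show "s' ''q'' 0 = s ''q'' 0 + Suc (set_of 2 (n - 1))"
    unfolding s'2 using s2(3) by (simp add: s1_def upd_def)
  fix i assume i: "i \<in> {1..n}"
  then have "s2 ''val'' (i - 1) = v (i - 1)" by (intro s2(2)) auto
  also have "v (i - 1) = (if z i = 1 then 2 else if z i = 2 then 0 else 1)"
    using i by (simp add: v_def)
  finally have "s2 ''val'' (i - 1) = 2 \<longleftrightarrow> z i = 1" by simp
  moreover have "min (s2 ''n'' 0) (s2 ''N'' 0) = n" using st2 by (simp add: std_def NN_def)
  ultimately have "s' ''dum'' i = (if z i = 1 then 2 else 1)"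
    using i unfolding s'2 by simp
  then show "1 \<le> s' ''dum'' i \<and> s' ''dum'' i \<le> k \<and> s' ''dum'' i \<noteq> z i"
    using k by auto
qed

end

section \<open>The tree of positions and the colour counts at its nodes\<close>

context game
begin

definition L :: nat where "L = depth n"

definition ancestor :: "nat \<Rightarrow> nat \<Rightarrow> nat" where
  "ancestor l i = (2 ^ L + (i - 1)) div 2 ^ (L - l)"

definition node_count :: "nat \<Rightarrow> nat \<Rightarrow> nat \<Rightarrow> nat" where
  "node_count l v c = card {i \<in> {1..n}. ancestor l i = v \<and> z i = c}"

text \<open>Ties are broken by the colour number, so that the ranks at a node are a bijection onto
  \<open>{..<k}\<close>.\<close>

definition rank_of :: "nat \<Rightarrow> nat \<Rightarrow> nat \<Rightarrow> nat" where
  "rank_of l v c = card {c' \<in> {1..k}. node_count l v c < node_count l v c' \<or> node_count l v c = node_count l v c' \<and> c' < c}"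

definition pick :: "nat \<Rightarrow> nat \<Rightarrow> nat \<Rightarrow> nat" where
  "pick l v r = inv_into {1..k} (rank_of l v) r"

lemma L_bounds: "n \<le> 2 ^ L" "2 ^ L \<le> 2 * n" "L \<le> n"
  using depth_ge[of n] depth_le[OF n] depth_le_n[of n] by (auto simp: L_def)

lemma pow_le_NN: "l \<le> L \<Longrightarrow> 2 ^ l \<le> NN" "l \<le> Suc L \<Longrightarrow> 2 ^ l \<le> NN"
proof -
  have *: "2 ^ l \<le> NN" if "l \<le> Suc L" for l
  proof -
    have "(2::nat) ^ l \<le> 2 ^ Suc L" using that by (intro power_increasing) auto
    then show ?thesis using L_bounds(2) by (simp add: NN_def)
  qed
  then show "l \<le> L \<Longrightarrow> 2 ^ l \<le> NN" "l \<le> Suc L \<Longrightarrow> 2 ^ l \<le> NN" by auto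
qed

lemma L_NN: "L \<le> NN"
  using L_bounds(3) by (simp add: NN_def)

lemma ancestor_bounds:
  assumes "i \<in> {1..n}" "l \<le> L"
  shows "2 ^ l \<le> ancestor l i" "ancestor l i < 2 ^ Suc l"
proof -
  have e: "(2::nat) ^ L = 2 ^ l * 2 ^ (L - l)" using assms(2) by (simp add: power_add[symmetric])
  have i: "i - 1 < 2 ^ L" using assms(1) L_bounds(1) by auto
  have "2 ^ l * 2 ^ (L - l) \<le> 2 ^ L + (i - 1)" using e by simp
  then show "2 ^ l \<le> ancestor l i"
    unfolding ancestor_def by (subst less_eq_div_iff_mult_less_eq) auto
  have "2 ^ L + (i - 1) < 2 ^ Suc l * 2 ^ (L - l)" using e i by simp
  then show "ancestor l i < 2 ^ Suc l"
    unfolding ancestor_def by (subst div_less_iff_less_mult) auto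
qed

lemma ancestor_Suc:
  assumes "l < L"
  shows "ancestor l i = ancestor (Suc l) i div 2"
proof -
  have "(2::nat) ^ (L - l) = 2 ^ (L - Suc l) * 2"
    using assms by (metis Suc_diff_Suc power_Suc2)
  then show ?thesis by (simp add: ancestor_def div_mult2_eq)
qed

lemma ancestor_0: "i \<in> {1..n} \<Longrightarrow> ancestor 0 i = 1"
  using ancestor_bounds[of i 0] by simp

lemma ancestor_L: "ancestor L i = 2 ^ L + (i - 1)"
  by (simp add: ancestor_def)

lemma card_or:
  assumes "finite X" "\<And>x. x \<in> X \<Longrightarrow> P x \<longleftrightarrow> Q x \<or> R x" "\<And>x. \<not> (Q x \<and> R x)"
  shows "card {x \<in> X. P x} = card {x \<in> X. Q x} + card {x \<in> X. R x}"
proof -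
  have "{x \<in> X. P x} = {x \<in> X. Q x} \<union> {x \<in> X. R x}" using assms(2) by auto
  moreover have "{x \<in> X. Q x} \<inter> {x \<in> X. R x} = {}" using assms(3) by auto
  ultimately show ?thesis using assms(1) by (simp add: card_Un_disjoint)
qed

lemma node_count_split:
  assumes "l < L"
  shows "node_count l v c = node_count (Suc l) (2 * v) c + node_count (Suc l) (2 * v + 1) c"
  unfolding node_count_def
proof (rule card_or)
  fix x
  have "ancestor (Suc l) x div 2 = v \<longleftrightarrow> ancestor (Suc l) x = 2 * v \<or> ancestor (Suc l) x = 2 * v + 1" by presburger
  then show "ancestor l x = v \<and> z x = c \<longleftrightarrow>
      ancestor (Suc l) x = 2 * v \<and> z x = c \<or> ancestor (Suc l) x = 2 * v + 1 \<and> z x = c"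
    unfolding ancestor_Suc[OF assms] by blast
qed auto

lemma node_count_0: "node_count 0 1 c = colour_count c"
  unfolding node_count_def colour_count_def by (rule arg_cong[where f = card]) (auto simp: ancestor_0)

lemma node_count_le: "node_count l v c \<le> n"
proof -
  have "node_count l v c \<le> card {1..n}" unfolding node_count_def by (intro card_mono) auto
  then show ?thesis by simp
qed

text \<open>Positions are mapped injectively to their leaves, and the leaves below a node form an
  interval. Equality fails in general, because up to half of the leaves carry no position.\<close>

lemma sum_node_count: "(\<Sum>c\<in>{1..k}. node_count l v c) \<le> 2 ^ (L - l)"
proof -
  let ?w = "2 ^ (L - l) :: nat" and ?P = "{i \<in> {1..n}. ancestor l i = v}"
  have "(\<Sum>c\<in>{1..k}. node_count l v c) = (\<Sum>c\<in>{1..k}. card {i \<in> ?P. z i = c})"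
    unfolding node_count_def by (intro sum.cong arg_cong[where f = card]) auto
  also have "\<dots> = (\<Sum>c\<in>{1..k}. \<Sum>i\<in>{i \<in> ?P. z i = c}. 1)" by simp
  also have "\<dots> = (\<Sum>i\<in>?P. 1)"
    by (rule sum.group) (use z_range in auto)
  also have "\<dots> = card ?P" by simp
  also have "\<dots> \<le> card {v * ?w..<v * ?w + ?w}"
  proof (rule card_inj_on_le)
    show "inj_on (\<lambda>i. 2 ^ L + (i - 1)) ?P" by (auto intro!: inj_onI)
    show "(\<lambda>i. 2 ^ L + (i - 1)) ` ?P \<subseteq> {v * ?w..<v * ?w + ?w}"
    proof (rule image_subsetI)
      fix i assume "i \<in> ?P"
      then have v: "(2 ^ L + (i - 1)) div ?w = v" unfolding ancestor_def by blast
      define p where "p = 2 ^ L + (i - 1)"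
      have "p = v * ?w + p mod ?w" using div_mult_mod_eq[of p ?w] v unfolding p_def by simp
      moreover have "p mod ?w < ?w" by simp
      ultimately have "v * ?w \<le> p" "p < v * ?w + ?w" by linarith+
      then show "2 ^ L + (i - 1) \<in> {v * ?w..<v * ?w + ?w}" by (simp only: p_def atLeastLessThan_iff)
    qed
  qed simp
  finally show ?thesis by simp
qed

lemma rank_bij: "bij_betw (rank_of l v) {1..k} {..<k}"
proof -
  have "bij_betw (\<lambda>b. card {a \<in> {1..k}. node_count l v b < node_count l v a \<or> node_count l v b = node_count l v a \<and> a < b})
      {1..k} {..<card {1..k}}"
    by (rule bij_betw_rank) auto
  then show ?thesis by (simp add: rank_of_def[abs_def])
qed

lemma rank_less: "c \<in> {1..k} \<Longrightarrow> rank_of l v c < k"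
  using rank_bij[of l v] by (auto simp: bij_betw_def)

lemma pick_rank:
  assumes "r < k"
  shows "pick l v r \<in> {1..k} \<and> rank_of l v (pick l v r) = r"
proof -
  have "rank_of l v ` {1..k} = {..<k}" using rank_bij by (rule bij_betw_imp_surj_on)
  with assms have r: "r \<in> rank_of l v ` {1..k}" by simp
  show ?thesis
    unfolding pick_def using inv_into_into[OF r] f_inv_into_f[OF r] by blast
qed

lemma pick_unique:
  assumes "r < k" "c \<in> {1..k}"
  shows "rank_of l v c = r \<longleftrightarrow> c = pick l v r"
proof
  have inj: "inj_on (rank_of l v) {1..k}" using rank_bij by (rule bij_betw_imp_inj_on)
  assume "rank_of l v c = r"
  then show "c = pick l v r"
    using inj_onD[OF inj _ assms(2)] pick_rank[OF assms(1), of l v] by metis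
next
  assume "c = pick l v r"
  then show "rank_of l v c = r" using pick_rank[OF assms(1), of l v] by simp
qed

text \<open>All colours ranked up to \<open>c\<close>, including \<open>c\<close> itself, occur at
  least as often as \<open>c\<close>, and together they occur at most as often as there are
  leaves.\<close>

lemma rank_bound:
  assumes "c \<in> {1..k}"
  shows "Suc (rank_of l v c) * node_count l v c \<le> 2 ^ (L - l)"
proof -
  let ?R = "{c' \<in> {1..k}. node_count l v c < node_count l v c' \<or> node_count l v c = node_count l v c' \<and> c' < c}"
  have "Suc (rank_of l v c) * node_count l v c = card (insert c ?R) * node_count l v c"
    by (simp add: rank_of_def)
  also have "\<dots> = (\<Sum>c'\<in>insert c ?R. node_count l v c)" by (simp only: sum_constant of_nat_id)
  also have "\<dots> \<le> (\<Sum>c'\<in>insert c ?R. node_count l v c')" by (rule sum_mono) auto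
  also have "\<dots> \<le> (\<Sum>c'\<in>{1..k}. node_count l v c')" by (rule sum_mono2) (use assms in auto)
  also have "\<dots> \<le> 2 ^ (L - l)" by (rule sum_node_count)
  finally show ?thesis .
qed

lemma cpow_NN: "l \<le> L \<Longrightarrow> cpow NN l = 2 ^ l" "cpow NN (L - l) = 2 ^ (L - l)"
  using L_NN by (auto simp: cpow_eq)

lemma cancestor_eq:
  assumes "i \<in> {1..n}" "l \<le> L"
  shows "cancestor NN L l i = ancestor l i"
proof -
  have "ancestor l i \<le> NN" using ancestor_bounds(2)[OF assms] pow_le_NN(2)[of "Suc l"] assms(2) by auto
  then show ?thesis by (simp add: cancestor_def cpow_NN cdiv_eq ancestor_def)
qed

lemma crank_eq:
  assumes "v \<le> NN" "c \<in> {1..k}" "\<And>c. c \<in> {1..k} \<Longrightarrow> cnt (v * NN + c) = node_count l v c"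
  shows "crank NN k cnt v c = rank_of l v c"
proof -
  have "crank NN k cnt v c = (\<Sum>c'<NN. if c' \<in> {c' \<in> {1..k}. node_count l v c < node_count l v c' \<or> node_count l v c = node_count l v c' \<and> c' < c} then 1 else 0)"
    unfolding crank_def using assms by (intro sum.cong) auto
  also have "\<dots> = rank_of l v c"
    unfolding rank_of_def by (rule sum_if_set) (auto simp: NN_def)
  finally show ?thesis .
qed

lemma ccolour_eq:
  assumes "v \<le> NN" "r < k" "\<And>c. c \<in> {1..k} \<Longrightarrow> cnt (v * NN + c) = node_count l v c"
  shows "ccolour NN k cnt v r = pick l v r"
  unfolding ccolour_def
proof (rule sum_delta_cond)
  fix c
  show "1 \<le> c \<and> c \<le> k \<and> crank NN k cnt v c = r \<longleftrightarrow> c = pick l v r"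
    using crank_eq[OF assms(1) _ assms(3), of c] pick_unique[OF assms(2), of c l v] pick_rank[OF assms(2), of l v]
    by auto
  show "pick l v r < NN" using pick_rank[OF assms(2), of l v] by (auto simp: NN_def)
qed

definition ready :: "state \<Rightarrow> bool" where
  "ready s \<longleftrightarrow> std s \<and> s ''L'' 0 = L \<and> s ''off'' 0 = 0 \<and> s ''base'' 0 = 0 \<and>
     (\<forall>i\<in>{1..n}. 1 \<le> s ''dum'' i \<and> s ''dum'' i \<le> k \<and> s ''dum'' i \<noteq> z i)"

definition counted :: "nat \<Rightarrow> state \<Rightarrow> bool" where
  "counted l s \<longleftrightarrow> (\<forall>v c. 2 ^ l \<le> v \<longrightarrow> v < 2 ^ Suc l \<longrightarrow> c \<in> {1..k} \<longrightarrow>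
     s ''cnt'' (v * NN + c) = node_count l v c)"

text \<open>\<open>P v c\<close> says that the children of \<open>v\<close> already have their
  counts of \<open>c\<close>. All other cells from level \<open>l + 1\<close> on must be 0: this is
  the right value for colours of rank at least \<open>w\<close>, about which nothing is asked, and
  it hands empty tables to the next level.\<close>

definition partial :: "nat \<Rightarrow> (nat \<Rightarrow> nat \<Rightarrow> bool) \<Rightarrow> state \<Rightarrow> bool" where
  "partial l P s \<longleftrightarrow> (\<forall>v c. 2 ^ Suc l \<le> v \<longrightarrow> c \<in> {1..k} \<longrightarrow>
     s ''cnt'' (v * NN + c) = (if v < 2 ^ Suc (Suc l) \<and> P (v div 2) c then node_count (Suc l) v c else 0))"

definition rows :: "nat \<Rightarrow> nat \<Rightarrow> nat" where
  "rows l r = Suc (set_of (bits (2 ^ (L - l)) r) (2 ^ l - 1))"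

abbreviation WC :: "vname set" where "WC \<equiv> WD \<union> {''m'', ''j'', ''r'', ''cnt''}"

lemma store_correct:
  assumes s: "std s" "s ''l'' 0 = l" "s ''r'' 0 = r" and l: "l < L" and r: "r < k"
    and B: "B < 2 ^ l" and val: "s ''val'' B = node_count (Suc l) (2 * (2 ^ l + B)) (pick l (2 ^ l + B) r)"
    and c: "counted l s" "partial l P s"
  shows "only {''cnt''} s (store B s)" "counted l (store B s)"
    "partial l (\<lambda>v c. P v c \<or> v = 2 ^ l + B \<and> c = pick l v r) (store B s)"
proof -
  let ?v = "2 ^ l + B" let ?c = "pick l ?v r"
  have cpopcount: "?c \<in> {1..k}" using pick_rank[OF r] by blast
  have cells: "s ''N'' 0 = NN" "s ''k'' 0 = k" using s(1) by (auto simp: std_def)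
  have vN: "Suc (?v + ?v) \<le> NN"
  proof -
    have "2 * ?v < 2 ^ Suc (Suc l)" using B by simp
    moreover have "2 ^ Suc (Suc l) \<le> NN" using l by (intro pow_le_NN(2)) simp
    ultimately have "2 * ?v < NN" by (rule less_le_trans)
    then show ?thesis by simp
  qed
  have cNN: "c < NN" if "c \<in> {1..k}" for c using that by (auto simp: NN_def)
  have node: "node B t = ?v" if "t ''N'' 0 = NN" "t ''l'' 0 = l" for t
    using that l by (simp add: node_def cpow_NN)
  have chosen: "chosen B t = ?c" if "t ''N'' 0 = NN" "t ''l'' 0 = l" "t ''k'' 0 = k" "t ''r'' 0 = r" "counted l t" for t
  proof -
    have "ccolour NN k (t ''cnt'') ?v r = ?c"
      by (rule ccolour_eq) (use that(5) B vN r in \<open>auto simp: counted_def\<close>)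
    then show ?thesis using that node[of t] by (simp add: chosen_def)
  qed
  define s1 where "s1 = upd ''cnt'' ((?v + ?v) * NN + ?c) (s ''val'' B) s"
  have 1: "assign ''cnt'' (\<lambda>s. min (node B s + node B s) (s ''N'' 0) * s ''N'' 0 + chosen B s)
       (\<lambda>s. s ''val'' B) s = s1"
    using node[of s, OF cells(1) s(2)] chosen[of s, OF cells(1) s(2) cells(2) s(3) c(1)] vN cells
    by (simp add: assign_def s1_def)
  have s1c: "s1 ''cnt'' (v * NN + c) = (if v = ?v + ?v \<and> c = ?c then s ''val'' B else s ''cnt'' (v * NN + c))"
    if "c \<in> {1..k}" for v c
    using cell_inj[OF cNN[OF that] cNN[OF cpopcount], of v "?v + ?v"] by (auto simp: s1_def upd_def)
  have c1: "counted l s1"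
    using c(1) by (auto simp: counted_def s1c)
  have cells1: "s1 ''N'' 0 = NN" "s1 ''l'' 0 = l" "s1 ''k'' 0 = k" "s1 ''r'' 0 = r" "s1 ''val'' B = s ''val'' B"
    using cells s by (auto simp: s1_def upd_def)
  define s2 where "s2 = upd ''cnt'' (Suc (?v + ?v) * NN + ?c) (node_count (Suc l) (2 * ?v + 1) ?c) s1"
  have "s1 ''cnt'' (?v * NN + ?c) = node_count l ?v ?c"
    using c1 B cpopcount by (simp add: counted_def)
  then have "s1 ''cnt'' (?v * NN + ?c) - s1 ''val'' B = node_count (Suc l) (2 * ?v + 1) ?c"
    using node_count_split[OF l, of ?v ?c] cells1(5) val by simp
  then have 2: "store B s = s2"
    unfolding store_def seq_def 1
    using node[of s1, OF cells1(1,2)] chosen[of s1, OF cells1(1-4) c1] vN cells1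
    by (simp add: assign_def s2_def)
  have s2c: "s2 ''cnt'' (v * NN + c) = (if v = Suc (?v + ?v) \<and> c = ?c then node_count (Suc l) (2 * ?v + 1) ?c
      else s1 ''cnt'' (v * NN + c))" if "c \<in> {1..k}" for v c
    using cell_inj[OF cNN[OF that] cNN[OF cpopcount], of v "Suc (?v + ?v)"]
    by (auto simp: s2_def upd_def simp del: mult_Suc)
  show "only {''cnt''} s (store B s)"
    unfolding 2 by (auto simp: only_def s1_def s2_def upd_def)
  show "counted l (store B s)"
    unfolding 2 using c1 by (auto simp: counted_def s2c)
  show "partial l (\<lambda>v c. P v c \<or> v = 2 ^ l + B \<and> c = pick l v r) (store B s)"
    unfolding partial_def 2
  proof (intro allI impI)
    fix v c :: nat assume v: "2 ^ Suc l \<le> v" and cc: "c \<in> {1..k}"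
    have old: "s ''cnt'' (v * NN + c) = (if v < 2 ^ Suc (Suc l) \<and> P (v div 2) c then node_count (Suc l) v c else 0)"
      using c(2) v cc by (simp add: partial_def)
    have d: "v div 2 = ?v \<longleftrightarrow> v = ?v + ?v \<or> v = Suc (?v + ?v)" by presburger
    have small: "?v + ?v < 2 ^ Suc (Suc l)" "Suc (?v + ?v) < 2 ^ Suc (Suc l)" using B by auto
    consider "v = ?v + ?v" "c = ?c" | "v = Suc (?v + ?v)" "c = ?c"
      | "\<not> (v div 2 = ?v \<and> c = ?c)" using d by blast
    then show "s2 ''cnt'' (v * NN + c) = (if v < 2 ^ Suc (Suc l) \<and>
        (P (v div 2) c \<or> v div 2 = ?v \<and> c = pick l (v div 2) r) then node_count (Suc l) v c else 0)"
    proof cases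
      case 1
      then have "v div 2 = ?v" by simp
      moreover have "s2 ''cnt'' (v * NN + c) = s ''val'' B" using 1 cc by (simp add: s2c s1c)
      moreover have "node_count (Suc l) v c = s ''val'' B" using val 1 by (simp only: mult_2)
      moreover have "v < 2 ^ Suc (Suc l)" using 1 small by (simp only:)
      ultimately show ?thesis using 1(2) by simp
    next
      case 2
      then have "v div 2 = ?v" by simp
      moreover have "s2 ''cnt'' (v * NN + c) = node_count (Suc l) (2 * ?v + 1) ?c"
        using 2 cc by (simp only: s2c) simp
      moreover have "2 * ?v + 1 = v" using 2 by simp
      moreover have "v < 2 ^ Suc (Suc l)" using 2 small by (simp only:)
      ultimately show ?thesis using 2(2) by simp
    next
      case 3
      then have "s2 ''cnt'' (v * NN + c) = s ''cnt'' (v * NN + c)"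
        using cc d by (auto simp: s2c s1c)
      then show ?thesis using old 3 by auto
    qed
  qed
qed

lemma split_colour_correct:
  assumes s: "ready s" "s ''l'' 0 = l" and l: "l < L" and r: "r < k" "r < 2 ^ (L - l)"
    and c: "counted l s" "partial l (\<lambda>v c. rank_of l v c < r) s"
    and s': "s' = split_colour A r s"
  shows "only WC s s'" "counted l s'" "partial l (\<lambda>v c. rank_of l v c < Suc r) s'"
    "s' ''q'' 0 = s ''q'' 0 + rows l r"
proof -
  let ?w = "2 ^ (L - l) :: nat"
  define j where "j = bits ?w r"
  define s1 where "s1 = upd ''j'' 0 j (upd ''m'' 0 (2 ^ l) (upd ''r'' 0 r s))"
  define s2 where "s2 = detect query_split A s1"
  have std: "std s" and sL: "s ''L'' 0 = L" and off: "s ''off'' 0 = 0" and base: "s ''base'' 0 = 0"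
    and dum: "\<And>i. i \<in> {1..n} \<Longrightarrow> 1 \<le> s ''dum'' i \<and> s ''dum'' i \<le> k \<and> s ''dum'' i \<noteq> z i"
    using s(1) by (auto simp: ready_def)
  have N: "s ''N'' 0 = NN" and sk: "s ''k'' 0 = k" using std by (auto simp: std_def)
  have wNN: "?w \<le> NN" by (rule pow_le_NN(1)) simp
  have jle: "j \<le> NN" using bits_le[of ?w r] wNN by (simp add: j_def)
  have j1: "1 \<le> j" using bits_pos[OF r(2)] by (simp add: j_def)
  have wsum: "(\<Sum>i<NN. if min (Suc r) NN * cpow NN i \<le> ?w then 1 else 0) = j"
  proof -
    have "Suc r \<le> NN" using r(1) by (simp add: NN_def)
    then have "(\<Sum>i<NN. if min (Suc r) NN * cpow NN i \<le> ?w then 1 else 0) =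
        (\<Sum>i<NN. if i \<in> {i. Suc r * 2 ^ i \<le> ?w} then 1 else (0::nat))"
      by (intro sum.cong) (auto simp: cpow_eq)
    also have "\<dots> = card {..<j}"
      unfolding bits_set j_def[symmetric] by (rule sum_if_set) (use jle in auto)
    finally show ?thesis by simp
  qed
  have width: "width t = ?w" if "t ''N'' 0 = NN" "t ''L'' 0 = L" "t ''l'' 0 = l" for t
    using that by (simp add: width_def cpow_NN)
  define t1 where "t1 = upd ''m'' 0 (2 ^ l) (upd ''r'' 0 r s)"
  have "width t1 = ?w" by (rule width) (use N sL s(2) in \<open>auto simp: t1_def upd_def\<close>)
  moreover have "t1 ''N'' 0 = NN" using N by (simp add: t1_def upd_def)
  ultimately have wj: "assign ''j'' (\<lambda>s. 0) (\<lambda>s. \<Sum>i<s ''N'' 0. if min (Suc r) (s ''N'' 0) * cpow (s ''N'' 0) i \<le> width s then 1 else 0) t1 = s1"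
    unfolding assign_def using wsum by (simp add: s1_def t1_def)
  have "assign ''m'' (\<lambda>s. 0) (\<lambda>s. cpow (s ''N'' 0) (s ''l'' 0)) (assign ''r'' (\<lambda>s. 0) (\<lambda>s. r) s) = t1"
    using N s(2) l by (simp add: assign_def t1_def upd_def cpow_NN)
  then have s'2: "s' = for_st (\<lambda>s. s ''m'' 0) store s2"
    unfolding s' split_colour_def seq_def s2_def wj[symmetric] by simp
  have cells: "s1 ''m'' 0 = 2 ^ l" "s1 ''j'' 0 = j" "s1 ''N'' 0 = NN" "s1 ''k'' 0 = k" "s1 ''L'' 0 = L"
    "s1 ''l'' 0 = l" "s1 ''r'' 0 = r" "s1 ''off'' 0 = 0" "s1 ''base'' 0 = 0" "s1 ''dum'' = s ''dum''"
    "s1 ''cnt'' = s ''cnt''" "s1 ''q'' = s ''q''"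
    using N sk sL s(2) off base by (auto simp: s1_def upd_def)
  have std1: "std s1" using std by (auto simp: s1_def std_def upd_def)
  have lNN: "2 ^ l \<le> NN" using l by (intro pow_le_NN) simp
  have cset: "set_of j (2 ^ l - 1) \<le> 2 ^ l" using set_of_le[OF j1, of "2 ^ l - 1"] by simp
  have l2: "2 ^ l < NN"
  proof -
    have "(2::nat) ^ l \<le> 2 * n" using L_bounds(2) power_increasing[of l L "2::nat"] l by linarith
    then show ?thesis by (simp add: NN_def)
  qed
  define v where "v B = node_count (Suc l) (2 * (2 ^ l + B)) (pick l (2 ^ l + B) r)" for B
  define cc where "cc T i = (if even (ancestor (Suc l) i) \<and> entry j (ancestor l i - 2 ^ l) T = 1
      then pick l (ancestor l i) r else s ''dum'' i)" for T i
  have det: "only WD s1 s2 \<and> (\<forall>u<2 ^ l. s2 ''val'' u = v u) \<and>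
        s2 ''q'' 0 = s1 ''q'' 0 + Suc (set_of j (2 ^ l - 1))"
  proof (rule detect_correct[of s1 "2 ^ l" j v query_split cc s2])
    show "Suc (set_of j (2 ^ l - 1)) \<le> NN" using cset l2 by simp
  next
    fix u :: nat assume u: "u < 2 ^ l"
    let ?v = "2 ^ l + u" and ?c = "pick l (2 ^ l + u) r"
    have cpopcount: "?c \<in> {1..k}" "rank_of l ?v ?c = r" using pick_rank[OF r(1)] by auto
    \<comment> \<open>A colour of rank \<open>r\<close> occurs at most \<open>w / (r + 1)\<close>
      times, a number of \<open>j\<close> binary digits, and no more often in the left
      child.\<close>
    have "Suc r * node_count l ?v ?c \<le> ?w" using rank_bound[OF cpopcount(1), of l ?v] cpopcount(2) by simp
    also have "\<dots> < Suc r * 2 ^ j" unfolding j_def by (rule bits_greater)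
    finally have "node_count l ?v ?c < 2 ^ j" by (simp only: mult_less_cancel1)
    then show "v u < 2 ^ j" using node_count_split[OF l, of ?v ?c] by (simp add: v_def)
    show "v u \<le> NN" using node_count_le[of "Suc l" "2 * ?v" ?c] by (simp add: v_def NN_def)
  next
    fix T i t assume T: "T \<le> set_of j (2 ^ l - 1)" and i: "i \<in> {1..n}" and o: "only WD s1 t"
    have tc: "t ''N'' 0 = NN" "t ''k'' 0 = k" "t ''L'' 0 = L" "t ''l'' 0 = l" "t ''r'' 0 = r"
      "t ''j'' 0 = j" "t ''dum'' = s ''dum''" "t ''cnt'' = s ''cnt''"
      using onlyD[OF o] cells by auto
    have a: "2 ^ l \<le> ancestor l i" "ancestor l i < 2 ^ Suc l" using ancestor_bounds[OF i] l by auto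
    have aNN: "ancestor l i \<le> NN" using a(2) pow_le_NN(2)[of "Suc l"] l by simp
    have "ancestor (Suc l) i < 2 ^ Suc (Suc l)" using ancestor_bounds(2)[OF i, of "Suc l"] l by simp
    then have aNN2: "ancestor (Suc l) i \<le> NN" using pow_le_NN(2)[of "Suc (Suc l)"] l by linarith
    have "centry NN j (ancestor l i - 2 ^ l) T = entry j (ancestor l i - 2 ^ l) T"
      by (rule centry_eq[OF j1]) (use a l2 T cset in auto)
    moreover have "ccolour NN k (s ''cnt'') (ancestor l i) r = pick l (ancestor l i) r"
      by (rule ccolour_eq[OF aNN r(1)]) (use c(1) a in \<open>auto simp: counted_def\<close>)
    ultimately show "query_split T i t = cc T i"
      using cancestor_eq[OF i, of l] cancestor_eq[OF i, of "Suc l"] l aNN2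
      by (simp add: query_split_def tc cc_def cpow_NN cparity_eq even_iff_mod_2_eq_zero)
  next
    fix T i assume "i \<in> {1..n}"
    then show "1 \<le> cc T i \<and> cc T i \<le> k"
      using dum pick_rank[OF r(1), of l "ancestor l i"] by (auto simp: cc_def)
  next
    fix T
    have "card {i \<in> {1..n}. z i = cc T i} = (\<Sum>B<2 ^ l. entry j B T * v B)"
    proof -
      let ?S = "{i \<in> {1..n}. z i = cc T i}"
      have "card ?S = (\<Sum>i\<in>?S. 1)" by simp
      also have "\<dots> = (\<Sum>B<2 ^ l. \<Sum>i\<in>{i \<in> ?S. ancestor l i - 2 ^ l = B}. 1)"
      proof (rule sum.group[symmetric])
        show "(\<lambda>i. ancestor l i - 2 ^ l) ` ?S \<subseteq> {..<2 ^ l}"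
        proof (rule image_subsetI)
          fix i assume "i \<in> ?S"
          then have "ancestor l i < 2 ^ Suc l" using ancestor_bounds(2)[of i l] l by simp
          then show "ancestor l i - 2 ^ l \<in> {..<2 ^ l}" by simp
        qed
      qed auto
      also have "\<dots> = (\<Sum>B<2 ^ l. entry j B T * v B)"
      proof (rule sum.cong[OF refl])
        fix B :: nat assume "B \<in> {..<2 ^ l}"
        \<comment> \<open>Within node \<open>2 ^ l + B\<close> only the left half can match, and
          only if row \<open>T\<close> selects the node, because \<open>dum\<close> is wrong
          everywhere.\<close>
        have e: "{i \<in> ?S. ancestor l i - 2 ^ l = B} = (if entry j B T = 1 then
            {i \<in> {1..n}. ancestor (Suc l) i = 2 * (2 ^ l + B) \<and> z i = pick l (2 ^ l + B) r} else {})"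
        proof -
          have "z i = cc T i \<and> ancestor l i - 2 ^ l = B \<longleftrightarrow>
              entry j B T = 1 \<and> ancestor (Suc l) i = 2 * (2 ^ l + B) \<and> z i = pick l (2 ^ l + B) r"
            if i: "i \<in> {1..n}" for i
          proof -
            have a: "2 ^ l \<le> ancestor l i" using ancestor_bounds(1)[OF i, of l] l by simp
            then have "ancestor l i - 2 ^ l = B \<longleftrightarrow> ancestor l i = 2 ^ l + B" by auto
            moreover have "ancestor (Suc l) i = 2 * (2 ^ l + B) \<longleftrightarrow>
                ancestor l i = 2 ^ l + B \<and> even (ancestor (Suc l) i)"
              unfolding ancestor_Suc[OF l] by presburger
            moreover have "z i \<noteq> s ''dum'' i" using dum[OF i] by auto
            ultimately show ?thesis by (auto simp: cc_def)
          qed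
          then show ?thesis by auto
        qed
        show "(\<Sum>i\<in>{i \<in> ?S. ancestor l i - 2 ^ l = B}. 1) = entry j B T * v B"
          unfolding e using entry_01[of j B T] by (auto simp: v_def node_count_def)
      qed
      finally show ?thesis .
    qed
    then show "card {i \<in> {1..n}. z i = cc T i} +
        (\<Sum>u<2 ^ l. if entry j u T = 1 then s1 ''off'' 0 else 0) - s1 ''base'' 0 =
        (\<Sum>u<2 ^ l. entry j u T * v u)"
      using cells by simp
  qed (use std1 cells j1 lNN s2_def in auto)
  have std2: "std s2" by (rule std_only[OF std1, of WD]) (use det in auto)
  have cells2: "s2 ''m'' 0 = 2 ^ l" "s2 ''N'' 0 = NN" "s2 ''l'' 0 = l" "s2 ''r'' 0 = r" "s2 ''cnt'' = s ''cnt''"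
    using det onlyD[of WD s1 s2] cells by auto
  \<comment> \<open>While the answers are being stored, rank \<open>r\<close> is finished exactly at
    the nodes before \<open>2 ^ l + B\<close>.\<close>
  let ?P = "\<lambda>B v c. rank_of l v c < r \<or> v < 2 ^ l + B \<and> c = pick l v r"
  let ?I = "\<lambda>B t. only {''cnt''} s2 t \<and> counted l t \<and> partial l (?P B) t"
  \<comment> \<open>\<open>partial l\<close> consults its predicate only at nodes of level
    \<open>l\<close>, so its values elsewhere may change.\<close>
  have pcong: "partial l P t \<Longrightarrow> (\<And>v c. 2 ^ l \<le> v \<Longrightarrow> v < 2 ^ Suc l \<Longrightarrow> c \<in> {1..k} \<Longrightarrow> P v c \<longleftrightarrow> Q v c) \<Longrightarrow> partial l Q t" for P Q t
    unfolding partial_def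
  proof (intro allI impI)
    fix v c :: nat
    assume p: "\<forall>v c. 2 ^ Suc l \<le> v \<longrightarrow> c \<in> {1..k} \<longrightarrow>
     t ''cnt'' (v * NN + c) = (if v < 2 ^ Suc (Suc l) \<and> P (v div 2) c then node_count (Suc l) v c else 0)"
     and q: "\<And>v c. 2 ^ l \<le> v \<Longrightarrow> v < 2 ^ Suc l \<Longrightarrow> c \<in> {1..k} \<Longrightarrow> P v c \<longleftrightarrow> Q v c"
     and v: "2 ^ Suc l \<le> v" and c: "c \<in> {1..k}"
    have "P (v div 2) c \<longleftrightarrow> Q (v div 2) c" if "v < 2 ^ Suc (Suc l)"
    proof (rule q[OF _ _ c])
      show "2 ^ l \<le> v div 2" using v by simp
      show "v div 2 < 2 ^ Suc l" using that by simp
    qed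
    then show "t ''cnt'' (v * NN + c) = (if v < 2 ^ Suc (Suc l) \<and> Q (v div 2) c then node_count (Suc l) v c else 0)"
      using p v c by auto
  qed
  have "?I (2 ^ l) s'"
    unfolding s'2
  proof (rule for_st_inv[where I = ?I])
    show "2 ^ l = min (s2 ''m'' 0) (s2 ''N'' 0)" using cells2 lNN by simp
  next
    have "counted l s2" using c(1) cells2(5) by (simp add: counted_def)
    moreover have "partial l (\<lambda>v c. rank_of l v c < r) s2" using c(2) cells2(5) by (simp add: partial_def)
    then have "partial l (?P 0) s2" by (rule pcong) auto
    ultimately show "?I 0 s2" by (simp add: only_refl)
  next
    fix B t assume B: "B < 2 ^ l" and I: "?I B t"
    have st: "std t" by (rule std_only[OF std2, of "{''cnt''}"]) (use I in auto)
    have tc: "t ''l'' 0 = l" "t ''r'' 0 = r" "t ''val'' B = v B"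
      using onlyD[of "{''cnt''}" s2 t] I cells2 det B by auto
    note st = store_correct[OF st tc(1,2) l r(1) B tc(3)[unfolded v_def], of "?P B"]
    have "only {''cnt''} t (store B t)" "counted l (store B t)"
      "partial l (\<lambda>v c. ?P B v c \<or> v = 2 ^ l + B \<and> c = pick l v r) (store B t)"
      using st I by auto
    moreover from this(3) have "partial l (?P (Suc B)) (store B t)"
      by (rule pcong) auto
    ultimately show "?I (Suc B) (store B t)" using I only_trans by blast
  qed
  then have fin: "only {''cnt''} s2 s'" "counted l s'" "partial l (?P (2 ^ l)) s'" by auto
  show "counted l s'" by (rule fin(2))
  have "?P (2 ^ l) v c \<longleftrightarrow> rank_of l v c < Suc r" if "v < 2 ^ Suc l" "c \<in> {1..k}" for v c
    using pick_unique[OF r(1) that(2), of l v] that(1) by auto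
  then show "partial l (\<lambda>v c. rank_of l v c < Suc r) s'" by (intro pcong[OF fin(3)]) auto
  show "only WC s s'"
    using fin(1) det by (auto simp: only_def s1_def upd_def)
  show "s' ''q'' 0 = s ''q'' 0 + rows l r"
    using onlyD[OF fin(1), of "''q''"] det cells by (simp add: rows_def j_def)
qed

end

text \<open>The summands are the constant guesses, the search for a wrong colour at each position,
  and the tree. The last guess, the code itself, is not included; hence
  \<open>Suc (questions n k)\<close> in the bounds.\<close>

definition questions :: "nat \<Rightarrow> nat \<Rightarrow> nat" where
  "questions n k = k + Suc (set_of 2 (n - 1)) +
     (\<Sum>l<depth n. \<Sum>r<min k (2 ^ (depth n - l)).
        Suc (set_of (bits (2 ^ (depth n - l)) r) (2 ^ l - 1)))"

context game
begin

lemma ready_only: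
  assumes "ready s" "only W s s'"
    "''n'' \<notin> W" "''k'' \<notin> W" "''N'' \<notin> W" "''L'' \<notin> W" "''off'' \<notin> W" "''base'' \<notin> W" "''dum'' \<notin> W"
  shows "ready s'"
  using assms std_only[of s W s'] by (simp add: ready_def only_def)

lemma split_level_correct:
  assumes s: "ready s" and l: "l < L" and c: "counted l s" "partial l (\<lambda>_ _. False) s"
    and s': "s' = split_level A l s"
  shows "only (WC \<union> {''l''}) s s' \<and> counted (Suc l) s' \<and> partial (Suc l) (\<lambda>_ _. False) s' \<and>
    s' ''q'' 0 = s ''q'' 0 + (\<Sum>r<min k (2 ^ (L - l)). rows l r)"
proof -
  let ?w = "2 ^ (L - l) :: nat"
  let ?R = "min k ?w"
  define s1 where "s1 = upd ''l'' 0 l s"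
  have cells: "s ''N'' 0 = NN" "s ''k'' 0 = k" "s ''L'' 0 = L" using s by (auto simp: ready_def std_def)
  have ready1: "ready s1"
    by (rule ready_only[OF s, of "{''l''}"]) (auto simp: s1_def only_def upd_def)
  have cnt1: "s1 ''cnt'' = s ''cnt''" "s1 ''q'' = s ''q''" by (auto simp: s1_def upd_def)
  have c1: "counted l s1" "partial l (\<lambda>v c. rank_of l v c < 0) s1"
    using c cnt1 by (auto simp: counted_def partial_def)
  have w1: "width s1 = ?w" using cells by (simp add: width_def s1_def upd_def cpow_NN)
  let ?b = "\<lambda>s. if s ''k'' 0 < width s then s ''k'' 0 else width s"
  have s'1: "s' = for_st ?b (split_colour A) s1"
    unfolding s' split_level_def seq_def by (simp add: assign_def s1_def)
  let ?I = "\<lambda>r t. only WC s1 t \<and> counted l t \<and> partial l (\<lambda>v c. rank_of l v c < r) t \<and>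
      t ''q'' 0 = s1 ''q'' 0 + (\<Sum>r'<r. rows l r')"
  have I: "?I ?R s'"
    unfolding s'1
  proof (rule for_st_inv[where I = ?I])
    have "?w \<le> NN" by (rule pow_le_NN(1)) simp
    then show "?R = min (?b s1) (s1 ''N'' 0)"
      unfolding w1 using cells by (auto simp: s1_def upd_def NN_def min_def)
  next
    show "?I 0 s1" using c1 by (simp add: only_refl)
  next
    fix r t assume r: "r < ?R" and J: "?I r t"
    have rt: "ready t" by (rule ready_only[OF ready1, of WC]) (use J in auto)
    have tl: "t ''l'' 0 = l" using J onlyD[of WC s1 t "''l''"] by (simp add: s1_def upd_def)
    note sc = split_colour_correct[OF rt tl l _ _ _ _ refl, of r]
    have "only WC t (split_colour A r t)" "counted l (split_colour A r t)"
      "partial l (\<lambda>v c. rank_of l v c < Suc r) (split_colour A r t)"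
      "split_colour A r t ''q'' 0 = t ''q'' 0 + rows l r"
      using sc r J by auto
    then show "?I (Suc r) (split_colour A r t)" using J only_trans[of WC s1 t] by auto
  qed
  have "counted (Suc l) s'"
    unfolding counted_def
  proof (intro allI impI)
    fix v c :: nat assume v: "2 ^ Suc l \<le> v" "v < 2 ^ Suc (Suc l)" and cc: "c \<in> {1..k}"
    have e: "s' ''cnt'' (v * NN + c) = (if rank_of l (v div 2) c < ?R then node_count (Suc l) v c else 0)"
      using I v cc by (simp add: partial_def)
    \<comment> \<open>The loop stops at rank \<open>min k w\<close>: by \<open>rank_bound\<close> a
      colour of rank at least \<open>w\<close> does not occur below the node, so the initial 0 is
      its count.\<close>
    have "node_count (Suc l) v c = 0" if "\<not> rank_of l (v div 2) c < ?R"
    proof -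
      have "?w \<le> rank_of l (v div 2) c" using that rank_less[OF cc, of l "v div 2"] by auto
      moreover have "Suc (rank_of l (v div 2) c) * node_count l (v div 2) c \<le> ?w" by (rule rank_bound[OF cc])
      ultimately have lt: "Suc (rank_of l (v div 2) c) * node_count l (v div 2) c < Suc (rank_of l (v div 2) c)"
        by linarith
      then have "node_count l (v div 2) c = 0" by (cases "node_count l (v div 2) c") auto
      then have "node_count (Suc l) (2 * (v div 2)) c = 0" "node_count (Suc l) (2 * (v div 2) + 1) c = 0"
        using node_count_split[OF l, of "v div 2" c] by auto
      moreover have "v = 2 * (v div 2) \<or> v = 2 * (v div 2) + 1" by presburger
      ultimately show ?thesis by metis
    qed
    then show "s' ''cnt'' (v * NN + c) = node_count (Suc l) v c" using e by auto
  qed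
  moreover have "partial (Suc l) (\<lambda>_ _. False) s'"
    unfolding partial_def
  proof (intro allI impI)
    fix v c :: nat assume v: "2 ^ Suc (Suc l) \<le> v" and cc: "c \<in> {1..k}"
    have "(2::nat) ^ Suc l \<le> 2 ^ Suc (Suc l)" by simp
    then have "2 ^ Suc l \<le> v" using v by (rule order_trans)
    moreover have "\<not> v < 2 ^ Suc (Suc l)" using v by simp
    ultimately have "s' ''cnt'' (v * NN + c) = 0" using I cc unfolding partial_def by auto
    then show "s' ''cnt'' (v * NN + c) =
        (if v < 2 ^ Suc (Suc (Suc l)) \<and> False then node_count (Suc (Suc l)) v c else 0)" by simp
  qed
  moreover have "only (WC \<union> {''l''}) s s'" using I by (auto simp: only_def s1_def upd_def)
  ultimately show ?thesis using I cnt1(2) by simp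
qed

lemma play_correct:
  assumes h: "h = play A (init_state n k [])"
  shows "h ''q'' 0 = Suc (questions n k)" "dec n (h ''log'' (questions n k)) = z"
proof -
  define s0 where "s0 = init_state n k []"
  have std0: "std s0" and cnt0: "\<And>x. s0 ''cnt'' x = 0" and q0: "s0 ''q'' 0 = 0"
    by (auto simp: s0_def init_state_def input_state_def upd_def std_def NN_def)
  define s1 where "s1 = count_colours A s0"
  note cc = count_colours_correct[OF std0 cnt0 s1_def]
  have std1: "std s1" by (rule std_only[OF std0 cc(1)]) auto
  define s2 where "s2 = find_zero A s1"
  have "s1 ''cnt'' (NN + 2) = colour_count 2" using cc(3)[of "NN + 2"] k by simp
  note fz = find_zero_correct[OF std1 this s2_def]
  have std2: "std s2" by (rule std_only[OF std1 fz(1)]) auto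
  have cnt2: "s2 ''cnt'' = s1 ''cnt''" using onlyD[OF fz(1)] by auto
  define s3 where "s3 = upd ''L'' 0 L (upd ''base'' 0 0 (upd ''off'' 0 0 s2))"
  have Lsum: "(\<Sum>i<NN. if cpow NN i < n then 1 else 0) = L"
  proof -
    have "(\<Sum>i<NN. if cpow NN i < n then 1 else 0) = (\<Sum>i<NN. if i \<in> {i. 2 ^ i < n} then 1 else (0::nat))"
      by (rule sum.cong) (auto simp: cpow_eq)
    also have "\<dots> = card {..<L}"
      unfolding depth_set L_def[symmetric] by (rule sum_if_set) (use L_NN in auto)
    finally show ?thesis by simp
  qed
  have w3: "assign ''L'' (\<lambda>s. 0) (\<lambda>s. \<Sum>i<s ''N'' 0. if cpow (s ''N'' 0) i < s ''n'' 0 then 1 else 0)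
     (assign ''base'' (\<lambda>s. 0) (\<lambda>s. 0) (assign ''off'' (\<lambda>s. 0) (\<lambda>s. 0) s2)) = s3"
    using std2 Lsum by (simp add: assign_def s3_def std_def upd_def)
  have ready3: "ready s3"
    using std2 fz(3) by (auto simp: ready_def s3_def std_def upd_def)
  have cnt3: "s3 ''cnt'' = s1 ''cnt''" using cnt2 by (simp add: s3_def upd_def)
  have counted0: "counted 0 s3"
    unfolding counted_def
  proof (intro allI impI)
    fix v c :: nat assume "2 ^ 0 \<le> v" "v < 2 ^ Suc 0" and c: "c \<in> {1..k}"
    then have "v = 1" by simp
    then show "s3 ''cnt'' (v * NN + c) = node_count 0 v c"
      unfolding cnt3 using cc(3)[of "NN + c"] c node_count_0[of c] by simp
  qed
  have partial0: "partial 0 (\<lambda>_ _. False) s3"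
    unfolding partial_def
  proof (intro allI impI)
    fix v c :: nat assume v: "2 ^ Suc 0 \<le> v" and c: "c \<in> {1..k}"
    have "2 * NN \<le> v * NN" using v by (intro mult_le_mono1) simp
    moreover have "k < NN" by (simp add: NN_def)
    ultimately have "\<not> v * NN + c \<le> NN + k" by linarith
    then show "s3 ''cnt'' (v * NN + c) = (if v < 2 ^ Suc (Suc 0) \<and> False then node_count (Suc 0) v c else 0)"
      unfolding cnt3 using cc(3)[of "v * NN + c"] by simp
  qed
  define s4 where "s4 = for_st (\<lambda>s. s ''L'' 0) (split_level A) s3"
  let ?W = "WC \<union> {''l''}"
  let ?I = "\<lambda>l t. only ?W s3 t \<and> counted l t \<and> partial l (\<lambda>_ _. False) t \<and>
      t ''q'' 0 = s3 ''q'' 0 + (\<Sum>l'<l. \<Sum>r<min k (2 ^ (L - l')). rows l' r)"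
  have I: "?I L s4"
    unfolding s4_def
  proof (rule for_st_inv[where I = ?I])
    show "L = min (s3 ''L'' 0) (s3 ''N'' 0)"
      using ready3 L_NN by (simp add: ready_def std_def)
    show "?I 0 s3" using counted0 partial0 by (simp add: only_refl)
  next
    fix l t assume l: "l < L" and J: "?I l t"
    have "ready t" by (rule ready_only[OF ready3, of ?W]) (use J in auto)
    from split_level_correct[OF this l _ _ refl] J
    have "only ?W t (split_level A l t)" "counted (Suc l) (split_level A l t)"
      "partial (Suc l) (\<lambda>_ _. False) (split_level A l t)"
      "split_level A l t ''q'' 0 = t ''q'' 0 + (\<Sum>r<min k (2 ^ (L - l)). rows l r)" by auto
    then show "?I (Suc l) (split_level A l t)" using J only_trans[of ?W s3 t] by auto
  qed
  have ready4: "ready s4" by (rule ready_only[OF ready3, of ?W]) (use I in auto)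
  then have std4: "std s4" and L4: "s4 ''L'' 0 = L" by (auto simp: ready_def)
  let ?g = "\<lambda>i s. \<Sum>c<s ''N'' 0. if c \<le> s ''k'' 0 then min c (s ''N'' 0) *
          s ''cnt'' (min (cpow (s ''N'' 0) (s ''L'' 0) + (i - 1)) (s ''N'' 0) * s ''N'' 0 + c) else 0"
  have h': "h = A (fill ''G'' (\<lambda>s. s ''n'' 0) ?g s4)"
    unfolding h play_def seq_def s4_def w3[symmetric] s2_def s1_def s0_def by simp
  have g: "?g i t = z i" if i: "i \<in> {1..n}" and o: "only {''G''} s4 t" for i t
  proof -
    have t: "t ''N'' 0 = NN" "t ''k'' 0 = k" "t ''L'' 0 = L" "t ''cnt'' = s4 ''cnt''"
      using onlyD[OF o] std4 L4 by (auto simp: std_def)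
    have a: "2 ^ L \<le> ancestor L i" "ancestor L i < 2 ^ Suc L" using ancestor_bounds[OF i, of L] by auto
    have "ancestor L i \<le> NN" using a(2) pow_le_NN(2)[of "Suc L"] by simp
    then have m: "min (cpow NN L + (i - 1)) NN = ancestor L i" by (simp add: ancestor_L cpow_NN)
    have zi: "z i \<in> {1..k}" using z_range[OF i] by simp
    have one: "s4 ''cnt'' (ancestor L i * NN + c) = of_bool (c = z i)" if "c \<in> {1..k}" for c
    proof -
      have "ancestor L i' = ancestor L i \<longleftrightarrow> i' = i" if "i' \<in> {1..n}" for i'
        using i that unfolding ancestor_L by auto
      then have "{i' \<in> {1..n}. ancestor L i' = ancestor L i \<and> z i' = c} = (if c = z i then {i} else {})"
        using i by auto
      then have "node_count L (ancestor L i) c = of_bool (c = z i)" by (simp add: node_count_def)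
      moreover have "s4 ''cnt'' (ancestor L i * NN + c) = node_count L (ancestor L i) c"
        using I a that by (simp add: counted_def)
      ultimately show ?thesis by simp
    qed
    have "?g i t = (\<Sum>c<NN. if c = z i then c else 0)"
      unfolding t m
    proof (rule sum.cong[OF refl])
      fix c assume "c \<in> {..<NN}"
      then have "min c NN = c" by simp
      then show "(if c \<le> k then min c NN * s4 ''cnt'' (ancestor L i * NN + c) else 0) = (if c = z i then c else 0)"
        using one[of c] zi by (cases "c = 0") auto
    qed
    also have "\<dots> = z i"
      by (rule sum_delta_cond) (use zi in \<open>auto simp: NN_def\<close>)
    finally show ?thesis .
  qed
  have Q: "s4 ''q'' 0 = questions n k"
  proof -
    have "s3 ''q'' = s2 ''q''" by (simp add: s3_def upd_def)
    then show ?thesis using I fz(2) cc(2) q0 by (simp add: questions_def L_def rows_def)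
  qed
  have "h ''q'' 0 = s4 ''q'' 0 + 1 \<and> dec n (h ''log'' (s4 ''q'' 0)) = restrict z {1..n}"
    using ask_fill(3,4)[OF std4 _ _ h', of z] g z_range by blast
  moreover have "restrict z {1..n} = z" using z unfolding codes_def by (rule PiE_restrict)
  ultimately show "h ''q'' 0 = Suc (questions n k)" "dec n (h ''log'' (questions n k)) = z"
    using Q by auto
qed

end

theorem strategy_exists:
  "\<exists>\<sigma>. polynomial_time \<sigma> \<and> (\<forall>n k B. 1 \<le> n \<longrightarrow> 2 \<le> k \<longrightarrow> real (Suc (questions n k)) \<le> B \<longrightarrow>
     wins_within n k (\<sigma> n k) B)"
proof -
  obtain p where p: "sreads p \<inter> hidden = {}" "swrites p \<inter> (hidden \<union> inputs) = {}"
    and run: "\<And>A v s. run A p v s = play A s"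
    using prog_play by (auto simp: prog_def)
  have "polynomial_time (strategy_of p)"
    by (rule polynomial_time_strategy_of) (use p in \<open>auto simp: hidden_def inputs_def\<close>)
  moreover have "wins_within n k (strategy_of p n k) B"
    if "1 \<le> n" "2 \<le> k" "real (Suc (questions n k)) \<le> B" for n k B
  proof (rule strategy_of_wins[OF p])
    fix z assume "z \<in> codes n k"
    then interpret game n k z using that by unfold_locales auto
    show "\<exists>q. real (Suc q) \<le> B \<and> (let h = run (honest n k z) p (\<lambda>_. 0) (init_state n k []) in
        h ''q'' 0 = Suc q \<and> dec n (h ''log'' q) = z)"
      unfolding run Let_def using that(3) play_correct[OF refl] by blast
  qed (use that in simp)
  ultimately show ?thesis by blast
qed

section \<open>Counting the questions\<close>

text \<open>Double counting: with the digit \<open>i\<close> fixed, at most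
  \<open>2 ^ a / 2 ^ i\<close> ranks have counts long enough to reach it. If \<open>k\<close> is
  large, the right side is geometric, so all counts of a node together take a number of bits linear
  in its width.\<close>

lemma sum_bits_le: "(\<Sum>r<min k (2 ^ a). bits (2 ^ a) r) \<le> (\<Sum>e\<le>a. min k (2 ^ e))"
proof -
  let ?K = "min k (2 ^ a)"
  have b: "bits (2 ^ a) r = (\<Sum>i\<le>a. if Suc r * 2 ^ i \<le> 2 ^ a then 1 else 0)" for r
  proof -
    have "i \<le> a" if "Suc r * 2 ^ i \<le> 2 ^ a" for i
    proof -
      have "(2::nat) ^ i \<le> Suc r * 2 ^ i" by simp
      then have "(2::nat) ^ i \<le> 2 ^ a" using that by (rule order_trans)
      then show ?thesis by simp
    qed
    then have "{i. Suc r * 2 ^ i \<le> 2 ^ a} = {..a} \<inter> {i. Suc r * 2 ^ i \<le> 2 ^ a}" by blast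
    then show ?thesis unfolding bits_def by (simp add: sum.If_cases)
  qed
  have "(\<Sum>r<?K. bits (2 ^ a) r) = (\<Sum>i\<le>a. \<Sum>r<?K. if Suc r * 2 ^ i \<le> 2 ^ a then 1 else 0)"
    unfolding b by (rule sum.swap)
  also have "\<dots> \<le> (\<Sum>i\<le>a. min k (2 ^ (a - i)))"
  proof (rule sum_mono)
    fix i assume "i \<in> {..a}"
    then have e: "(2::nat) ^ a = 2 ^ (a - i) * 2 ^ i" by (simp add: power_add[symmetric])
    have "(\<Sum>r<?K. if Suc r * 2 ^ i \<le> 2 ^ a then 1 else 0) = card ({..<?K} \<inter> {r. Suc r * 2 ^ i \<le> 2 ^ a})"
      by (simp add: sum.If_cases)
    also have "\<dots> \<le> card {..<min k (2 ^ (a - i))}"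
    proof (rule card_mono)
      show "{..<?K} \<inter> {r. Suc r * 2 ^ i \<le> 2 ^ a} \<subseteq> {..<min k (2 ^ (a - i))}"
      proof
        fix r assume r: "r \<in> {..<?K} \<inter> {r. Suc r * 2 ^ i \<le> 2 ^ a}"
        then have "Suc r * 2 ^ i \<le> 2 ^ (a - i) * 2 ^ i" using e by auto
        then have "Suc r \<le> 2 ^ (a - i)" by (simp only: mult_le_cancel2) simp
        with r show "r \<in> {..<min k (2 ^ (a - i))}" by auto
      qed
    qed simp
    finally show "(\<Sum>r<?K. if Suc r * 2 ^ i \<le> 2 ^ a then 1 else 0) \<le> min k (2 ^ (a - i))" by simp
  qed
  also have "\<dots> = (\<Sum>e\<le>a. min k (2 ^ e))"
    by (rule sum.reindex_bij_witness[of _ "\<lambda>i. a - i" "\<lambda>i. a - i"]) auto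
  finally show ?thesis .
qed

text \<open>The summands are bounded by a geometric sequence up to \<open>d\<close>; each further
  one is at most \<open>k\<close>, hence at most \<open>2 ^ d\<close>.\<close>

lemma sum_min_le:
  assumes "k \<le> 2 ^ d"
  shows "(\<Sum>e\<le>a. min k (2 ^ e)) \<le> (if a \<le> d then 2 ^ Suc a else 2 ^ d * (2 + (a - d)))"
proof (induction a)
  case (Suc a)
  show ?case
  proof (cases "Suc a \<le> d")
    case True
    then have "(\<Sum>e\<le>a. min k (2 ^ e)) \<le> 2 ^ Suc a" using Suc.IH by simp
    moreover have "min k (2 ^ Suc a) \<le> 2 ^ Suc a" by simp
    ultimately have "(\<Sum>e\<le>Suc a. min k (2 ^ e)) \<le> 2 ^ Suc a + 2 ^ Suc a"
      unfolding sum.atMost_Suc by (rule add_mono)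
    then show ?thesis using True by simp
  next
    case False
    have "(\<Sum>e\<le>a. min k (2 ^ e)) \<le> 2 ^ d * (2 + (a - d))"
      using Suc.IH False by (cases "a = d") auto
    moreover have "min k (2 ^ Suc a) \<le> 2 ^ d" using assms by (rule min.coboundedI1)
    ultimately have "(\<Sum>e\<le>Suc a. min k (2 ^ e)) \<le> 2 ^ d * (2 + (a - d)) + 2 ^ d"
      unfolding sum.atMost_Suc by (rule add_mono)
    also have "\<dots> = 2 ^ d * (2 + (Suc a - d))" using False by (simp add: Suc_diff_le)
    finally show ?thesis using False by simp
  qed
qed simp

text \<open>The full series: \<open>(y + 1) * (y + 2) * x ^ y\<close> sums to
  \<open>2 / (1 - x) ^ 3\<close>, which is 16 at \<open>x = 1 / 2\<close>, and the summand for
  \<open>y = 0\<close>, which is 2, is left out.\<close>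

lemma sum_geometric_quadratic:
  "(\<Sum>l<D. (2 + real (D - l)) * (1 + real (D - l)) / 2 ^ (D - l)) \<le> 14"
proof -
  let ?f = "\<lambda>y. (2 + real y) * (1 + real y) / 2 ^ y"
  \<comment> \<open>The added fraction is the exact tail of the series, which turns the bound into
    an identity open to induction.\<close>
  have "(\<Sum>l<D. ?f (D - l)) + (2 * (real D + 1) ^ 2 + 10 * (real D + 1) + 16) / 2 ^ Suc D = 14"
  proof (induction D)
    case (Suc D)
    have "(\<Sum>l<Suc D. ?f (Suc D - l)) = ?f (Suc D) + (\<Sum>l<D. ?f (D - l))"
      by (simp only: sum.lessThan_Suc_shift diff_Suc_Suc diff_zero)
    then show ?case using Suc by (simp add: field_simps power2_eq_square)
  qed simp
  moreover have "(2 * (real D + 1) ^ 2 + 10 * (real D + 1) + 16) / 2 ^ Suc D \<ge> 0" by simp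
  ultimately show ?thesis by linarith
qed

text \<open>Comparison with the logarithm in steps
  \<open>1 / (l + 1) \<le> ln (l + 1) - ln l\<close>. The first summand stays outside, since for
  \<open>L = D + 1\<close> the logarithm is 0.\<close>

lemma sum_harmonic_le:
  assumes "D < L"
  shows "(\<Sum>l\<in>{D..<L}. 1 / (real l + 1)) \<le> 1 / (real D + 1) + ln (real L / (real D + 1))"
  using assms
proof (induction L)
  case (Suc L)
  show ?case
  proof (cases "D = L")
    case True
    then show ?thesis by (simp add: add.commute)
  next
    case False
    then have L: "D < L" using Suc.prems by simp
    have "ln (real L / (real L + 1)) \<le> real L / (real L + 1) - 1"
      by (rule ln_le_minus_one) (use L in auto)
    also have "\<dots> = - (1 / (real L + 1))" by (simp add: field_simps)
    finally have "1 / (real L + 1) \<le> ln (real L + 1) - ln (real L)"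
      using L by (simp add: ln_div)
    moreover have "(\<Sum>l\<in>{D..<Suc L}. 1 / (real l + 1)) =
        (\<Sum>l\<in>{D..<L}. 1 / (real l + 1)) + 1 / (real L + 1)" using L by simp
    moreover have "ln (real (Suc L) / (real D + 1)) = ln (real L + 1) - ln (real D + 1)"
      "ln (real L / (real D + 1)) = ln (real L) - ln (real D + 1)"
      using L by (simp_all add: ln_div add.commute)
    ultimately show ?thesis using Suc.IH[OF L] by linarith
  qed
qed simp

text \<open>From level \<open>L - d\<close> on, a node has at most \<open>2 ^ d\<close> leaves, the
  bits per node are linear in its width, and only the saving \<open>l + 1\<close> matters. Closer to
  the root the number of colours is the bottleneck, and the cost decays geometrically in the
  distance \<open>L - d - l\<close>.\<close>

lemma level_questions_le:
  fixes n k l :: nat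
  defines "L \<equiv> depth n" and "d \<equiv> depth k"
  assumes l: "l < L"
  shows "real (\<Sum>r<min k (2 ^ (L - l)). Suc (set_of (bits (2 ^ (L - l)) r) (2 ^ l - 1))) \<le>
    12 * 2 ^ L * (if L - d \<le> l then 2 / (real l + 1)
      else (2 + real (L - d - l)) / 2 ^ (L - d - l) / (real l + 1))"
proof -
  let ?a = "L - l"
  let ?rows = "\<lambda>r. Suc (set_of (bits (2 ^ ?a) r) (2 ^ l - 1))"
  let ?B = "\<Sum>e\<le>?a. min k (2 ^ e)"
  have "(\<Sum>r<min k (2 ^ ?a). ?rows r) * Suc l \<le> (\<Sum>r<min k (2 ^ ?a). 12 * 2 ^ l * bits (2 ^ ?a) r)"
    unfolding sum_distrib_right
    by (intro sum_mono rows_bound bits_pos) auto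
  also have "\<dots> = 12 * 2 ^ l * (\<Sum>r<min k (2 ^ ?a). bits (2 ^ ?a) r)"
    by (simp only: sum_distrib_left)
  also have "\<dots> \<le> 12 * 2 ^ l * ?B" by (intro mult_le_mono2 sum_bits_le)
  finally have "real ((\<Sum>r<min k (2 ^ ?a). ?rows r) * Suc l) \<le> real (12 * 2 ^ l * ?B)"
    by (rule of_nat_mono)
  then have 0: "real (\<Sum>r<min k (2 ^ ?a). ?rows r) * (1 + real l) \<le> 12 * 2 ^ l * real ?B"
    by (simp only: of_nat_mult of_nat_Suc of_nat_power of_nat_numeral)
  have pos: "0 < real l + 1" by simp
  have 1: "real (\<Sum>r<min k (2 ^ ?a). ?rows r) \<le> 12 * 2 ^ l * real ?B / (real l + 1)"
    unfolding pos_le_divide_eq[OF pos] using 0 by (simp only: add.commute)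
  have B: "?B \<le> (if ?a \<le> d then 2 ^ Suc ?a else 2 ^ d * (2 + (?a - d)))"
    by (rule sum_min_le) (simp add: d_def depth_ge)
  show ?thesis
  proof (cases "L - d \<le> l")
    case True
    then have "?B \<le> 2 ^ Suc ?a" using B by (simp split: if_splits)
    then have "real ?B \<le> real (2 ^ Suc ?a)" by (rule of_nat_mono)
    then have "2 ^ l * real ?B \<le> 2 ^ l * 2 ^ Suc ?a" by (intro mult_left_mono) auto
    also have "\<dots> = 2 * 2 ^ L" using l by (simp add: power_add[symmetric])
    finally have "12 * 2 ^ l * real ?B / (real l + 1) \<le> 12 * (2 * 2 ^ L) / (real l + 1)"
      by (intro divide_right_mono) auto
    then show ?thesis using 1 True by simp
  next
    case False
    let ?y = "L - d - l"
    have "?a - d = ?y" "\<not> ?a \<le> d" using False by auto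
    then have "?B \<le> 2 ^ d * (2 + ?y)" using B by (simp only: if_False)
    then have "real ?B \<le> real (2 ^ d * (2 + ?y))" by (rule of_nat_mono)
    then have "real ?B \<le> 2 ^ d * (2 + real ?y)"
      by (simp only: of_nat_mult of_nat_add of_nat_power of_nat_numeral)
    then have "2 ^ l * real ?B \<le> 2 ^ l * (2 ^ d * (2 + real ?y))" by (rule mult_left_mono) simp
    also have "\<dots> = 2 ^ L * ((2 + real ?y) / 2 ^ ?y)"
    proof -
      have "(2::real) ^ L = 2 ^ l * 2 ^ d * 2 ^ ?y" using False by (simp add: power_add[symmetric])
      then show ?thesis by (simp add: field_simps)
    qed
    finally have "12 * 2 ^ l * real ?B / (real l + 1) \<le>
        12 * (2 ^ L * ((2 + real ?y) / 2 ^ ?y)) / (real l + 1)"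
      by (intro divide_right_mono) auto
    then show ?thesis using 1 False by simp
  qed
qed

lemma tree_questions_le:
  fixes n k :: nat
  defines "L \<equiv> depth n" and "D \<equiv> depth n - depth k"
  assumes D: "D < L"
  shows "real (\<Sum>l<L. \<Sum>r<min k (2 ^ (L - l)). Suc (set_of (bits (2 ^ (L - l)) r) (2 ^ l - 1))) \<le>
    12 * 2 ^ L * (16 / (real D + 1) + 2 * ln (real L / (real D + 1)))"
proof -
  let ?g = "\<lambda>l. if D \<le> l then 2 / (real l + 1) else (2 + real (D - l)) / 2 ^ (D - l) / (real l + 1)"
  have "real (\<Sum>l<L. \<Sum>r<min k (2 ^ (L - l)). Suc (set_of (bits (2 ^ (L - l)) r) (2 ^ l - 1))) \<le>
      (\<Sum>l<L. 12 * 2 ^ L * ?g l)"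
    unfolding of_nat_sum[of _ "{..<L}"]
  proof (rule sum_mono)
    fix l assume "l \<in> {..<L}"
    then show "real (\<Sum>r<min k (2 ^ (L - l)). Suc (set_of (bits (2 ^ (L - l)) r) (2 ^ l - 1))) \<le> 12 * 2 ^ L * ?g l"
      using level_questions_le[of l n k] by (simp only: L_def D_def lessThan_iff)
  qed
  also have "\<dots> = 12 * 2 ^ L * (\<Sum>l<L. ?g l)" by (simp only: sum_distrib_left)
  finally have 1: "real (\<Sum>l<L. \<Sum>r<min k (2 ^ (L - l)). Suc (set_of (bits (2 ^ (L - l)) r) (2 ^ l - 1))) \<le>
      12 * 2 ^ L * (\<Sum>l<L. ?g l)" .
  have 2: "(\<Sum>l<L. ?g l) = (\<Sum>l<D. ?g l) + (\<Sum>l\<in>{D..<L}. ?g l)"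
    unfolding lessThan_atLeast0
    by (rule sum.atLeastLessThan_concat[symmetric]) (use D in auto)
  have 3: "(\<Sum>l<D. ?g l) \<le> 14 / (real D + 1)"
  proof -
    have "(\<Sum>l<D. ?g l) \<le> (\<Sum>l<D. (2 + real (D - l)) * (1 + real (D - l)) / 2 ^ (D - l) / (real D + 1))"
    proof (rule sum_mono)
      fix l assume "l \<in> {..<D}"
      then obtain y where y: "D = l + y" "y > 0" by (metis lessThan_iff less_imp_add_positive)
      \<comment> \<open>Trades \<open>1 / (l + 1)\<close> for \<open>1 / (D + 1)\<close> at the
        price of a factor \<open>1 + y\<close>, which the geometric decay in \<open>y\<close>
        absorbs.\<close>
      have "real D + 1 \<le> (1 + real y) * (real l + 1)" using y by (simp add: algebra_simps)
      then have "1 / (real l + 1) \<le> (1 + real y) / (real D + 1)"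
        by (simp add: field_simps)
      then have "(2 + real y) / 2 ^ y * (1 / (real l + 1)) \<le> (2 + real y) / 2 ^ y * ((1 + real y) / (real D + 1))"
        by (intro mult_left_mono) auto
      then show "?g l \<le> (2 + real (D - l)) * (1 + real (D - l)) / 2 ^ (D - l) / (real D + 1)"
        using y by simp
    qed
    also have "\<dots> = (\<Sum>l<D. (2 + real (D - l)) * (1 + real (D - l)) / 2 ^ (D - l)) / (real D + 1)"
      by (simp only: sum_divide_distrib)
    also have "\<dots> \<le> 14 / (real D + 1)"
      using sum_geometric_quadratic by (intro divide_right_mono) auto
    finally show ?thesis .
  qed
  have "(\<Sum>l\<in>{D..<L}. ?g l) = 2 * (\<Sum>l\<in>{D..<L}. 1 / (real l + 1))"
    unfolding sum_distrib_left by (rule sum.cong) auto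
  also have "\<dots> \<le> 2 * (1 / (real D + 1) + ln (real L / (real D + 1)))"
    using sum_harmonic_le[OF D] by simp
  finally have "(\<Sum>l<L. ?g l) \<le> 14 / (real D + 1) + 2 * (1 / (real D + 1) + ln (real L / (real D + 1)))"
    unfolding 2 using 3 by (intro add_mono)
  also have "\<dots> = 16 / (real D + 1) + 2 * ln (real L / (real D + 1))"
  proof -
    have "14 / a + 2 * (1 / a + x) = 16 / a + 2 * x" for a x :: real
    proof -
      have "14 / a + 2 / a = 16 / a" by (simp add: add_divide_distrib[symmetric])
      then show ?thesis by (simp add: distrib_left add.assoc[symmetric])
    qed
    then show ?thesis by blast
  qed
  finally have "12 * 2 ^ L * (\<Sum>l<L. ?g l) \<le>
      12 * 2 ^ L * (16 / (real D + 1) + 2 * ln (real L / (real D + 1)))"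
    by (intro mult_left_mono) auto
  with 1 show ?thesis by (rule order_trans)
qed

section \<open>From depths to logarithms\<close>

lemma depth_log:
  assumes "n \<ge> 2"
  shows "log 2 (real n) \<le> real (depth n)" "real (depth n) \<le> log 2 (real n) + 1" "depth n \<ge> 1"
proof -
  have "real n \<le> real (2 ^ depth n)" using depth_ge by (rule of_nat_mono)
  then have "log 2 (real n) \<le> log 2 (real (2 ^ depth n))" using assms by (intro log_mono) auto
  then show "log 2 (real n) \<le> real (depth n)" by (simp add: log_nat_power)
  have "real (2 ^ depth n) \<le> real (2 * n)" using depth_le[of n] assms by (intro of_nat_mono) simp
  then have "log 2 (real (2 ^ depth n)) \<le> log 2 (2 * real n)" by (intro log_mono) auto
  then show "real (depth n) \<le> log 2 (real n) + 1" using assms by (simp add: log_nat_power log_mult)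
  have "depth n \<noteq> 0" using depth_ge[of n] assms by (cases "depth n") auto
  then show "depth n \<ge> 1" by simp
qed

lemma questions_le:
  fixes n k :: nat
  defines "L \<equiv> depth n" and "D \<equiv> depth n - depth k"
  assumes n: "n \<ge> 2" and k: "k \<ge> 2"
  shows "real (Suc (questions n k)) \<le> real k + 1 + 24 * real n / log 2 (real n) +
    24 * real n * (16 / (real D + 1) + 2 * ln (real L / (real D + 1)))"
    and "real D + 1 \<le> real L"
proof -
  have L1: "L \<ge> 1" using depth_log(3)[OF n] by (simp add: L_def)
  have "depth k \<ge> 1" using depth_log(3)[OF k] .
  then have D: "D < L" using L1 by (simp add: D_def L_def)
  then show "real D + 1 \<le> real L" by simp
  have "2 ^ L \<le> 2 * n" unfolding L_def by (rule depth_le) (use n in simp)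
  then have "2 ^ (L - 1) \<le> n" using L1 by (cases L) auto
  \<comment> \<open>Here the unknowns are the \<open>n\<close> positions with two bits each, so 24
    is \<open>12 * 2\<close>; the exponent \<open>L - 1\<close> makes the saved factor exactly
    \<open>L\<close>.\<close>
  from rows_bound[OF _ this, of 2] L1 have "Suc (set_of 2 (n - 1)) * L \<le> 24 * n" by simp
  then have "real (Suc (set_of 2 (n - 1)) * L) \<le> real (24 * n)" by (rule of_nat_mono)
  then have "real (Suc (set_of 2 (n - 1))) \<le> 24 * real n / real L"
    using L1 by (simp add: field_simps)
  also have "\<dots> \<le> 24 * real n / log 2 (real n)"
    using depth_log(1)[OF n] n L1 by (intro divide_left_mono mult_pos_pos) (auto simp: L_def)
  finally have 1: "real (Suc (set_of 2 (n - 1))) \<le> 24 * real n / log 2 (real n)" .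
  have "real (\<Sum>l<L. \<Sum>r<min k (2 ^ (L - l)). Suc (set_of (bits (2 ^ (L - l)) r) (2 ^ l - 1))) \<le>
    12 * 2 ^ L * (16 / (real D + 1) + 2 * ln (real L / (real D + 1)))"
    using tree_questions_le[of n k] D unfolding L_def D_def by blast
  also have "\<dots> \<le> 12 * (2 * real n) * (16 / (real D + 1) + 2 * ln (real L / (real D + 1)))"
  proof (intro mult_right_mono mult_left_mono)
    have "real (2 ^ L) \<le> real (2 * n)" using \<open>2 ^ L \<le> 2 * n\<close> by (rule of_nat_mono)
    then show "2 ^ L \<le> 2 * real n" by simp
    show "0 \<le> 16 / (real D + 1) + 2 * ln (real L / (real D + 1))"
      using D by (intro add_nonneg_nonneg mult_nonneg_nonneg ln_ge_zero) (auto simp: field_simps)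
  qed auto
  finally have 2: "real (\<Sum>l<L. \<Sum>r<min k (2 ^ (L - l)). Suc (set_of (bits (2 ^ (L - l)) r) (2 ^ l - 1))) \<le>
    24 * real n * (16 / (real D + 1) + 2 * ln (real L / (real D + 1)))" by simp
  have "real (Suc (questions n k)) = real k + 1 + real (Suc (set_of 2 (n - 1))) +
    real (\<Sum>l<L. \<Sum>r<min k (2 ^ (L - l)). Suc (set_of (bits (2 ^ (L - l)) r) (2 ^ l - 1)))"
    by (simp add: questions_def L_def)
  with 1 2 show "real (Suc (questions n k)) \<le> real k + 1 + 24 * real n / log 2 (real n) +
    24 * real n * (16 / (real D + 1) + 2 * ln (real L / (real D + 1)))" by linarith
qed

lemma ln2_ge_half: "ln (2::real) \<ge> 1 / 2"
  using ln_le_minus_one[of "1 / 2 :: real"] by (simp add: ln_div)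

lemma ln_le_log2: "x \<ge> 1 \<Longrightarrow> ln x \<le> log 2 x"
proof -
  assume x: "x \<ge> 1"
  have "ln (2::real) \<le> 1" using ln_le_minus_one[of "2::real"] by simp
  moreover have "0 < ln (2::real)" by simp
  ultimately show ?thesis using x by (simp add: log_def pos_le_divide_eq mult_left_le)
qed

lemma log2_le: "x > 0 \<Longrightarrow> log 2 x \<le> x"
proof -
  assume x: "x > 0"
  have "ln x \<le> x / 2 + ln 2 - 1" using ln_le_minus_one[of "x / 2"] x by (simp add: ln_div)
  moreover have l2: "ln (2::real) \<ge> 1 / 2" using ln2_ge_half .
  moreover have "ln (2::real) \<le> 1" using ln_le_minus_one[of "2::real"] by simp
  moreover have "x * (1 / 2) \<le> x * ln 2" using x l2 by (intro mult_left_mono) auto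
  ultimately have "ln x \<le> x * ln 2" by linarith
  then show ?thesis using l2 by (simp add: log_def pos_divide_le_eq)
qed

text \<open>The gap between the depths of \<open>n\<close> and \<open>k\<close> is bounded below by
  0 only. For \<open>n \<ge> 16\<close> the iterated logarithm is at least 2 and absorbs all
  additive constants.\<close>

theorem questions_many_colours:
  assumes n: "n \<ge> 16" and k: "k \<ge> 2"
  shows "real (Suc (questions n k)) \<le> 1000 * (real n * log 2 (log 2 (real n)) + real k)"
proof -
  let ?l = "log 2 (real n)" and ?D = "depth n - depth k"
  have l4: "?l \<ge> 4" using n by (subst le_log_iff) auto
  have ll: "log 2 ?l \<ge> 2" using l4 by (subst le_log_iff) auto
  have q: "real (Suc (questions n k)) \<le> real k + 1 + 24 * real n / ?l +
    24 * real n * (16 / (real ?D + 1) + 2 * ln (real (depth n) / (real ?D + 1)))"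
    by (rule questions_le(1)) (use n k in auto)
  have L: "real (depth n) \<le> ?l + 1" "1 \<le> depth n" using depth_log[of n] n by auto
  have "ln (real (depth n) / (real ?D + 1)) \<le> ln (2 * ?l)"
  proof -
    have "real (depth n) / (real ?D + 1) \<le> real (depth n) / 1" by (intro divide_left_mono) auto
    also have "\<dots> = real (depth n)" by simp
    also have "\<dots> \<le> 2 * ?l" using L l4 by linarith
    finally show ?thesis using L l4 by (intro ln_mono) auto
  qed
  also have "\<dots> \<le> log 2 (2 * ?l)" by (rule ln_le_log2) (use l4 in auto)
  also have "\<dots> = 1 + log 2 ?l" using l4 by (simp add: log_mult)
  finally have 1: "ln (real (depth n) / (real ?D + 1)) \<le> 1 + log 2 ?l" .
  have "16 / (real ?D + 1) \<le> 16" by (simp add: divide_le_eq)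
  with 1 ll have "16 / (real ?D + 1) + 2 * ln (real (depth n) / (real ?D + 1)) \<le> 12 * log 2 ?l"
    by linarith
  then have 2: "24 * real n * (16 / (real ?D + 1) + 2 * ln (real (depth n) / (real ?D + 1))) \<le>
      24 * real n * (12 * log 2 ?l)" by (intro mult_left_mono) auto
  have "24 * real n / ?l \<le> 24 * real n / 1" using l4 by (intro divide_left_mono) auto
  also have "real n * 1 \<le> real n * log 2 ?l" using ll by (intro mult_left_mono) linarith+
  then have "24 * real n / 1 \<le> 24 * (real n * log 2 ?l)" by linarith
  finally have 3: "24 * real n / ?l \<le> 24 * (real n * log 2 ?l)" .
  have "0 \<le> real n * log 2 ?l" using ll by simp
  with q 2 3 k show ?thesis by (simp add: algebra_simps)
qed

text \<open>The difficulty is that the target can be as small as the order of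
  \<open>n / log n\<close>, namely for bounded \<open>k\<close>. Every term, even \<open>k\<close>
  and the additive 1, has to be compared with \<open>n\<close> times the logarithm of the ratio. The
  condition \<open>2 * k \<le> n\<close> makes \<open>log (n / k)\<close> at least 1.\<close>

theorem questions_few_colours:
  assumes k: "k \<ge> 2" and kn: "2 * k \<le> n"
  shows "real (Suc (questions n k)) \<le>
    1100 * (real n * log 2 (log 2 (real n) / log 2 (real n / real k)))"
proof -
  let ?l = "log 2 (real n)" and ?x = "log 2 (real n / real k)" and ?D = "depth n - depth k"
  have n: "n \<ge> 4" using k kn by simp
  have kk: "log 2 (real k) \<ge> 1" using k log_mono[of 2 2 "real k"] by simp
  have xe: "?x = ?l - log 2 (real k)" using n k by (simp add: log_divide)
  have "log 2 2 \<le> ?x"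
  proof (rule log_mono)
    have "real (2 * k) \<le> real n" using kn by (rule of_nat_mono)
    then show "2 \<le> real n / real k" using k by (simp add: field_simps)
  qed auto
  then have x1: "?x \<ge> 1" by simp
  then have l2: "?l \<ge> 2" using xe kk by simp
  let ?R = "ln (?l / ?x)"
  \<comment> \<open>With \<open>u = log k / log n\<close> the ratio is \<open>1 / (1 - u)\<close>,
    and \<open>- ln (1 - u) \<ge> u\<close>.\<close>
  have R: "?R \<ge> log 2 (real k) / ?l"
  proof -
    have "ln (?x / ?l) \<le> ?x / ?l - 1" by (rule ln_le_minus_one) (use x1 l2 in auto)
    moreover have "ln (?x / ?l) = - ?R" using x1 l2 by (simp add: ln_div)
    moreover have "1 - ?x / ?l = log 2 (real k) / ?l" using l2 xe by (simp add: field_simps)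
    ultimately show ?thesis by linarith
  qed
  have "1 / ?l \<le> log 2 (real k) / ?l" using kk l2 by (intro divide_right_mono) auto
  then have R1: "1 / ?l \<le> ?R" using R by linarith
  have q: "real (Suc (questions n k)) \<le> real k + 1 + 24 * real n / ?l +
    24 * real n * (16 / (real ?D + 1) + 2 * ln (real (depth n) / (real ?D + 1)))"
    and DL: "real ?D + 1 \<le> real (depth n)"
    by (rule questions_le; use n k in simp)+
  have Dx: "?x \<le> real ?D + 1"
  proof -
    have "real (depth n) - real (depth k) \<le> real ?D" by linarith
    moreover have "?l \<le> real (depth n)" using depth_log(1)[of n] n by simp
    moreover have "real (depth k) \<le> log 2 (real k) + 1" using depth_log(2)[OF k] .
    ultimately show ?thesis using xe by linarith
  qed
  \<comment> \<open>The rounding in \<open>depth\<close> costs the factor \<open>1 + 1 / ?l\<close>,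
    whose logarithm is at most \<open>1 / ?l\<close> and thus at most \<open>?R\<close>.\<close>
  have lnD: "ln (real (depth n) / (real ?D + 1)) \<le> 2 * ?R"
  proof -
    have "real (depth n) \<le> ?l + 1" using depth_log(2)[of n] n by simp
    then have "real (depth n) / (real ?D + 1) \<le> (?l + 1) / ?x"
      using Dx x1 by (intro frac_le) auto
    moreover have "0 < real (depth n) / (real ?D + 1)" using DL by simp
    ultimately have "ln (real (depth n) / (real ?D + 1)) \<le> ln ((?l + 1) / ?x)" by simp
    also have "(?l + 1) / ?x = (?l / ?x) * (1 + 1 / ?l)" using l2 x1 by (simp add: field_simps)
    also have "ln \<dots> = ?R + ln (1 + 1 / ?l)" using l2 x1 by (intro ln_mult_pos) (auto intro: add_pos_pos)
    also have "ln (1 + 1 / ?l) \<le> 1 / ?l" using l2 by (intro ln_add_one_self_le_self) auto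
    finally show ?thesis using R1 by linarith
  qed
  \<comment> \<open>If \<open>log (n / k)\<close> is at least half of \<open>log n\<close>, the left
    side is at most \<open>2 / log n\<close>; otherwise the ratio exceeds 2 and \<open>?R\<close> is
    at least \<open>ln 2\<close>.\<close>
  have D: "1 / (real ?D + 1) \<le> 2 * ?R"
  proof (cases "?x \<ge> ?l / 2")
    case True
    have "1 / (real ?D + 1) \<le> 1 / (?l / 2)"
      using True Dx l2 by (intro divide_left_mono) auto
    also have "\<dots> = 2 * (1 / ?l)" by simp
    finally show ?thesis using R1 by linarith
  next
    case False
    then have "2 \<le> ?l / ?x" using x1 by (simp add: field_simps)
    then have "ln 2 \<le> ?R" by simp
    moreover have "ln (2::real) \<ge> 1 / 2" using ln2_ge_half .
    moreover have "1 / (real ?D + 1) \<le> 1" by simp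
    ultimately show ?thesis by linarith
  qed
  have nR: "real n / ?l \<le> real n * ?R" using mult_left_mono[OF R1, of "real n"] by simp
  \<comment> \<open>Multiplied by \<open>log n = log (n / k) + log k\<close>, the left side splits:
    \<open>k * log (n / k) \<le> n\<close> by \<open>log2_le\<close>, and
    \<open>k * log k \<le> n * log k\<close>.\<close>
  have "real k \<le> 2 * (real n * ?R)"
  proof -
    have "real k * ?x \<le> real k * (real n / real k)"
      using log2_le[of "real n / real k"] n k by (intro mult_left_mono) auto
    then have 1: "real k * ?x \<le> real n" using k by simp
    have "real n \<le> real n * log 2 (real k)" using mult_left_mono[OF kk, of "real n"] by simp
    moreover have "real k * log 2 (real k) \<le> real n * log 2 (real k)"
      using kk kn by (intro mult_right_mono) auto
    moreover have "real k * ?l = real k * ?x + real k * log 2 (real k)"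
    proof -
      have "?l = ?x + log 2 (real k)" using xe by linarith
      then have "real k * ?l = real k * (?x + log 2 (real k))" by (rule arg_cong)
      then show ?thesis by (simp only: distrib_left)
    qed
    ultimately have "real k * ?l \<le> 2 * (real n * log 2 (real k))" using 1 by linarith
    then have "real k \<le> 2 * (real n * (log 2 (real k) / ?l))" using l2 by (simp add: field_simps)
    moreover have "real n * (log 2 (real k) / ?l) \<le> real n * ?R" using R by (intro mult_left_mono) auto
    ultimately show ?thesis by linarith
  qed
  moreover have "1 \<le> real n * ?R"
  proof -
    have "?l \<le> real n" using log2_le[of "real n"] n by simp
    then have "1 \<le> real n / ?l" using l2 by simp
    then show ?thesis using nR by linarith
  qed
  moreover have "24 * real n * (16 / (real ?D + 1) + 2 * ln (real (depth n) / (real ?D + 1))) \<le>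
      24 * real n * (36 * ?R)"
  proof (intro mult_left_mono)
    have "16 / (real ?D + 1) = 16 * (1 / (real ?D + 1))" by simp
    then show "16 / (real ?D + 1) + 2 * ln (real (depth n) / (real ?D + 1)) \<le> 36 * ?R"
      using D lnD by linarith
  qed simp
  moreover have "24 * real n / ?l = 24 * (real n / ?l)" by simp
  ultimately have * : "real k \<le> 2 * (real n * ?R)" "1 \<le> real n * ?R"
    "24 * real n * (16 / (real ?D + 1) + 2 * ln (real (depth n) / (real ?D + 1))) \<le> 24 * real n * (36 * ?R)"
    "24 * real n / ?l = 24 * (real n / ?l)" by blast+
  \<comment> \<open>The coefficients add up to 2 + 1 + 24 + 864 = 891.\<close>
  have "real (Suc (questions n k)) \<le> 1100 * (real n * ?R)"
  proof -
    have "24 * real n * (36 * ?R) = 864 * (real n * ?R)" by simp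
    with * q nR show ?thesis by linarith
  qed
  also have "\<dots> \<le> 1100 * (real n * log 2 (?l / ?x))"
  proof -
    have "?l / ?x \<ge> 1" using xe kk x1 by simp
    then have "?R \<le> log 2 (?l / ?x)" by (rule ln_le_log2)
    then show ?thesis by (intro mult_left_mono) auto
  qed
  finally show ?thesis .
qed

text \<open>Both parts are witnessed by the same strategy, and \<open>C\<close> is chosen before the
  function \<open>k\<close>, so it is absolute. The second part asks for \<open>2 \<le> k n\<close>
  because for a single colour its bound is 0, while even the only code takes one guess.\<close>

theorem theorem3:
  shows "(\<exists>\<sigma> :: nat \<Rightarrow> nat \<Rightarrow> strategy. polynomial_time \<sigma> \<and>
           (\<exists>C>0. \<forall>k :: nat \<Rightarrow> nat. (\<lambda>n. real (k n)) \<in> \<Omega>(\<lambda>n. real n) \<longrightarrow>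
              (\<forall>\<^sub>F n in sequentially.
                 wins_within n (k n) (\<sigma> n (k n))
                   (C * (real n * log 2 (log 2 (real n)) + real (k n))))))
       \<and> (\<exists>\<sigma> :: nat \<Rightarrow> nat \<Rightarrow> strategy. polynomial_time \<sigma> \<and>
           (\<exists>C>0. \<forall>k :: nat \<Rightarrow> nat. (\<lambda>n. real (k n)) \<in> o(\<lambda>n. real n) \<longrightarrow>
              (\<forall>\<^sub>F n in sequentially. 2 \<le> k n \<longrightarrow>
                 wins_within n (k n) (\<sigma> n (k n))
                   (C * (real n * log 2 (log 2 (real n) / log 2 (real n / real (k n))))))))"
proof -
  obtain \<sigma> where poly: "polynomial_time \<sigma>"
    and wins: "\<And>n k B. 1 \<le> n \<Longrightarrow> 2 \<le> k \<Longrightarrow> real (Suc (questions n k)) \<le> B \<Longrightarrow>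
     wins_within n k (\<sigma> n k) B"
    using strategy_exists by blast
  have many: "\<forall>\<^sub>F n in sequentially. wins_within n (k n) (\<sigma> n (k n))
      (1000 * (real n * log 2 (log 2 (real n)) + real (k n)))"
    if k: "(\<lambda>n. real (k n)) \<in> \<Omega>(\<lambda>n. real n)" for k :: "nat \<Rightarrow> nat"
  proof -
    obtain c where c: "c > 0" "\<forall>\<^sub>F n in sequentially. norm (real (k n)) \<ge> c * norm (real n)"
      using k by (rule landau_omega.bigE)
    \<comment> \<open>The constant \<open>c\<close> hidden in the lower bound on \<open>k\<close>
      only delays the start, until \<open>c * n \<ge> 2\<close> provides two colours; it does not
      enter 1000.\<close>
    have "\<forall>\<^sub>F n in sequentially. n \<ge> max 16 (nat \<lceil>2 / c\<rceil>)" by (rule eventually_ge_at_top)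
    with c(2) show ?thesis
    proof eventually_elim
      case (elim n)
      have "2 / c \<le> real n" using elim(2) by linarith
      then have "2 \<le> c * real n" using c(1) by (simp add: field_simps)
      then have "2 \<le> k n" using elim(1) by simp
      then show ?case using elim(2) by (intro wins questions_many_colours) auto
    qed
  qed
  have few: "\<forall>\<^sub>F n in sequentially. 2 \<le> k n \<longrightarrow> wins_within n (k n) (\<sigma> n (k n))
      (1100 * (real n * log 2 (log 2 (real n) / log 2 (real n / real (k n)))))"
    if k: "(\<lambda>n. real (k n)) \<in> o(\<lambda>n. real n)" for k :: "nat \<Rightarrow> nat"
  proof -
    have "\<forall>\<^sub>F n in sequentially. norm (real (k n)) \<le> 1 / 2 * norm (real n)"
      by (rule landau_o.smallD[OF k]) simp
    then show ?thesis
    proof eventually_elim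
      case (elim n)
      then have "2 * k n \<le> n" by simp
      then show ?case by (intro impI wins questions_few_colours) auto
    qed
  qed
  show ?thesis
    using poly many few
    by (intro conjI exI[of _ \<sigma>] exI[of _ "1000::real"] exI[of _ "1100::real"]) auto
qed

end
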